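(* Let $G$ be a countable infinite group and let $H$ be any countable maximally almost periodic group. Then there exists a minimal, free $G$-flow $Y$ whose underlying space is homeomorphic to the Cantor set such that $H$ embeds into $\mathrm{Aut}(Y,G)$.
   Context: A group is maximally almost periodic if it admits an injective homomorphism into a compact group. A $G$-flow is minimal if every orbit is dense and free if every point has trivial stabilizer. $\mathrm{Aut}(Y,G)$ is the group of homeomorphisms of $Y$ commuting with the $G$-action. *)

theory Defs
  imports "HOL-Analysis.Analysis" "HOL-Algebra.Group_Action"
begin

definition compact_group :: "('k, 'm) monoid_scheme \<Rightarrow> 'k topology \<Rightarrow> bool" where
  "compact_group K T \<longleftrightarrow> group K \<and> topspace T = carrier K
     \<and> continuous_map (prod_topology T T) T (\<lambda>p. fst p \<otimes>\<^bsub>K\<^esub> snd p)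
     \<and> continuous_map T T (\<lambda>x. inv\<^bsub>K\<^esub> x)
     \<and> compact_space T \<and> Hausdorff_space T"

definition cantor_space :: "(nat \<Rightarrow> bool) topology" where
  "cantor_space = product_topology (\<lambda>_. discrete_topology UNIV) UNIV"

definition G_flow :: "('g, 'm) monoid_scheme \<Rightarrow> 'y topology \<Rightarrow> ('g \<Rightarrow> 'y \<Rightarrow> 'y) \<Rightarrow> bool" where
  "G_flow G Y act \<longleftrightarrow> group_action G (topspace Y) act
     \<and> (\<forall>g\<in>carrier G. continuous_map Y Y (act g))
     \<and> compact_space Y \<and> Hausdorff_space Y"

definition minimal_flow :: "('g, 'm) monoid_scheme \<Rightarrow> 'y topology \<Rightarrow> ('g \<Rightarrow> 'y \<Rightarrow> 'y) \<Rightarrow> bool" where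
  "minimal_flow G Y act \<longleftrightarrow> (\<forall>y\<in>topspace Y. Y closure_of (orbit G act y) = topspace Y)"

definition free_flow :: "('g, 'm) monoid_scheme \<Rightarrow> 'y topology \<Rightarrow> ('g \<Rightarrow> 'y \<Rightarrow> 'y) \<Rightarrow> bool" where
  "free_flow G Y act \<longleftrightarrow> (\<forall>y\<in>topspace Y. stabilizer G act y = {\<one>\<^bsub>G\<^esub>})"

definition Aut_flow :: "('g, 'm) monoid_scheme \<Rightarrow> 'y topology \<Rightarrow> ('g \<Rightarrow> 'y \<Rightarrow> 'y) \<Rightarrow> ('y \<Rightarrow> 'y) monoid" where
  "Aut_flow G Y act =
    \<lparr> carrier = {f \<in> extensional (topspace Y). homeomorphic_map Y Y f
                   \<and> (\<forall>g\<in>carrier G. \<forall>y\<in>topspace Y. f (act g y) = act g (f y))},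
      mult = (\<lambda>f f'. compose (topspace Y) f f'),
      one = restrict id (topspace Y) \<rparr>"

end

theory Submission
  imports Defs
begin

text \<open>
  The compact group only serves to equip \<open>H\<close> with a totally bounded bi-invariant metric \<open>d\<close>. It then
  suffices to find one configuration \<open>x\<close> on \<open>G\<close>, with values in \<open>H\<close> together with countably many
  \<open>3\<close>-colourings, such that for all finite \<open>F \<subseteq> G\<close>, \<open>\<epsilon> > 0\<close> and \<open>h \<in> H\<close> the pattern of \<open>x\<close> on \<open>F\<close>,
  right-multiplied by \<open>h\<close>, recurs syndetically up to \<open>\<epsilon>\<close>, and such that the \<open>n\<close>-th colouring separates
  \<open>t\<close> from \<open>g\<^sub>n t\<close> for every \<open>t\<close>, where \<open>g\<^sub>0, g\<^sub>1, \<dots>\<close> enumerates \<open>G\<close>. Recording the truth values of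
  \<open>d (x g) k < r\<close> and of the colours, for radii \<open>r\<close> that are never attained, turns \<open>x\<close> into a point of a
  Cantor space: recurrence makes its orbit closure minimal and \<open>H\<close>-invariant, the colours make it free,
  and a free minimal flow of an infinite group has no isolated points.

  The configuration is a limit of points of a decreasing sequence of strongly irreducible,
  shift-invariant and \<open>H\<close>-invariant sets of configurations. In such a set a pattern \<open>p\<close> and finitely
  many translates \<open>p h\<close>, \<open>h\<close> in an \<open>\<epsilon>\<close>-net of \<open>H\<close>, can be glued into one pattern, and demanding that
  this pattern occurs near every point preserves strong irreducibility. This is the only place where
  total boundedness is needed.
\<close>

section \<open>Perfect subsets of the Cantor space\<close>

text \<open>The obstacle is that \<open>H\<close> need not be compact, so a decreasing sequence of
  sets of \<open>H\<close>-valued configurations need not have a common point. Hence finite parts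
  are frozen exactly: each new point agrees with the previous one on a finite set, in the
  \<open>H\<close>-value and in the colours treated so far, and only conditions that can be read off
  finite parts pass to the limit. This is why the recurrence demand comes with a finite set of
  return times that does not depend on the position. Left invariance of \<open>d\<close> makes one
  \<epsilon>-net of \<open>H\<close> serve all places of a pattern at once, because
  \<open>d (p a) (p h) = d a h\<close>; right invariance keeps the sets stable under
  \<open>H\<close>, which multiplies values on the right. Freeness must survive at limit points of
  the orbit, so \<open>t\<close> and \<open>g t\<close> have to be told apart inside a bounded
  window, uniformly in \<open>t\<close>. A proper 3-colouring of the graph joining \<open>t\<close>
  to \<open>g t\<close> does this, and as all degrees are at most 2, it extends from any partial
  colouring, which makes the demand compatible with gluing.\<close>

lemma topspace_cantor_space [simp]: "topspace cantor_space = UNIV"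
  by (simp add: cantor_space_def)

lemma compact_space_cantor_space: "compact_space cantor_space"
  by (simp add: cantor_space_def compact_space_product_topology compact_space_discrete_topology)

lemma Hausdorff_space_cantor_space: "Hausdorff_space cantor_space"
  by (simp add: cantor_space_def Hausdorff_space_product_topology Hausdorff_space_discrete_topology)

lemma openin_cantor_space:
  "openin cantor_space U \<longleftrightarrow> (\<forall>y\<in>U. \<exists>n. \<forall>z. (\<forall>i<n. z i = y i) \<longrightarrow> z \<in> U)"
proof
  assume U: "openin cantor_space U"
  show "\<forall>y\<in>U. \<exists>n. \<forall>z. (\<forall>i<n. z i = y i) \<longrightarrow> z \<in> U"
  proof
    fix y assume "y \<in> U"
    then obtain V where V: "finite {i. V i \<noteq> UNIV}" "\<And>i. y i \<in> V i" "Pi\<^sub>E UNIV V \<subseteq> U"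
      using U unfolding cantor_space_def openin_product_topology_alt by (force simp: PiE_iff)
    obtain n where n: "\<And>i. V i \<noteq> UNIV \<Longrightarrow> i < n"
      using finite_nat_set_iff_bounded[of "{i. V i \<noteq> UNIV}"] V(1) by auto
    have "z \<in> U" if "\<forall>i<n. z i = y i" for z
    proof -
      have "z i \<in> V i" for i
        using that n[of i] V(2)[of i] by (cases "V i = UNIV") auto
      then show ?thesis using V(3) by (auto simp: PiE_iff)
    qed
    then show "\<exists>n. \<forall>z. (\<forall>i<n. z i = y i) \<longrightarrow> z \<in> U" by blast
  qed
next
  assume U: "\<forall>y\<in>U. \<exists>n. \<forall>z. (\<forall>i<n. z i = y i) \<longrightarrow> z \<in> U"
  show "openin cantor_space U"
    unfolding cantor_space_def openin_product_topology_alt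
  proof (intro ballI)
    fix y assume "y \<in> U"
    then obtain n where n: "\<And>z. (\<forall>i<n. z i = y i) \<Longrightarrow> z \<in> U" using U by blast
    show "\<exists>V. finite {i \<in> UNIV. V i \<noteq> topspace (discrete_topology UNIV)} \<and>
        (\<forall>i\<in>UNIV. openin (discrete_topology UNIV) (V i)) \<and> y \<in> Pi\<^sub>E UNIV V \<and> Pi\<^sub>E UNIV V \<subseteq> U"
    proof (intro exI conjI)
      let ?V = "\<lambda>i. if i < n then {y i} else UNIV"
      have "{i \<in> UNIV. ?V i \<noteq> topspace (discrete_topology UNIV)} \<subseteq> {..<n}" by auto
      then show "finite {i \<in> UNIV. ?V i \<noteq> topspace (discrete_topology UNIV)}"
        using finite_subset by blast
      show "Pi\<^sub>E UNIV ?V \<subseteq> U"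
      proof
        fix z assume z: "z \<in> Pi\<^sub>E UNIV ?V"
        have "z i = y i" if "i < n" for i
          using PiE_mem[OF z, of i] that by simp
        then show "z \<in> U" using n by blast
      qed
    qed (auto simp: PiE_iff)
  qed
qed

lemma openin_cylinder: "openin cantor_space {z. \<forall>i<n. z i = y i}"
  unfolding openin_cantor_space by (intro ballI exI[of _ n]) auto

lemma in_closure_of_cantor_space:
  "y \<in> cantor_space closure_of S \<longleftrightarrow> (\<forall>n. \<exists>z\<in>S. \<forall>i<n. z i = y i)"
proof
  assume y: "y \<in> cantor_space closure_of S"
  show "\<forall>n. \<exists>z\<in>S. \<forall>i<n. z i = y i"
  proof
    fix n
    show "\<exists>z\<in>S. \<forall>i<n. z i = y i"
    proof -
      have "y \<in> {z. \<forall>i<n. z i = y i}" by simp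
      then obtain z where "z \<in> S" "z \<in> {z. \<forall>i<n. z i = y i}"
        using y openin_cylinder[of n y] unfolding in_closure_of by meson
      then show ?thesis by blast
    qed
  qed
next
  assume S: "\<forall>n. \<exists>z\<in>S. \<forall>i<n. z i = y i"
  show "y \<in> cantor_space closure_of S"
    unfolding in_closure_of
  proof (intro conjI allI impI)
    fix U assume U: "y \<in> U \<and> openin cantor_space U"
    then obtain n where "\<And>z. (\<forall>i<n. z i = y i) \<Longrightarrow> z \<in> U"
      unfolding openin_cantor_space by blast
    then show "\<exists>z. z \<in> S \<and> z \<in> U" using S by blast
  qed simp
qed

lemma continuous_map_subtopology_cantor_space:
  assumes "\<And>y j. y \<in> P \<Longrightarrow> \<exists>n. \<forall>z\<in>P. (\<forall>i<n. z i = y i) \<longrightarrow> f z j = f y j"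
  shows "continuous_map (subtopology cantor_space P) cantor_space f"
proof -
  have "continuous_map (subtopology cantor_space P) (discrete_topology UNIV) (\<lambda>y. f y j)" for j
    unfolding continuous_map_def
  proof (intro conjI allI impI)
    fix V :: "bool set"
    \<comment> \<open>A union of cylinders of the whole space around points of \<open>P\<close> with
      bit \<open>j\<close> in \<open>V\<close>, each long enough that this bit is constant on its
      part in \<open>P\<close>. So \<open>?W\<close> is open although \<open>f\<close> is controlled
      on \<open>P\<close> only.\<close>
    let ?W = "{w. \<exists>y\<in>P. f y j \<in> V \<and> (\<exists>n. (\<forall>z\<in>P. (\<forall>i<n. z i = y i) \<longrightarrow> f z j = f y j) \<and> (\<forall>i<n. w i = y i))}"
    have "openin cantor_space ?W"
      unfolding openin_cantor_space
    proof
      fix w assume "w \<in> ?W"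
      then obtain y n where y: "y \<in> P" "f y j \<in> V" "\<forall>z\<in>P. (\<forall>i<n. z i = y i) \<longrightarrow> f z j = f y j"
        "\<forall>i<n. w i = y i" by blast
      have "z \<in> ?W" if "\<forall>i<n. z i = w i" for z
      proof -
        have "\<forall>i<n. z i = y i" using y(4) that by simp
        then show ?thesis using y(1-3) by blast
      qed
      then show "\<exists>n. \<forall>z. (\<forall>i<n. z i = w i) \<longrightarrow> z \<in> ?W" by blast
    qed
    moreover have "{x \<in> topspace (subtopology cantor_space P). f x j \<in> V} = ?W \<inter> P"
    proof (intro subset_antisym subsetI)
      fix x assume x: "x \<in> {x \<in> topspace (subtopology cantor_space P). f x j \<in> V}"
      then have "x \<in> P" "f x j \<in> V" by auto
      moreover obtain n where "\<forall>z\<in>P. (\<forall>i<n. z i = x i) \<longrightarrow> f z j = f x j"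
        using assms[OF \<open>x \<in> P\<close>] by blast
      ultimately show "x \<in> ?W \<inter> P" by blast
    next
      fix x assume "x \<in> ?W \<inter> P"
      then obtain y n where "x \<in> P" "f y j \<in> V" "\<forall>z\<in>P. (\<forall>i<n. z i = y i) \<longrightarrow> f z j = f y j"
        "\<forall>i<n. x i = y i" by blast
      then show "x \<in> {x \<in> topspace (subtopology cantor_space P). f x j \<in> V}" by auto
    qed
    ultimately show "openin (subtopology cantor_space P) {x \<in> topspace (subtopology cantor_space P). f x j \<in> V}"
      unfolding openin_subtopology by blast
  qed simp
  then show ?thesis
    unfolding cantor_space_def by (simp add: continuous_map_componentwise_UNIV)
qed

section \<open>Branching positions in the binary tree of prefixes of \<open>P\<close>\<close>

definition branch :: "(nat \<Rightarrow> bool) set \<Rightarrow> (nat \<Rightarrow> bool) \<Rightarrow> nat \<Rightarrow> bool" where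
  "branch P y m \<longleftrightarrow> (\<exists>z\<in>P. (\<forall>i<m. z i = y i) \<and> z m \<noteq> y m)"

definition branch_count :: "(nat \<Rightarrow> bool) set \<Rightarrow> (nat \<Rightarrow> bool) \<Rightarrow> nat \<Rightarrow> nat" where
  "branch_count P y m = card {i. i < m \<and> branch P y i}"

text \<open>The count first exceeds \<open>j\<close> right after branching number \<open>j\<close>,
  counted from 0, so this is its position.\<close>

definition branch_index :: "(nat \<Rightarrow> bool) set \<Rightarrow> (nat \<Rightarrow> bool) \<Rightarrow> nat \<Rightarrow> nat" where
  "branch_index P y j = (LEAST m. j < branch_count P y (Suc m))"

text \<open>Branching at \<open>m\<close> depends on the prefix of length \<open>m\<close> alone: if
  the points differ in bit \<open>m\<close> itself, each witnesses the branching of the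
  other.\<close>

lemma branch_cong:
  assumes "y \<in> P" "z \<in> P" "\<forall>i<m. z i = y i"
  shows "branch P z m = branch P y m"
proof (cases "z m = y m")
  case True
  then show ?thesis unfolding branch_def using assms(3) by auto
next
  case False
  then have "branch P y m" "branch P z m"
    unfolding branch_def using assms by auto
  then show ?thesis by simp
qed

lemma branch_count_Suc:
  "branch_count P y (Suc m) = branch_count P y m + (if branch P y m then 1 else 0)"
proof -
  have "{i. i < Suc m \<and> branch P y i} = {i. i < m \<and> branch P y i} \<union> (if branch P y m then {m} else {})"
    by (auto simp: less_Suc_eq)
  then show ?thesis by (simp add: branch_count_def)
qed

text \<open>The bound is \<open>Suc m\<close> and not \<open>m\<close>: the count below
  \<open>k\<close> involves positions up to \<open>k - 1\<close>, and branching at a position needs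
  only the bits strictly before it.\<close>

lemma branch_count_cong:
  assumes "y \<in> P" "z \<in> P" "\<forall>i<m. z i = y i" "k \<le> Suc m"
  shows "branch_count P z k = branch_count P y k"
proof -
  have "branch P z i = branch P y i" if "i < k" for i
    by (rule branch_cong) (use assms that in auto)
  then have "{i. i < k \<and> branch P z i} = {i. i < k \<and> branch P y i}" by blast
  then show ?thesis by (simp add: branch_count_def)
qed

lemma branch_count_mono: "m \<le> n \<Longrightarrow> branch_count P y m \<le> branch_count P y n"
  unfolding branch_count_def by (rule card_mono) auto

text \<open>
  The homeomorphism onto the Cantor space reads off the bits of a point at its branching positions.
\<close>

locale perfect_subset =
  fixes P :: "(nat \<Rightarrow> bool) set"
  assumes nonempty: "P \<noteq> {}" and closed: "closedin cantor_space P"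
    and perfect: "\<And>y n. y \<in> P \<Longrightarrow> \<exists>z\<in>P. z \<noteq> y \<and> (\<forall>i<n. z i = y i)"
begin

lemma branch_above:
  assumes "y \<in> P" shows "\<exists>m\<ge>n. branch P y m"
proof -
  obtain z where z: "z \<in> P" "z \<noteq> y" "\<forall>i<n. z i = y i" using perfect[OF assms] by blast
  define m where "m = (LEAST i. z i \<noteq> y i)"
  have m: "z m \<noteq> y m" unfolding m_def by (rule LeastI_ex) (use z(2) in auto)
  have "\<forall>i<m. z i = y i" unfolding m_def using not_less_Least by blast
  moreover have "n \<le> m" using m z(3) not_less by blast
  ultimately show ?thesis unfolding branch_def using m z(1) by blast
qed

lemma branch_count_unbounded:
  assumes "y \<in> P" shows "\<exists>m. j < branch_count P y (Suc m)"
proof (induction j)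
  case 0
  obtain m where "branch P y m" using branch_above[OF assms] by blast
  then show ?case by (metis add_is_0 branch_count_Suc gr0I one_neq_zero)
next
  case (Suc j)
  then obtain m where m: "j < branch_count P y (Suc m)" by blast
  obtain n where n: "n \<ge> Suc m" "branch P y n" using branch_above[OF assms] by blast
  have "branch_count P y (Suc m) \<le> branch_count P y n" by (rule branch_count_mono) (use n in auto)
  then have "Suc j < branch_count P y (Suc n)" using m n(2) by (simp add: branch_count_Suc)
  then show ?case by blast
qed

lemma branch_index:
  assumes "y \<in> P"
  shows "branch P y (branch_index P y j)" "branch_count P y (branch_index P y j) = j"
proof -
  define m where "m = branch_index P y j"
  have 1: "j < branch_count P y (Suc m)"
    unfolding m_def branch_index_def by (rule LeastI_ex) (rule branch_count_unbounded[OF assms])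
  have 2: "branch_count P y m \<le> j"
  proof (cases m)
    case 0 then show ?thesis by (simp add: branch_count_def)
  next
    case (Suc k)
    then have "\<not> j < branch_count P y (Suc k)"
      using not_less_Least[of k "\<lambda>m. j < branch_count P y (Suc m)"] m_def branch_index_def by auto
    then show ?thesis using Suc by simp
  qed
  show "branch P y (branch_index P y j)" "branch_count P y (branch_index P y j) = j"
    using 1 2 by (auto simp: branch_count_Suc m_def[symmetric] split: if_splits)
qed

lemma branch_index_eqI:
  assumes "branch P y m" "branch_count P y m = j"
  shows "branch_index P y j = m"
  unfolding branch_index_def
proof (rule Least_equality)
  show "j < branch_count P y (Suc m)" using assms by (simp add: branch_count_Suc)
  fix k assume "j < branch_count P y (Suc k)"
  then show "m \<le> k" using assms(2) branch_count_mono[of "Suc k" m P y] by (metis leD not_less_eq_eq)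
qed

definition code :: "(nat \<Rightarrow> bool) \<Rightarrow> nat \<Rightarrow> bool" where
  "code y j = y (branch_index P y j)"

text \<open>Agreement strictly before the branching position suffices; the bit at that position may
  change, a freedom that \<open>code_dense\<close> exploits.\<close>

lemma branch_index_cong:
  assumes "y \<in> P" "z \<in> P" "\<forall>i<m. z i = y i" "branch_index P y j \<le> m"
  shows "branch_index P z j = branch_index P y j"
proof (rule branch_index_eqI)
  show "branch P z (branch_index P y j)"
    using branch_cong[of y P z "branch_index P y j"] branch_index(1)[OF assms(1)] assms by auto
  show "branch_count P z (branch_index P y j) = j"
    using branch_count_cong[of y P z m "branch_index P y j"] branch_index(2)[OF assms(1)] assms by auto
qed

lemma branch_index_mono:
  assumes "y \<in> P" "j < k" shows "branch_index P y j < branch_index P y k"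
proof (rule ccontr)
  assume "\<not> ?thesis"
  then have "branch_count P y (branch_index P y k) \<le> branch_count P y (branch_index P y j)"
    by (intro branch_count_mono) auto
  then show False using assms by (simp add: branch_index)
qed

text \<open>If bit \<open>N\<close> of the code is wrong, leave \<open>y\<close> at its branching
  number \<open>N\<close>: the new point has the opposite bit there, and the earlier branching
  positions lie below and keep their bits.\<close>

lemma code_dense: "\<exists>y\<in>P. \<forall>j<N. code y j = b j"
proof (induction N)
  case 0
  then show ?case using nonempty by auto
next
  case (Suc N)
  then obtain y where y: "y \<in> P" "\<forall>j<N. code y j = b j" by blast
  show ?case
  proof (cases "code y N = b N")
    case True
    then show ?thesis using y by (auto simp: less_Suc_eq)
  next
    case False
    define m where "m = branch_index P y N"
    obtain z where z: "z \<in> P" "\<forall>i<m. z i = y i" "z m \<noteq> y m"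
      using branch_index(1)[OF y(1), of N] unfolding branch_def m_def by blast
    have "code z j = b j" if "j < Suc N" for j
    proof (cases "j = N")
      case True
      then have "code z j = z m"
        using branch_index_cong[OF y(1) z(1,2), of N] by (simp add: code_def m_def)
      moreover have "code y N = y m" by (simp add: code_def m_def)
      ultimately show ?thesis using z(3) False True by auto
    next
      case False
      then have j: "j < N" using that by simp
      then have "branch_index P y j < m" using branch_index_mono[OF y(1)] m_def by blast
      then have "code z j = code y j"
        using branch_index_cong[OF y(1) z(1,2), of j] z(2) by (simp add: code_def)
      then show ?thesis using j y(2) by simp
    qed
    then show ?thesis using z(1) by blast
  qed
qed

lemma homeomorphic_cantor_space: "subtopology cantor_space P homeomorphic_space cantor_space"
proof -
  let ?X = "subtopology cantor_space P"
  have cpt: "compact_space ?X"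
    using closed closedin_compact_space compact_space_cantor_space compact_space_subtopology by blast
  have cont: "continuous_map ?X cantor_space code"
  proof (rule continuous_map_subtopology_cantor_space)
    fix y j assume y: "y \<in> P"
    show "\<exists>n. \<forall>z\<in>P. (\<forall>i<n. z i = y i) \<longrightarrow> code z j = code y j"
    proof (intro exI[of _ "Suc (branch_index P y j)"] ballI impI)
      fix z assume z: "z \<in> P" "\<forall>i<Suc (branch_index P y j). z i = y i"
      then show "code z j = code y j"
        using branch_index_cong[OF y z(1), of "branch_index P y j" j] by (simp add: code_def)
    qed
  qed
  have inj: "inj_on code P"
  proof (rule inj_onI, rule ccontr)
    fix y z assume yz: "y \<in> P" "z \<in> P" "code y = code z" "y \<noteq> z"
    define m where "m = (LEAST i. z i \<noteq> y i)"
    have m: "z m \<noteq> y m" unfolding m_def by (rule LeastI_ex) (use yz(4) in auto)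
    have ag: "\<forall>i<m. z i = y i" unfolding m_def using not_less_Least by blast
    \<comment> \<open>The first difference of two points is a branching position of both with the
      same number, so it shows in the code.\<close>
    have "branch P y m" unfolding branch_def using yz(2) m ag by blast
    then have iy: "branch_index P y (branch_count P y m) = m" by (intro branch_index_eqI) auto
    then have "branch_index P z (branch_count P y m) = m"
      using branch_index_cong[OF yz(1,2) ag, of "branch_count P y m"] by simp
    then have "code z (branch_count P y m) \<noteq> code y (branch_count P y m)"
      using m iy by (simp add: code_def)
    then show False using yz(3) by simp
  qed
  have "compactin cantor_space (code ` topspace ?X)"
    using cpt cont image_compactin compact_space_def by blast
  then have "closedin cantor_space (code ` P)"
    using compactin_imp_closedin Hausdorff_space_cantor_space by fastforce
  moreover have "b \<in> cantor_space closure_of (code ` P)" for b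
    unfolding in_closure_of_cantor_space
  proof
    fix n
    obtain y where "y \<in> P" "\<forall>j<n. code y j = b j" using code_dense by blast
    then show "\<exists>z\<in>code ` P. \<forall>i<n. z i = b i" by (intro bexI[of _ "code y"]) auto
  qed
  ultimately have "code ` P = UNIV"
    unfolding closure_of_eq[symmetric] by blast
  then have "homeomorphic_map ?X cantor_space code"
    using cpt cont inj Hausdorff_space_cantor_space
    by (intro continuous_imp_homeomorphic_map) auto
  then show ?thesis using homeomorphic_map_imp_homeomorphic_space by blast
qed

end

section \<open>The orbit closure of a recurrent point\<close>

text \<open>The order of composition in \<open>\<sigma>_mult\<close> and \<open>\<tau>_mult\<close>
  makes \<open>y \<circ> \<sigma> s\<close> and \<open>y \<circ> \<tau> h\<close> left actions. In
  \<open>recurrent\<close> the element \<open>e\<close> acts after \<open>t\<close>, so a bounded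
  move leads from any orbit point close to \<open>y\<^sub>0 \<circ> \<tau> h\<close>. The uniform
  bounds \<open>E\<close> and \<open>k\<close> let recurrence and aperiodicity pass to limits of the
  orbit.\<close>

locale recurrent_point = G: group G + H: group H
  for G :: "('g, 'a) monoid_scheme" (structure) and H :: "('h, 'b) monoid_scheme" +
  fixes \<sigma> :: "'g \<Rightarrow> nat \<Rightarrow> nat" and \<tau> :: "'h \<Rightarrow> nat \<Rightarrow> nat" and y\<^sub>0 :: "nat \<Rightarrow> bool"
  assumes infinite_G: "infinite (carrier G)"
    and \<sigma>_one: "\<sigma> \<one> n = n"
    and \<sigma>_mult: "\<lbrakk>s \<in> carrier G; t \<in> carrier G\<rbrakk> \<Longrightarrow> \<sigma> (s \<otimes> t) n = \<sigma> t (\<sigma> s n)"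
    and \<tau>_one: "\<tau> \<one>\<^bsub>H\<^esub> n = n"
    and \<tau>_mult: "\<lbrakk>h \<in> carrier H; h' \<in> carrier H\<rbrakk> \<Longrightarrow> \<tau> (h \<otimes>\<^bsub>H\<^esub> h') n = \<tau> h' (\<tau> h n)"
    and \<sigma>_\<tau>: "\<lbrakk>s \<in> carrier G; h \<in> carrier H\<rbrakk> \<Longrightarrow> \<sigma> s (\<tau> h n) = \<tau> h (\<sigma> s n)"
    and recurrent: "h \<in> carrier H \<Longrightarrow> \<exists>E. finite E \<and> E \<subseteq> carrier G \<and>
          (\<forall>t\<in>carrier G. \<exists>e\<in>E. \<forall>n<k. y\<^sub>0 (\<sigma> (e \<otimes> t) n) = y\<^sub>0 (\<tau> h n))"
    and aperiodic: "\<lbrakk>g \<in> carrier G; g \<noteq> \<one>\<rbrakk> \<Longrightarrow>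
          \<exists>k. \<forall>t\<in>carrier G. \<exists>n<k. y\<^sub>0 (\<sigma> t n) \<noteq> y\<^sub>0 (\<sigma> t (\<sigma> g n))"
    and faithful: "\<lbrakk>h \<in> carrier H; h \<noteq> \<one>\<^bsub>H\<^esub>\<rbrakk> \<Longrightarrow> \<exists>n. y\<^sub>0 (\<tau> h n) \<noteq> y\<^sub>0 n"
begin

definition P :: "(nat \<Rightarrow> bool) set" where
  "P = cantor_space closure_of {y\<^sub>0 \<circ> \<sigma> s |s. s \<in> carrier G}"

lemma P_iff: "y \<in> P \<longleftrightarrow> (\<forall>n. \<exists>s\<in>carrier G. \<forall>i<n. y\<^sub>0 (\<sigma> s i) = y i)"
  unfolding P_def in_closure_of_cantor_space by auto (metis comp_apply)+

lemma finite_window: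
  fixes f :: "nat \<Rightarrow> nat"
  shows "\<exists>m. \<forall>i<k. f i < m"
  by (rule exI[of _ "Suc (Max (f ` {..<k}))"]) (simp add: less_Suc_eq_le)

lemma orbit_in_P: "s \<in> carrier G \<Longrightarrow> y\<^sub>0 \<circ> \<sigma> s \<in> P"
  unfolding P_iff by auto

lemma y0_in_P: "y\<^sub>0 \<in> P"
  unfolding P_iff using \<sigma>_one G.one_closed by metis

lemma \<sigma>_P:
  assumes "s \<in> carrier G" "y \<in> P" shows "y \<circ> \<sigma> s \<in> P"
  unfolding P_iff
proof
  fix n
  obtain m where m: "\<And>i. i < n \<Longrightarrow> \<sigma> s i < m" using finite_window[of n "\<sigma> s"] by blast
  obtain t where t: "t \<in> carrier G" "\<forall>i<m. y\<^sub>0 (\<sigma> t i) = y i"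
    using assms(2) unfolding P_iff by blast
  have "\<forall>i<n. y\<^sub>0 (\<sigma> (s \<otimes> t) i) = (y \<circ> \<sigma> s) i"
    using \<sigma>_mult[OF assms(1) t(1)] t(2) m by simp
  then show "\<exists>s'\<in>carrier G. \<forall>i<n. y\<^sub>0 (\<sigma> s' i) = (y \<circ> \<sigma> s) i"
    using assms(1) t(1) by blast
qed

lemma \<tau>_y0:
  assumes "h \<in> carrier H" shows "y\<^sub>0 \<circ> \<tau> h \<in> P"
  unfolding P_iff
proof
  fix n
  obtain E where E: "E \<subseteq> carrier G"
    "\<forall>t\<in>carrier G. \<exists>e\<in>E. \<forall>i<n. y\<^sub>0 (\<sigma> (e \<otimes> t) i) = y\<^sub>0 (\<tau> h i)"
    using recurrent[OF assms] by meson
  obtain e where "e \<in> E" "\<forall>i<n. y\<^sub>0 (\<sigma> (e \<otimes> \<one>) i) = y\<^sub>0 (\<tau> h i)"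
    using E(2) G.one_closed by blast
  then show "\<exists>s\<in>carrier G. \<forall>i<n. y\<^sub>0 (\<sigma> s i) = (y\<^sub>0 \<circ> \<tau> h) i"
    using E(1) by auto
qed

lemma closed_P: "closedin cantor_space P"
  by (simp add: P_def)

text \<open>As the actions commute, approximating \<open>y\<close> by
  \<open>y\<^sub>0 \<circ> \<sigma> t\<close> approximates \<open>y \<circ> \<tau> h\<close> by a
  translate of \<open>y\<^sub>0 \<circ> \<tau> h\<close>, which lies in \<open>P\<close>.\<close>

lemma \<tau>_P:
  assumes "h \<in> carrier H" "y \<in> P" shows "y \<circ> \<tau> h \<in> P"
proof -
  have "y \<circ> \<tau> h \<in> cantor_space closure_of P"
    unfolding in_closure_of_cantor_space
  proof
    fix n
    obtain m where m: "\<And>i. i < n \<Longrightarrow> \<tau> h i < m" using finite_window[of n "\<tau> h"] by blast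
    obtain t where t: "t \<in> carrier G" "\<forall>i<m. y\<^sub>0 (\<sigma> t i) = y i"
      using assms(2) unfolding P_iff by blast
    have "y\<^sub>0 \<circ> \<tau> h \<circ> \<sigma> t \<in> P" using \<sigma>_P \<tau>_y0 assms(1) t(1) by blast
    moreover have "\<forall>i<n. (y\<^sub>0 \<circ> \<tau> h \<circ> \<sigma> t) i = (y \<circ> \<tau> h) i"
      using t(2) m \<sigma>_\<tau>[OF t(1) assms(1), symmetric] by simp
    ultimately show "\<exists>z\<in>P. \<forall>i<n. z i = (y \<circ> \<tau> h) i" by blast
  qed
  then show ?thesis by (simp add: closure_of_eq[THEN iffD2, OF closed_P])
qed

text \<open>The source of minimality. As \<open>E\<close> is finite, one window contains all
  coordinates \<open>\<sigma> e n\<close> with \<open>n < k\<close>; a return time \<open>e\<close>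
  of an orbit point that agrees with \<open>y\<close> on this window also works for
  \<open>y\<close>.\<close>

lemma y0_in_orbit_closure:
  assumes "y \<in> P"
  shows "\<exists>e\<in>carrier G. \<forall>n<k. y (\<sigma> e n) = y\<^sub>0 n"
proof -
  obtain E where E: "finite E" "E \<subseteq> carrier G"
    "\<forall>t\<in>carrier G. \<exists>e\<in>E. \<forall>n<k. y\<^sub>0 (\<sigma> (e \<otimes> t) n) = y\<^sub>0 (\<tau> \<one>\<^bsub>H\<^esub> n)"
    using recurrent[OF H.one_closed] by meson
  define m where "m = Suc (Max ((\<lambda>(e, n). \<sigma> e n) ` (E \<times> {..<k})))"
  have m: "\<sigma> e n < m" if "e \<in> E" "n < k" for e n
    unfolding m_def less_Suc_eq_le by (rule Max_ge) (use that E(1) in auto)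
  obtain t where t: "t \<in> carrier G" "\<forall>i<m. y\<^sub>0 (\<sigma> t i) = y i"
    using assms unfolding P_iff by blast
  obtain e where e: "e \<in> E" "\<forall>n<k. y\<^sub>0 (\<sigma> (e \<otimes> t) n) = y\<^sub>0 n"
    using E(3) t(1) \<tau>_one by auto
  have "y (\<sigma> e n) = y\<^sub>0 n" if "n < k" for n
  proof -
    have "e \<in> carrier G" using e(1) E(2) by blast
    then have "y\<^sub>0 (\<sigma> t (\<sigma> e n)) = y\<^sub>0 n" using e(2) that \<sigma>_mult[of e t n, symmetric] t(1) by simp
    then show ?thesis using t(2) m[OF e(1) that] by simp
  qed
  then show ?thesis using e(1) E(2) by blast
qed

lemma free:
  assumes "g \<in> carrier G" "g \<noteq> \<one>" "y \<in> P"
  shows "y \<circ> \<sigma> g \<noteq> y"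
proof -
  obtain k where k: "\<forall>t\<in>carrier G. \<exists>n<k. y\<^sub>0 (\<sigma> t n) \<noteq> y\<^sub>0 (\<sigma> t (\<sigma> g n))"
    using aperiodic assms(1,2) by blast
  obtain m where m: "\<And>i. i < k \<Longrightarrow> \<sigma> g i < m" using finite_window[of k "\<sigma> g"] by blast
  obtain t where t: "t \<in> carrier G" "\<forall>i<max k m. y\<^sub>0 (\<sigma> t i) = y i"
    using assms(3) unfolding P_iff by blast
  then obtain n where "n < k" "y\<^sub>0 (\<sigma> t n) \<noteq> y\<^sub>0 (\<sigma> t (\<sigma> g n))" using k by blast
  then have "y n \<noteq> (y \<circ> \<sigma> g) n" using t(2) m[of n] by simp
  then show ?thesis by metis
qed

text \<open>If only \<open>y\<^sub>0\<close> itself returned to its cylinder of length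
  \<open>n\<close>, every return \<open>e \<otimes> t\<close> would fix \<open>y\<^sub>0\<close> and
  be trivial by freeness. Then each \<open>t\<close> would be the inverse of an element of the
  finite set \<open>E\<close>.\<close>

lemma perfect_y0: "\<exists>s\<in>carrier G. y\<^sub>0 \<circ> \<sigma> s \<noteq> y\<^sub>0 \<and> (\<forall>i<n. y\<^sub>0 (\<sigma> s i) = y\<^sub>0 i)"
proof (rule ccontr)
  assume contr: "\<not> ?thesis"
  obtain E where E: "finite E" "E \<subseteq> carrier G"
    "\<forall>t\<in>carrier G. \<exists>e\<in>E. \<forall>i<n. y\<^sub>0 (\<sigma> (e \<otimes> t) i) = y\<^sub>0 (\<tau> \<one>\<^bsub>H\<^esub> i)"
    using recurrent[OF H.one_closed] by meson
  have "carrier G \<subseteq> (\<lambda>e. inv e) ` E"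
  proof
    fix t assume t: "t \<in> carrier G"
    then obtain e where e: "e \<in> E" "\<forall>i<n. y\<^sub>0 (\<sigma> (e \<otimes> t) i) = y\<^sub>0 i" using E(3) \<tau>_one by auto
    have et: "e \<otimes> t \<in> carrier G" using e E(2) t by blast
    then have "y\<^sub>0 \<circ> \<sigma> (e \<otimes> t) = y\<^sub>0" using contr e(2) by blast
    then have "e \<otimes> t = \<one>" using free[OF et _ y0_in_P] by blast
    then have "t = inv e" using G.inv_equality t e E(2) by (metis G.inv_inv G.inv_closed subsetD)
    then show "t \<in> (\<lambda>e. inv e) ` E" using e(1) by blast
  qed
  then show False using infinite_G E(1) finite_surj by blast
qed

lemma perfect_subset: "perfect_subset P"
proof
  show "P \<noteq> {}" using y0_in_P by blast
  show "closedin cantor_space P" by (rule closed_P)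
  fix y n assume y: "y \<in> P"
  show "\<exists>z\<in>P. z \<noteq> y \<and> (\<forall>i<n. z i = y i)"
  proof (rule ccontr)
    assume contr: "\<not> ?thesis"
    obtain s where s: "s \<in> carrier G" "\<forall>i<n. y\<^sub>0 (\<sigma> s i) = y i" using y unfolding P_iff by blast
    \<comment> \<open>An isolated point of the orbit closure lies on the orbit, and acting by
      \<open>s\<close> carries orbit points close to \<open>y\<^sub>0\<close> to points close to
      \<open>y\<close>.\<close>
    then have ys: "y\<^sub>0 \<circ> \<sigma> s = y" using contr orbit_in_P[OF s(1)] by auto
    obtain m where m: "\<And>i. i < n \<Longrightarrow> \<sigma> s i < m" using finite_window[of n "\<sigma> s"] by blast
    obtain t where t: "t \<in> carrier G" "y\<^sub>0 \<circ> \<sigma> t \<noteq> y\<^sub>0" "\<forall>i<m. y\<^sub>0 (\<sigma> t i) = y\<^sub>0 i"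
      using perfect_y0 by blast
    have "y\<^sub>0 \<circ> \<sigma> t \<circ> \<sigma> s \<in> P" using \<sigma>_P orbit_in_P s(1) t(1) by blast
    moreover have "\<forall>i<n. (y\<^sub>0 \<circ> \<sigma> t \<circ> \<sigma> s) i = y i" using t(3) m s(2) by simp
    ultimately have "y\<^sub>0 \<circ> \<sigma> t \<circ> \<sigma> s = y\<^sub>0 \<circ> \<sigma> s" using contr ys by blast
    then have "y\<^sub>0 (\<sigma> t (\<sigma> s (\<sigma> (inv s) i))) = y\<^sub>0 (\<sigma> s (\<sigma> (inv s) i))" for i
      by (metis comp_apply)
    moreover have "\<sigma> s (\<sigma> (inv s) i) = i" for i
      using \<sigma>_mult[of "inv s" s i] s(1) \<sigma>_one by simp
    ultimately have "y\<^sub>0 \<circ> \<sigma> t = y\<^sub>0" by auto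
    then show False using t(2) by blast
  qed
qed

section \<open>The flow on the orbit closure and its automorphisms from \<open>H\<close>\<close>

abbreviation Y :: "(nat \<Rightarrow> bool) topology" where
  "Y \<equiv> subtopology cantor_space P"

text \<open>Restricted to \<open>P\<close>, because \<open>BijGroup\<close> and the carrier of
  \<open>Aut_flow\<close> consist of functions that are undefined outside the space; likewise for
  \<open>aut\<close>.\<close>

definition act :: "'g \<Rightarrow> (nat \<Rightarrow> bool) \<Rightarrow> nat \<Rightarrow> bool" where
  "act g = (\<lambda>y\<in>P. y \<circ> \<sigma> g)"

definition aut :: "'h \<Rightarrow> (nat \<Rightarrow> bool) \<Rightarrow> nat \<Rightarrow> bool" where
  "aut h = (\<lambda>y\<in>P. y \<circ> \<tau> h)"

lemma act_P: "g \<in> carrier G \<Longrightarrow> y \<in> P \<Longrightarrow> act g y \<in> P"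
  by (simp add: act_def \<sigma>_P)

lemma act_mult: "\<lbrakk>g \<in> carrier G; h \<in> carrier G; y \<in> P\<rbrakk> \<Longrightarrow> act (g \<otimes> h) y = act g (act h y)"
  by (auto simp: act_def \<sigma>_P \<sigma>_mult)

lemma aut_mult: "\<lbrakk>g \<in> carrier H; h \<in> carrier H; y \<in> P\<rbrakk> \<Longrightarrow> aut (g \<otimes>\<^bsub>H\<^esub> h) y = aut g (aut h y)"
  by (auto simp: aut_def \<tau>_P \<tau>_mult)

lemma act_one: "y \<in> P \<Longrightarrow> act \<one> y = y"
  by (auto simp: act_def \<sigma>_one)

lemma aut_one: "y \<in> P \<Longrightarrow> aut \<one>\<^bsub>H\<^esub> y = y"
  by (auto simp: aut_def \<tau>_one)

lemma continuous_map_comp_restrict: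
  assumes "\<And>y. y \<in> P \<Longrightarrow> y \<circ> f \<in> P"
  shows "continuous_map Y Y (\<lambda>y\<in>P. y \<circ> f)"
proof -
  have "continuous_map Y cantor_space (\<lambda>y\<in>P. y \<circ> f)"
  proof (rule continuous_map_subtopology_cantor_space)
    fix y j assume "y \<in> P"
    then show "\<exists>n. \<forall>z\<in>P. (\<forall>i<n. z i = y i) \<longrightarrow> (\<lambda>y\<in>P. y \<circ> f) z j = (\<lambda>y\<in>P. y \<circ> f) y j"
      by (intro exI[of _ "Suc (f j)"]) auto
  qed
  then show ?thesis by (intro continuous_map_into_subtopology) (use assms in auto)
qed

lemma compact_Y: "compact_space Y"
  using closed_P closedin_compact_space compact_space_cantor_space compact_space_subtopology by blast

lemma Hausdorff_Y: "Hausdorff_space Y"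
  by (simp add: Hausdorff_space_cantor_space Hausdorff_space_subtopology)

lemma act_Bij: "g \<in> carrier G \<Longrightarrow> act g \<in> Bij P"
proof -
  assume g: "g \<in> carrier G"
  have "bij_betw (act g) P P"
    by (rule bij_betw_byWitness[where f' = "act (inv g)"])
      (use g act_P act_mult[of g "inv g"] act_mult[of "inv g" g] act_one in auto)
  then show ?thesis by (auto simp: Bij_def act_def)
qed

lemma G_flow: "G_flow G Y act"
  unfolding G_flow_def
proof (intro conjI ballI)
  have "act (x \<otimes> y) = compose P (act x) (act y)" if "x \<in> carrier G" "y \<in> carrier G" for x y
  proof
    fix z show "act (x \<otimes> y) z = compose P (act x) (act y) z"
      using act_mult[OF that] by (cases "z \<in> P") (auto simp: compose_def act_def)
  qed
  then have "act \<in> hom G (BijGroup P)"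
    by (auto simp: hom_def BijGroup_def act_Bij)
  then have "group_action G P act"
    unfolding group_action_def group_hom_def group_hom_axioms_def
    using G.group_axioms group_BijGroup by blast
  then show "group_action G (topspace Y) act" by simp
  show "continuous_map Y Y (act g)" if "g \<in> carrier G" for g
    unfolding act_def by (rule continuous_map_comp_restrict) (use \<sigma>_P that in blast)
qed (fact compact_Y Hausdorff_Y)+

lemma minimal_flow: "minimal_flow G Y act"
  unfolding minimal_flow_def
proof
  fix y assume "y \<in> topspace Y"
  then have y: "y \<in> P" by simp
  let ?O = "orbit G act y"
  have O: "?O \<subseteq> P" using act_P[OF _ y] by (auto simp: orbit_def)
  have "P \<subseteq> cantor_space closure_of ?O"
  proof
    fix z assume z: "z \<in> P"
    show "z \<in> cantor_space closure_of ?O"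
      unfolding in_closure_of_cantor_space
    proof
      fix n
      obtain s where s: "s \<in> carrier G" "\<forall>i<n. y\<^sub>0 (\<sigma> s i) = z i" using z unfolding P_iff by blast
      obtain m where m: "\<And>i. i < n \<Longrightarrow> \<sigma> s i < m" using finite_window[of n "\<sigma> s"] by blast
      obtain e where e: "e \<in> carrier G" "\<forall>i<m. y (\<sigma> e i) = y\<^sub>0 i"
        using y0_in_orbit_closure[OF y] by blast
      have "\<forall>i<n. act (s \<otimes> e) y i = z i"
        using e s m y \<sigma>_mult[OF s(1) e(1)] by (simp add: act_def)
      moreover have "act (s \<otimes> e) y \<in> ?O" using s(1) e(1) by (auto simp: orbit_def)
      ultimately show "\<exists>z'\<in>?O. \<forall>i<n. z' i = z i" by blast
    qed
  qed
  moreover have "P \<inter> ?O = ?O" using O by blast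
  ultimately show "Y closure_of ?O = topspace Y"
    by (auto simp: closure_of_subtopology)
qed

lemma free_flow: "free_flow G Y act"
  unfolding free_flow_def
proof
  fix y assume "y \<in> topspace Y"
  then have y: "y \<in> P" by simp
  have "g = \<one>" if "g \<in> carrier G" "act g y = y" for g
    using free[OF that(1) _ y] that(2) y by (auto simp: act_def)
  then show "stabilizer G act y = {\<one>}"
    using act_one[OF y] by (auto simp: stabilizer_def)
qed

lemma aut_hom: "aut \<in> hom H (Aut_flow G Y act)"
proof (rule homI)
  fix h assume h: "h \<in> carrier H"
  have cont: "continuous_map Y Y (aut k)" if "k \<in> carrier H" for k
    unfolding aut_def by (rule continuous_map_comp_restrict) (use \<tau>_P that in blast)
  have "homeomorphic_maps Y Y (aut h) (aut (inv\<^bsub>H\<^esub> h))"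
    unfolding homeomorphic_maps_def
    using cont h aut_mult[of h "inv\<^bsub>H\<^esub> h"] aut_mult[of "inv\<^bsub>H\<^esub> h" h] aut_one by auto
  then have "homeomorphic_map Y Y (aut h)" using homeomorphic_maps_map by blast
  moreover have "aut h (act g y) = act g (aut h y)" if "g \<in> carrier G" "y \<in> P" for g y
    using that h \<tau>_P[OF h] \<sigma>_P \<sigma>_\<tau>[OF _ h] by (auto simp: aut_def act_def)
  moreover have "aut h \<in> extensional (topspace Y)" by (simp add: aut_def)
  ultimately show "aut h \<in> carrier (Aut_flow G Y act)" by (auto simp: Aut_flow_def)
next
  fix h k assume hk: "h \<in> carrier H" "k \<in> carrier H"
  have "aut (h \<otimes>\<^bsub>H\<^esub> k) z = compose P (aut h) (aut k) z" for z
    using aut_mult[OF hk] by (cases "z \<in> P") (auto simp: compose_def aut_def)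
  then show "aut (h \<otimes>\<^bsub>H\<^esub> k) = aut h \<otimes>\<^bsub>Aut_flow G Y act\<^esub> aut k"
    by (auto simp: Aut_flow_def)
qed

lemma aut_inj: "inj_on aut (carrier H)"
proof (rule inj_onI)
  fix h k assume hk: "h \<in> carrier H" "k \<in> carrier H" "aut h = aut k"
  let ?u = "inv\<^bsub>H\<^esub> h \<otimes>\<^bsub>H\<^esub> k"
  have "aut ?u y\<^sub>0 = aut (inv\<^bsub>H\<^esub> h) (aut h y\<^sub>0)"
    using aut_mult[of "inv\<^bsub>H\<^esub> h" k y\<^sub>0] hk y0_in_P by simp
  also have "\<dots> = y\<^sub>0"
    using aut_mult[of "inv\<^bsub>H\<^esub> h" h y\<^sub>0] hk y0_in_P aut_one by simp
  finally have "y\<^sub>0 \<circ> \<tau> ?u = y\<^sub>0" using y0_in_P by (simp add: aut_def)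
  then have "?u = \<one>\<^bsub>H\<^esub>" using faithful[of ?u] hk by (metis H.inv_closed H.m_closed comp_apply)
  then show "h = k" using hk by (metis H.inv_closed H.inv_equality H.inv_inv)
qed

theorem flow_exists:
  "\<exists>(Y :: (nat \<Rightarrow> bool) topology) act.
     G_flow G Y act \<and> minimal_flow G Y act \<and> free_flow G Y act
     \<and> Y homeomorphic_space cantor_space
     \<and> (\<exists>\<phi>. \<phi> \<in> hom H (Aut_flow G Y act) \<and> inj_on \<phi> (carrier H))"
  using G_flow minimal_flow free_flow aut_hom aut_inj
    perfect_subset.homeomorphic_cantor_space[OF perfect_subset]
  by (intro exI[of _ Y] exI[of _ act] exI[of _ aut] conjI)

end

section \<open>Irreducible sets of configurations\<close>

lemma ex_maximal_independent:
  fixes r :: "'a \<Rightarrow> 'a \<Rightarrow> bool"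
  assumes sym: "\<And>s t. r s t \<Longrightarrow> r t s"
  shows "\<exists>S\<subseteq>A. (\<forall>s\<in>S. \<forall>t\<in>S. s \<noteq> t \<longrightarrow> \<not> r s t) \<and> (\<forall>t\<in>A. t \<in> S \<or> (\<exists>s\<in>S. r s t))"
proof -
  let ?F = "{S. S \<subseteq> A \<and> (\<forall>s\<in>S. \<forall>t\<in>S. s \<noteq> t \<longrightarrow> \<not> r s t)}"
  have "\<exists>M\<in>?F. \<forall>X\<in>?F. M \<subseteq> X \<longrightarrow> X = M"
  proof (rule subset_Zorn_nonempty)
    show "?F \<noteq> {}" by blast
    fix \<C> assume C: "\<C> \<noteq> {}" "subset.chain ?F \<C>"
    have sub: "\<C> \<subseteq> ?F" and tot: "\<And>X Y. X \<in> \<C> \<Longrightarrow> Y \<in> \<C> \<Longrightarrow> X \<subseteq> Y \<or> Y \<subseteq> X"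
      using C(2) by (auto simp: subset_chain_def)
    have "\<not> r s t" if st: "s \<in> \<Union>\<C>" "t \<in> \<Union>\<C>" "s \<noteq> t" for s t
    proof -
      obtain X Y where "X \<in> \<C>" "s \<in> X" "Y \<in> \<C>" "t \<in> Y" using st by blast
      then obtain Z where "Z \<in> \<C>" "s \<in> Z" "t \<in> Z" using tot by blast
      then show ?thesis using sub st(3) by blast
    qed
    then show "\<Union>\<C> \<in> ?F" using sub by blast
  qed
  then obtain M where MF: "M \<in> ?F" and max: "\<forall>X\<in>?F. M \<subseteq> X \<longrightarrow> X = M" by (rule bexE)
  then have M: "M \<subseteq> A" "\<forall>s\<in>M. \<forall>t\<in>M. s \<noteq> t \<longrightarrow> \<not> r s t" by blast+
  have "t \<in> M \<or> (\<exists>s\<in>M. r s t)" if "t \<in> A" for t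
  proof (rule ccontr)
    assume n: "\<not> ?thesis"
    then have "insert t M \<in> ?F" using M that sym by blast
    then have "insert t M = M" using max[rule_format, of "insert t M"] by blast
    then show False using n by blast
  qed
  then show ?thesis using M by blast
qed

section \<open>Gluing and recurrence for configurations on a group\<close>

context group
begin

text \<open>Arguments are multiplied on the right, which leaves left multiplication for distances:
  every shift preserves the relation between \<open>c\<close> and
  \<open>\<delta> \<otimes> c\<close>, and \<open>f \<otimes> s\<close> is place \<open>f\<close> of
  a copy that sits at \<open>s\<close>.\<close>

definition shift :: "'a \<Rightarrow> ('a \<Rightarrow> 'x) \<Rightarrow> 'a \<Rightarrow> 'x" where
  "shift s z = (\<lambda>t. z (t \<otimes> s))"

definition window :: "'a set \<Rightarrow> bool" where
  "window D \<longleftrightarrow> finite D \<and> D \<subseteq> carrier G \<and> \<one> \<in> D \<and> (\<forall>\<delta>\<in>D. inv \<delta> \<in> D)"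

text \<open>
  \<open>X c\<close> is the configuration to be copied at \<open>c \<in> C\<close>. The pieces of \<open>C\<close> on which \<open>X\<close> is constant are
  pairwise \<open>D\<close>-apart, and irreducibility glues all of them, even infinitely many, at once.
\<close>

definition irreducible :: "('x \<Rightarrow> 'x \<Rightarrow> bool) \<Rightarrow> ('a \<Rightarrow> 'x) set \<Rightarrow> 'a set \<Rightarrow> bool" where
  "irreducible R Z D \<longleftrightarrow> (\<forall>C X. C \<subseteq> carrier G \<longrightarrow> (\<forall>c\<in>C. X c \<in> Z) \<longrightarrow>
     (\<forall>c\<in>C. \<forall>\<delta>\<in>D. \<delta> \<otimes> c \<in> C \<longrightarrow> X (\<delta> \<otimes> c) = X c) \<longrightarrow> (\<exists>z\<in>Z. \<forall>c\<in>C. R (z c) (X c c)))"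

lemma irreducibleD:
  assumes "irreducible R Z D" "C \<subseteq> carrier G" "\<And>c. c \<in> C \<Longrightarrow> X c \<in> Z"
    "\<And>c \<delta>. \<lbrakk>c \<in> C; \<delta> \<in> D; \<delta> \<otimes> c \<in> C\<rbrakk> \<Longrightarrow> X (\<delta> \<otimes> c) = X c"
  obtains z where "z \<in> Z" "\<And>c. c \<in> C \<Longrightarrow> R (z c) (X c c)"
proof -
  have "\<exists>z\<in>Z. \<forall>c\<in>C. R (z c) (X c c)"
    using assms(1)[unfolded irreducible_def, rule_format, of C X] assms(2-4) by blast
  then show ?thesis using that by blast
qed

text \<open>The translates \<open>W s\<close> and \<open>W t\<close> overlap; for finite
  \<open>W\<close> this confines \<open>s\<close> to finitely many left multiples of
  \<open>t\<close>. Syndeticity in this form is what a maximal set of sites with disjoint windows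
  delivers.\<close>

definition touch :: "'a set \<Rightarrow> 'a \<Rightarrow> 'a \<Rightarrow> bool" where
  "touch W s t \<longleftrightarrow> (\<exists>a\<in>W. \<exists>b\<in>W. a \<otimes> s = b \<otimes> t)"

lemma touch_sym: "touch W s t \<Longrightarrow> touch W t s"
  unfolding touch_def by metis

definition recurrent :: "('a \<Rightarrow> 'x) set \<Rightarrow> 'a set \<Rightarrow> (('a \<Rightarrow> 'x) \<Rightarrow> bool) \<Rightarrow> ('a \<Rightarrow> 'x) set" where
  "recurrent Z W P = {z \<in> Z. \<forall>t\<in>carrier G. \<exists>s\<in>carrier G. touch W s t \<and> P (shift s z)}"

end

section \<open>Planting a pattern syndetically\<close>

text \<open>The pattern to plant is \<open>q\<close> on \<open>F\<close>, but what has to recur is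
  only the property \<open>P\<close>, which sees the places in \<open>F\<close> up to
  \<open>R\<close>. The two are kept apart because \<open>P\<close> can be chosen invariant under
  \<open>H\<close>, while a fixed pattern in general is not.\<close>

locale pattern = group G for G :: "('a, 'm) monoid_scheme" (structure) +
  fixes R :: "'x \<Rightarrow> 'x \<Rightarrow> bool" and Z :: "('a \<Rightarrow> 'x) set" and D F :: "'a set"
    and q :: "'a \<Rightarrow> 'x" and P :: "('a \<Rightarrow> 'x) \<Rightarrow> bool"
  assumes R_sym: "R a b \<Longrightarrow> R b a"
    and irr: "irreducible R Z D" and D: "window D"
    and F: "finite F" "F \<subseteq> carrier G" "F \<noteq> {}"
    and shift_Z: "\<lbrakk>z \<in> Z; s \<in> carrier G\<rbrakk> \<Longrightarrow> shift s z \<in> Z"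
    and q: "q \<in> Z" "P q"
    and local: "\<lbrakk>\<And>f. f \<in> F \<Longrightarrow> R (x f) (y f); P x\<rbrakk> \<Longrightarrow> P y"
begin

text \<open>\<open>F\<close> thickened by \<open>D\<close>: copies of \<open>F\<close> at sites with
  disjoint windows are too far apart to be linked by an element of \<open>D\<close>, so
  irreducibility can glue them.\<close>

abbreviation W :: "'a set" where "W \<equiv> D <#> F"

lemma D_carrier: "\<delta> \<in> D \<Longrightarrow> \<delta> \<in> carrier G" and D_inv: "\<delta> \<in> D \<Longrightarrow> inv \<delta> \<in> D" and D_one: "\<one> \<in> D"
  using D by (auto simp: window_def)

lemma F_carrier: "f \<in> F \<Longrightarrow> f \<in> carrier G"
  using F by blast

lemma W_I: "\<delta> \<in> D \<Longrightarrow> f \<in> F \<Longrightarrow> \<delta> \<otimes> f \<in> W"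
  by (auto simp: set_mult_def)

lemma F_W: "f \<in> F \<Longrightarrow> f \<in> W"
  using W_I[OF D_one, of f] F_carrier by simp

lemma W_carrier: "w \<in> W \<Longrightarrow> w \<in> carrier G"
  using D_carrier F_carrier by (auto simp: set_mult_def)

lemma finite_W: "finite W"
  using D F by (auto simp: set_mult_def window_def)

lemma touch_refl: "touch W s s"
  using F(3) F_W by (auto simp: touch_def)

lemma ex_maximal_separated:
  "\<exists>S\<subseteq>A. (\<forall>s\<in>S. \<forall>t\<in>S. touch W s t \<longrightarrow> s = t) \<and> (\<forall>t\<in>A. \<exists>s\<in>S. touch W s t)"
proof -
  have "\<exists>S\<subseteq>A. (\<forall>s\<in>S. \<forall>t\<in>S. s \<noteq> t \<longrightarrow> \<not> touch W s t) \<and> (\<forall>t\<in>A. t \<in> S \<or> (\<exists>s\<in>S. touch W s t))"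
    by (rule ex_maximal_independent) (rule touch_sym)
  then obtain S where S: "S \<subseteq> A" "\<forall>s\<in>S. \<forall>t\<in>S. s \<noteq> t \<longrightarrow> \<not> touch W s t"
    "\<forall>t\<in>A. t \<in> S \<or> (\<exists>s\<in>S. touch W s t)" by (elim exE conjE)
  have "\<exists>s\<in>S. touch W s t" if "t \<in> A" for t
    using S(3)[rule_format, OF that] touch_refl[of t] by (elim disjE) (rule bexI[of _ t])
  then show ?thesis using S(1,2) by (intro exI[of _ S]) auto
qed

text \<open>A single application of irreducibility glues \<open>X\<close> on \<open>C\<close> and,
  at each site \<open>s\<close>, the pattern \<open>q\<close> moved to \<open>s\<close>. No element
  of \<open>D\<close> links different pieces, since the windows of the sites avoid \<open>C\<close>
  and each other.\<close>

lemma place: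
  assumes C: "C \<subseteq> carrier G" and X: "\<And>c. c \<in> C \<Longrightarrow> X c \<in> Z"
    and cons: "\<And>c \<delta>. \<lbrakk>c \<in> C; \<delta> \<in> D; \<delta> \<otimes> c \<in> C\<rbrakk> \<Longrightarrow> X (\<delta> \<otimes> c) = X c"
    and S: "S \<subseteq> carrier G" and sep: "\<And>s t. \<lbrakk>s \<in> S; t \<in> S; touch W s t\<rbrakk> \<Longrightarrow> s = t"
    and disj: "\<And>s w. \<lbrakk>s \<in> S; w \<in> W\<rbrakk> \<Longrightarrow> w \<otimes> s \<notin> C"
  obtains z where "z \<in> Z" "\<And>c. c \<in> C \<Longrightarrow> R (z c) (X c c)"
    "\<And>s f. \<lbrakk>s \<in> S; f \<in> F\<rbrakk> \<Longrightarrow> R (z (f \<otimes> s)) (q f)"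
proof -
  define B where "B = {f \<otimes> s |f s. f \<in> F \<and> s \<in> S}"
  define \<kappa> where "\<kappa> u = (SOME s. s \<in> S \<and> (\<exists>f\<in>F. u = f \<otimes> s))" for u
  define X' where "X' u = (if u \<in> C then X u else shift (inv (\<kappa> u)) q)" for u
  have \<kappa>: "\<kappa> (f \<otimes> s) = s" if "f \<in> F" "s \<in> S" for f s
  proof -
    have "\<kappa> (f \<otimes> s) \<in> S \<and> (\<exists>f'\<in>F. f \<otimes> s = f' \<otimes> \<kappa> (f \<otimes> s))"
      unfolding \<kappa>_def by (rule someI_ex) (use that in blast)
    then show ?thesis using sep that F_W unfolding touch_def by metis
  qed
  have notC: "f \<otimes> s \<notin> C" if "f \<in> F" "s \<in> S" for f s
    using disj[OF that(2) F_W[OF that(1)]] .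
  have X'B: "X' (f \<otimes> s) = shift (inv s) q" if "f \<in> F" "s \<in> S" for f s
    using notC[OF that] \<kappa>[OF that] by (simp add: X'_def)
  obtain z where z: "z \<in> Z" "\<And>c. c \<in> C \<union> B \<Longrightarrow> R (z c) (X' c c)"
  proof (rule irreducibleD[OF irr])
    show "C \<union> B \<subseteq> carrier G" using C S F_carrier by (auto simp: B_def)
    show "X' c \<in> Z" if c: "c \<in> C \<union> B" for c
    proof (cases "c \<in> C")
      case True then show ?thesis using X by (simp add: X'_def)
    next
      case False
      then obtain f s where "f \<in> F" "s \<in> S" "c = f \<otimes> s" using c by (auto simp: B_def)
      then show ?thesis using X'B S shift_Z[OF q(1)] by auto
    qed
    show "X' (\<delta> \<otimes> c) = X' c" if \<delta>: "c \<in> C \<union> B" "\<delta> \<in> D" "\<delta> \<otimes> c \<in> C \<union> B" for c \<delta>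
    proof (cases "c \<in> C")
      case c: True
      have "\<delta> \<otimes> c \<in> C"
      proof (rule ccontr)
        assume "\<delta> \<otimes> c \<notin> C"
        then obtain f s where fs: "f \<in> F" "s \<in> S" "\<delta> \<otimes> c = f \<otimes> s" using \<delta> by (auto simp: B_def)
        \<comment> \<open>A link from \<open>c\<close> into a copy, read backwards, puts
          \<open>c\<close> into the window of a site; this uses the symmetry of
          \<open>D\<close>.\<close>
        have "c = inv \<delta> \<otimes> (\<delta> \<otimes> c)"
          using \<delta>(2) D_carrier c C by (metis inv_closed l_inv l_one m_assoc subsetD)
        also have "\<dots> = (inv \<delta> \<otimes> f) \<otimes> s"
          using fs \<delta>(2) D_carrier F_carrier S by (simp add: m_assoc subsetD)
        finally show False using disj[OF fs(2) W_I[OF D_inv[OF \<delta>(2)] fs(1)]] c by simp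
      qed
      then show ?thesis using c cons[OF c \<delta>(2)] by (simp add: X'_def)
    next
      case False
      then obtain f s where fs: "f \<in> F" "s \<in> S" "c = f \<otimes> s" using \<delta> by (auto simp: B_def)
      have \<delta>c: "\<delta> \<otimes> c = (\<delta> \<otimes> f) \<otimes> s"
        using fs \<delta>(2) D_carrier F_carrier S by (simp add: m_assoc subsetD)
      then have "\<delta> \<otimes> c \<notin> C" using disj[OF fs(2) W_I[OF \<delta>(2) fs(1)]] by simp
      then obtain g t where gt: "g \<in> F" "t \<in> S" "\<delta> \<otimes> c = g \<otimes> t" using \<delta> by (auto simp: B_def)
      have "touch W s t" unfolding touch_def
        using \<delta>c gt F_W W_I[OF \<delta>(2) fs(1)] by metis
      then have "s = t" using sep fs gt by blast
      then show ?thesis using X'B fs gt by metis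
    qed
  qed blast
  have "R (z (f \<otimes> s)) (q f)" if "s \<in> S" "f \<in> F" for f s
  proof -
    have "f \<otimes> s \<in> B" using that by (auto simp: B_def)
    then have "R (z (f \<otimes> s)) (shift (inv s) q (f \<otimes> s))" using z(2) X'B that by force
    moreover have "shift (inv s) q (f \<otimes> s) = q f"
      using that S F_carrier by (simp add: shift_def m_assoc subsetD)
    ultimately show ?thesis by simp
  qed
  moreover have "R (z c) (X c c)" if "c \<in> C" for c
    using z(2)[of c] that by (simp add: X'_def)
  ultimately show ?thesis using that z(1) by blast
qed

lemma P_shift:
  assumes "\<And>f. f \<in> F \<Longrightarrow> R (z (f \<otimes> s)) (q f)" shows "P (shift s z)"
proof (rule local[OF _ q(2)])
  show "R (q f) (shift s z f)" if "f \<in> F" for f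
    using assms[OF that] R_sym by (simp add: shift_def)
qed

text \<open>The sites are \<open>\<one>\<close> and a maximal separated set of points that do not
  touch \<open>\<one>\<close>. Points touching \<open>\<one>\<close> are served by
  \<open>\<one>\<close> itself, so \<open>q\<close> is realized in its original place.\<close>

lemma recurrent_realizes: "\<exists>z\<in>recurrent Z W P. \<forall>f\<in>F. R (z f) (q f)"
proof -
  let ?A = "{t \<in> carrier G. \<not> touch W \<one> t}"
  obtain S where S: "S \<subseteq> ?A" "\<forall>s\<in>S. \<forall>t\<in>S. touch W s t \<longrightarrow> s = t"
    "\<forall>t\<in>?A. \<exists>s\<in>S. touch W s t"
    using ex_maximal_separated[of ?A] by (elim exE conjE)
  let ?S = "insert \<one> S"
  have S': "?S \<subseteq> carrier G" using S(1) by auto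
  obtain z where z: "z \<in> Z" "\<And>s f. \<lbrakk>s \<in> ?S; f \<in> F\<rbrakk> \<Longrightarrow> R (z (f \<otimes> s)) (q f)"
  proof (rule place[of "{}" "\<lambda>_. q" ?S])
    show "s = t" if "s \<in> ?S" "t \<in> ?S" "touch W s t" for s t
      using that S(1,2) touch_sym by blast
  qed (use S' in auto)
  have "\<exists>s\<in>carrier G. touch W s t \<and> P (shift s z)" if t: "t \<in> carrier G" for t
  proof -
    have "\<exists>s\<in>?S. touch W s t"
    proof (cases "touch W \<one> t")
      case False then show ?thesis using S(3) t touch_refl by blast
    qed blast
    then show ?thesis using P_shift z(2) S' by blast
  qed
  then have "z \<in> recurrent Z W P" using z(1) by (simp add: recurrent_def)
  moreover have "\<forall>f\<in>F. R (z f) (q f)" using z(2)[of \<one>] F_carrier by auto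
  ultimately show ?thesis by blast
qed

text \<open>
  To glue on \<open>C\<close>, keep those occurrences of the pattern in the given configurations that serve points \<open>t\<close>
  with \<open>W t\<close> meeting \<open>C\<close> (the set \<open>S\<^sub>0\<close>), and plant new occurrences at a maximal \<open>W\<close>-separated set of
  points away from \<open>C\<close> and \<open>S\<^sub>0\<close>. Maximality makes the recurrence window of the result the same as that of the
  given configurations, which is what preserves the recurrence condition.
\<close>

lemma recurrent_irreducible: "\<exists>D'. window D' \<and> irreducible R (recurrent Z W P) D'"
proof -
  \<comment> \<open>If \<open>w \<otimes> t = c\<close> and
    \<open>a \<otimes> s = b \<otimes> t\<close>, then \<open>f \<otimes> s = (f \<otimes> inv a
    \<otimes> b \<otimes> inv w) \<otimes> c\<close>. So \<open>E\<close> bounds how far a kept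
    occurrence reaches from the point of \<open>C\<close> for which it is kept.\<close>
  define E where "E = insert \<one> ((\<lambda>(f, a, b, w). f \<otimes> inv a \<otimes> b \<otimes> inv w) ` (F \<times> W \<times> W \<times> W))"
  have finE: "finite E" unfolding E_def using F(1) finite_W by blast
  have E_carrier: "e \<in> carrier G" if "e \<in> E" for e
    using that F_carrier W_carrier by (auto simp: E_def)
  have E_I: "f \<otimes> inv a \<otimes> b \<otimes> inv w \<in> E" if "f \<in> F" "a \<in> W" "b \<in> W" "w \<in> W" for f a b w
    unfolding E_def using that by (intro insertI2 image_eqI[of _ _ "(f, a, b, w)"]) auto
  \<comment> \<open>A link by \<open>D\<close> between \<open>e \<otimes> c\<close> and
    \<open>e' \<otimes> c'\<close> is a link by \<open>D'\<close> between \<open>c\<close> and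
    \<open>c'\<close>: pieces that are \<open>D'\<close>-apart stay \<open>D\<close>-apart after
    enlargement by \<open>E\<close>.\<close>
  define D' where "D' = (\<lambda>(e, \<delta>, e'). inv e \<otimes> \<delta> \<otimes> e') ` (E \<times> D \<times> E)"
  have D'_I: "inv e \<otimes> \<delta> \<otimes> e' \<in> D'" if "e \<in> E" "\<delta> \<in> D" "e' \<in> E" for e \<delta> e'
    unfolding D'_def using that by (intro image_eqI[of _ _ "(e, \<delta>, e')"]) auto
  have "window D'"
    unfolding window_def
  proof (intro conjI ballI)
    show "finite D'" unfolding D'_def using finE D by (auto simp: window_def)
    show "D' \<subseteq> carrier G" using E_carrier D_carrier by (auto simp: D'_def)
    have "\<one> \<in> E" by (simp add: E_def)
    then show "\<one> \<in> D'" using D'_I[of \<one> \<one> \<one>] D_one by simp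
    fix d assume "d \<in> D'"
    then obtain e \<delta> e' where d: "e \<in> E" "\<delta> \<in> D" "e' \<in> E" "d = inv e \<otimes> \<delta> \<otimes> e'"
      by (auto simp: D'_def)
    then have "inv d = inv e' \<otimes> inv \<delta> \<otimes> e"
      using E_carrier D_carrier by (simp add: inv_mult_group m_assoc)
    then show "inv d \<in> D'" using D'_I d D_inv by simp
  qed
  moreover have "irreducible R (recurrent Z W P) D'"
    unfolding irreducible_def
  proof (intro allI impI)
    fix C and X :: "'a \<Rightarrow> 'a \<Rightarrow> 'x"
    assume C: "C \<subseteq> carrier G" and X: "\<forall>c\<in>C. X c \<in> recurrent Z W P"
      and cons: "\<forall>c\<in>C. \<forall>\<delta>\<in>D'. \<delta> \<otimes> c \<in> C \<longrightarrow> X (\<delta> \<otimes> c) = X c"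
    define S\<^sub>0 where "S\<^sub>0 = {s \<in> carrier G. \<exists>c\<in>C. \<exists>w\<in>W. \<exists>t\<in>carrier G.
        w \<otimes> t = c \<and> touch W s t \<and> P (shift s (X c))}"
    define C\<^sub>0 where "C\<^sub>0 = C \<union> {f \<otimes> s |f s. f \<in> F \<and> s \<in> S\<^sub>0}"
    have nearS0: "\<exists>c\<in>C. P (shift s (X c)) \<and> (\<forall>f\<in>F. \<exists>e\<in>E. f \<otimes> s = e \<otimes> c)" if s: "s \<in> S\<^sub>0" for s
    proof -
      obtain c w t a b where *: "c \<in> C" "w \<in> W" "t \<in> carrier G" "w \<otimes> t = c" "a \<in> W" "b \<in> W"
        "a \<otimes> s = b \<otimes> t" "P (shift s (X c))" "s \<in> carrier G"
        using s unfolding S\<^sub>0_def touch_def by blast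
      have "s = inv a \<otimes> (b \<otimes> t)" using * W_carrier inv_solve_left' by (metis m_closed)
      moreover have "t = inv w \<otimes> c" using * W_carrier inv_solve_left' by (metis m_closed)
      ultimately have "f \<otimes> s = (f \<otimes> inv a \<otimes> b \<otimes> inv w) \<otimes> c" if "f \<in> F" for f
        using W_carrier[OF *(2)] W_carrier[OF *(5)] W_carrier[OF *(6)] F_carrier[OF that] *(1) C
        by (simp add: m_assoc subsetD)
      then have "\<forall>f\<in>F. \<exists>e\<in>E. f \<otimes> s = e \<otimes> c" using E_I *(2,5,6) by blast
      then show ?thesis using * by blast
    qed
    have nearC0: "\<exists>c\<in>C. \<exists>e\<in>E. u = e \<otimes> c" if "u \<in> C\<^sub>0" for u
    proof (cases "u \<in> C")
      case True
      then have "u = \<one> \<otimes> u" using C by auto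
      then show ?thesis using True by (auto simp: E_def)
    next
      case False
      then show ?thesis using that nearS0 unfolding C\<^sub>0_def by blast
    qed
    \<comment> \<open>Each point of \<open>C\<^sub>0\<close> copies from a nearby point of
      \<open>C\<close>; by \<open>same\<close> the copied configuration does not depend on the
      choice.\<close>
    define \<kappa> where "\<kappa> u = (SOME c. c \<in> C \<and> (\<exists>e\<in>E. u = e \<otimes> c))" for u
    have \<kappa>: "\<kappa> u \<in> C \<and> (\<exists>e\<in>E. u = e \<otimes> \<kappa> u)" if "u \<in> C\<^sub>0" for u
      unfolding \<kappa>_def by (rule someI_ex) (use nearC0[OF that] in blast)
    have same: "X c' = X c" if "c \<in> C" "c' \<in> C" "e \<in> E" "e' \<in> E" "\<delta> \<in> D" "\<delta> \<otimes> (e \<otimes> c) = e' \<otimes> c'"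
      for c c' e e' \<delta>
    proof -
      have "c' = inv e' \<otimes> (\<delta> \<otimes> (e \<otimes> c))"
        using that C E_carrier D_carrier inv_solve_left' by (metis m_closed subsetD)
      also have "\<dots> = (inv e' \<otimes> \<delta> \<otimes> e) \<otimes> c"
        using that C E_carrier D_carrier by (simp add: m_assoc subsetD)
      finally show ?thesis using cons that D'_I by blast
    qed
    have C0: "C\<^sub>0 \<subseteq> carrier G" using nearC0 C E_carrier by blast
    have X0: "X (\<kappa> (e \<otimes> c)) = X c" if ec: "e \<otimes> c \<in> C\<^sub>0" "e \<in> E" "c \<in> C" for e c
    proof -
      obtain e' where e': "e' \<in> E" "e \<otimes> c = e' \<otimes> \<kappa> (e \<otimes> c)" "\<kappa> (e \<otimes> c) \<in> C" using \<kappa>[OF ec(1)] by blast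
      have "\<one> \<otimes> (e \<otimes> c) = e' \<otimes> \<kappa> (e \<otimes> c)" using e'(2) ec C E_carrier by auto
      then show ?thesis using same[OF ec(3) e'(3) ec(2) e'(1) D_one] by simp
    qed
    let ?A = "{t \<in> carrier G. (\<forall>w\<in>W. w \<otimes> t \<notin> C) \<and> (\<forall>s\<in>S\<^sub>0. \<not> touch W s t)}"
    obtain S where S: "S \<subseteq> ?A" "\<forall>s\<in>S. \<forall>t\<in>S. touch W s t \<longrightarrow> s = t"
      "\<forall>t\<in>?A. \<exists>s\<in>S. touch W s t"
      using ex_maximal_separated[of ?A] by (elim exE conjE)
    obtain z where z: "z \<in> Z" "\<And>c. c \<in> C\<^sub>0 \<Longrightarrow> R (z c) (X (\<kappa> c) c)"
      "\<And>s f. \<lbrakk>s \<in> S; f \<in> F\<rbrakk> \<Longrightarrow> R (z (f \<otimes> s)) (q f)"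
    proof (rule place[OF C0, of "\<lambda>c. X (\<kappa> c)" S])
      show "X (\<kappa> c) \<in> Z" if "c \<in> C\<^sub>0" for c using \<kappa>[OF that] X by (auto simp: recurrent_def)
      show "X (\<kappa> (\<delta> \<otimes> c)) = X (\<kappa> c)" if c: "c \<in> C\<^sub>0" "\<delta> \<in> D" "\<delta> \<otimes> c \<in> C\<^sub>0" for c \<delta>
      proof -
        obtain e where e: "e \<in> E" "c = e \<otimes> \<kappa> c" "\<kappa> c \<in> C" using \<kappa>[OF c(1)] by blast
        obtain e' where e': "e' \<in> E" "\<delta> \<otimes> c = e' \<otimes> \<kappa> (\<delta> \<otimes> c)" "\<kappa> (\<delta> \<otimes> c) \<in> C" using \<kappa>[OF c(3)] by blast
        have "\<delta> \<otimes> (e \<otimes> \<kappa> c) = e' \<otimes> \<kappa> (\<delta> \<otimes> c)" using e(2) e'(2) by simp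
        then show ?thesis by (rule same[OF e(3) e'(3) e(1) e'(1) c(2)])
      qed
      show "S \<subseteq> carrier G" using S(1) by blast
      show "s = t" if "s \<in> S" "t \<in> S" "touch W s t" for s t using that S(2) by blast
      show "w \<otimes> s \<notin> C\<^sub>0" if s: "s \<in> S" "w \<in> W" for s w
      proof
        assume "w \<otimes> s \<in> C\<^sub>0"
        moreover have "w \<otimes> s \<notin> C" using S(1) s by blast
        ultimately obtain f t where ft: "f \<in> F" "t \<in> S\<^sub>0" "w \<otimes> s = f \<otimes> t" unfolding C\<^sub>0_def by blast
        then have "touch W t s" unfolding touch_def using F_W s(2) by metis
        then show False using S(1) s(1) ft(2) by blast
      qed
    qed blast
    \<comment> \<open>Around \<open>s\<close> the glued configuration copies \<open>X c\<close>, so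
      the occurrence survives by locality of \<open>P\<close>.\<close>
    have PS0: "P (shift s z)" if s: "s \<in> S\<^sub>0" for s
    proof -
      obtain c where c: "c \<in> C" "P (shift s (X c))" "\<forall>f\<in>F. \<exists>e\<in>E. f \<otimes> s = e \<otimes> c"
        using nearS0[OF s] by blast
      show ?thesis
      proof (rule local[OF _ c(2)])
        fix f assume f: "f \<in> F"
        then have u: "f \<otimes> s \<in> C\<^sub>0" unfolding C\<^sub>0_def using s by blast
        moreover have "X (\<kappa> (f \<otimes> s)) = X c" using X0 c(1,3) f u by metis
        ultimately have "R (z (f \<otimes> s)) (X c (f \<otimes> s))" using z(2) by metis
        then show "R (shift s (X c) f) (shift s z f)" using R_sym by (simp add: shift_def)
      qed
    qed
    have "\<exists>s\<in>carrier G. touch W s t \<and> P (shift s z)" if t: "t \<in> carrier G" for t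
    \<comment> \<open>If the window of \<open>t\<close> meets \<open>C\<close>, the occurrence that
      serves \<open>t\<close> in \<open>X (w \<otimes> t)\<close> was kept in
      \<open>S\<^sub>0\<close>; otherwise \<open>t\<close> touches \<open>S\<^sub>0\<close> or a
      planted site. All cases use the same window \<open>W\<close>.\<close>
    proof (cases "\<exists>w\<in>W. w \<otimes> t \<in> C")
      case True
      then obtain w where w: "w \<in> W" "w \<otimes> t \<in> C" by blast
      then obtain s where s: "s \<in> carrier G" "touch W s t" "P (shift s (X (w \<otimes> t)))"
        using X t unfolding recurrent_def by blast
      then have "s \<in> S\<^sub>0" unfolding S\<^sub>0_def using w t by blast
      then show ?thesis using PS0 s by blast
    next
      case noC: False
      show ?thesis
      proof (cases "\<exists>s\<in>S\<^sub>0. touch W s t")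
        case True
        then show ?thesis using PS0 unfolding S\<^sub>0_def by blast
      next
        case False
        then obtain s where "s \<in> S" "touch W s t" using S(3) noC t touch_refl by blast
        then show ?thesis using P_shift z(3) S(1) by blast
      qed
    qed
    then have "z \<in> recurrent Z W P" using z(1) by (simp add: recurrent_def)
    moreover have "R (z c) (X c c)" if c: "c \<in> C" for c
    proof -
      have c0: "c \<in> C\<^sub>0" and 1: "\<one> \<otimes> c = c" using c C by (auto simp: C\<^sub>0_def)
      have "X (\<kappa> c) = X c" using X0[of \<one> c] c c0 unfolding 1 by (simp add: E_def)
      then show ?thesis using z(2)[OF c0] by simp
    qed
    ultimately show "\<exists>z\<in>recurrent Z W P. \<forall>c\<in>C. R (z c) (X c c)" by blast
  qed
  ultimately show ?thesis by blast
qed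

end

section \<open>Extending partial 3-colourings\<close>

text \<open>Greedy colouring along \<open>\<gamma>\<close> never gets stuck, since two neighbours
  block at most two of three colours, and \<open>C\<close> may be infinite. With two colours the
  ends of a path could carry contradictory parities.\<close>

lemma extend_3_colouring:
  fixes nb :: "'a \<Rightarrow> 'a set" and \<gamma> :: "nat \<Rightarrow> 'a" and c\<^sub>0 :: "'a \<Rightarrow> nat"
  assumes nb: "\<And>t. finite (nb t)" "\<And>t. card (nb t) \<le> 2"
    and sym: "\<And>s t. s \<in> nb t \<Longrightarrow> t \<in> nb s" and irrefl: "\<And>t. t \<notin> nb t"
    and c\<^sub>0: "\<And>t. t \<in> C \<Longrightarrow> c\<^sub>0 t < 3" "\<And>s t. \<lbrakk>s \<in> C; t \<in> C; s \<in> nb t\<rbrakk> \<Longrightarrow> c\<^sub>0 s \<noteq> c\<^sub>0 t"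
  shows "\<exists>c. (\<forall>t\<in>C. c t = c\<^sub>0 t) \<and> (\<forall>t\<in>range \<gamma>. c t < 3)
    \<and> (\<forall>s\<in>range \<gamma>. \<forall>t\<in>range \<gamma>. s \<in> nb t \<longrightarrow> c s \<noteq> c t)"
proof -
  define B where "B n = C \<union> \<gamma> ` {..<n}" for n :: nat
  define ok where "ok n c \<longleftrightarrow> (\<forall>t\<in>C. c t = c\<^sub>0 t) \<and> (\<forall>t\<in>B n. c t < 3)
    \<and> (\<forall>s\<in>B n. \<forall>t\<in>B n. s \<in> nb t \<longrightarrow> c s \<noteq> c t)" for n and c :: "'a \<Rightarrow> nat"
  have "\<exists>f. \<forall>n. ok n (f n) \<and> (\<forall>t\<in>B n. f (Suc n) t = f n t)"
  proof (rule dependent_nat_choice)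
    show "\<exists>c. ok 0 c" unfolding ok_def B_def by (rule exI[of _ c\<^sub>0]) (use c\<^sub>0 in auto)
    fix c n assume ok: "ok n c"
    have BS: "B (Suc n) = insert (\<gamma> n) (B n)" by (auto simp: B_def less_Suc_eq)
    show "\<exists>c'. ok (Suc n) c' \<and> (\<forall>t\<in>B n. c' t = c t)"
    proof (cases "\<gamma> n \<in> B n")
      case True
      then have "B (Suc n) = B n" using BS by auto
      then show ?thesis using ok by (intro exI[of _ c]) (auto simp: ok_def)
    next
      case False
      have "card (c ` nb (\<gamma> n)) < card {..<3::nat}"
        using card_image_le[OF nb(1)[of "\<gamma> n"], of c] nb(2)[of "\<gamma> n"] by simp
      then have "\<not> {..<3} \<subseteq> c ` nb (\<gamma> n)"
        using card_mono[OF finite_imageI[OF nb(1)[of "\<gamma> n"]], of "{..<3}" c] by linarith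
      \<comment> \<open>Values at neighbours not coloured yet are avoided as well, which is harmless
        as there are at most two neighbours in all.\<close>
      then obtain v where v: "v < 3" "v \<notin> c ` nb (\<gamma> n)" by auto
      define c' where "c' = c(\<gamma> n := v)"
      have c'B: "c' t = c t" if "t \<in> B n" for t using that False by (auto simp: c'_def)
      have c'n: "c' (\<gamma> n) = v" by (simp add: c'_def)
      have "ok (Suc n) c'"
        unfolding ok_def
      proof (intro conjI ballI impI)
        show "c' t = c\<^sub>0 t" if "t \<in> C" for t
          using that ok c'B[of t] by (auto simp: ok_def B_def)
        show "c' t < 3" if "t \<in> B (Suc n)" for t
          using that c'B[of t] c'n v(1) ok unfolding BS ok_def by auto
        show "c' s \<noteq> c' t" if st: "s \<in> B (Suc n)" "t \<in> B (Suc n)" "s \<in> nb t" for s t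
        proof (cases "s = \<gamma> n")
          case s: True
          then have "t \<noteq> \<gamma> n" using st(3) irrefl by auto
          then have "c' t = c t" by (simp add: c'_def)
          moreover have "t \<in> nb (\<gamma> n)" using sym[OF st(3)] s by simp
          ultimately show ?thesis using v(2) c'n s by auto
        next
          case s: False
          then have cs: "c' s = c s" "s \<in> B n" using st(1) BS by (auto simp: c'_def)
          show ?thesis
          proof (cases "t = \<gamma> n")
            case True
            then show ?thesis using st(3) v(2) c'n cs(1) by (metis imageI)
          next
            case False
            then have "c' t = c t" "t \<in> B n" using st(2) BS by (auto simp: c'_def)
            then show ?thesis using cs st(3) ok by (auto simp: ok_def)
          qed
        qed
      qed
      then show ?thesis using c'B by blast
    qed
  qed
  then obtain f where f: "\<And>n. ok n (f n)" "\<And>n t. t \<in> B n \<Longrightarrow> f (Suc n) t = f n t" by blast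
  define ix where "ix t = (LEAST i. \<gamma> i = t)" for t
  \<comment> \<open>\<open>B n\<close> contains \<open>\<gamma> i\<close> for \<open>i < n\<close>,
    so the colour of \<open>t\<close> is final from stage \<open>Suc (ix t)\<close> on.\<close>
  define c where "c t = f (Suc (ix t)) t" for t
  have ix: "\<gamma> (ix t) = t" if "t \<in> range \<gamma>" for t
    unfolding ix_def by (rule LeastI_ex) (use that in auto)
  have stable: "f n t = c t" if "t \<in> range \<gamma>" "Suc (ix t) \<le> n" for n t
    using that(2)
  proof (induction n rule: dec_induct)
    case base then show ?case by (simp add: c_def)
  next
    case (step k)
    have "t \<in> B k" unfolding B_def using ix[OF that(1)] step(1) by (auto intro!: image_eqI[of _ _ "ix t"])
    then show ?case using f(2) step by simp
  qed
  show ?thesis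
  proof (intro exI[of _ c] conjI ballI impI)
    show "c t = c\<^sub>0 t" if "t \<in> C" for t using f(1)[of "Suc (ix t)"] that by (simp add: c_def ok_def)
    show "c t < 3" if "t \<in> range \<gamma>" for t
    proof -
      have "t \<in> B (Suc (ix t))" unfolding B_def using ix[OF that] by (auto intro!: image_eqI[of _ _ "ix t"])
      then show ?thesis using f(1)[of "Suc (ix t)"] by (simp add: c_def ok_def)
    qed
    fix s t assume st: "s \<in> range \<gamma>" "t \<in> range \<gamma>" "s \<in> nb t"
    define n where "n = Suc (max (ix s) (ix t))"
    have "s \<in> B n" "t \<in> B n" unfolding B_def n_def using ix[OF st(1)] ix[OF st(2)]
      by (auto intro!: image_eqI[of s _ "ix s"] image_eqI[of t _ "ix t"])
    then have "f n s \<noteq> f n t" using f(1)[of n] st(3) unfolding ok_def by blast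
    then show "c s \<noteq> c t" using stable[OF st(1), of n] stable[OF st(2), of n] by (simp add: n_def)
  qed
qed

section \<open>Configurations with values in \<open>H\<close> and colour layers\<close>

locale bi_invariant_metric = group H for H :: "('h, 'm) monoid_scheme" (structure) +
  fixes d :: "'h \<Rightarrow> 'h \<Rightarrow> real"
  assumes d_self: "a \<in> carrier H \<Longrightarrow> d a a = 0"
    and d_pos: "\<lbrakk>a \<in> carrier H; b \<in> carrier H; a \<noteq> b\<rbrakk> \<Longrightarrow> 0 < d a b"
    and d_sym: "\<lbrakk>a \<in> carrier H; b \<in> carrier H\<rbrakk> \<Longrightarrow> d a b = d b a"
    and d_triangle: "\<lbrakk>a \<in> carrier H; b \<in> carrier H; c \<in> carrier H\<rbrakk> \<Longrightarrow> d a c \<le> d a b + d b c"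
    and d_left: "\<lbrakk>a \<in> carrier H; b \<in> carrier H; c \<in> carrier H\<rbrakk> \<Longrightarrow> d (c \<otimes> a) (c \<otimes> b) = d a b"
    and d_right: "\<lbrakk>a \<in> carrier H; b \<in> carrier H; c \<in> carrier H\<rbrakk> \<Longrightarrow> d (a \<otimes> c) (b \<otimes> c) = d a b"
    and totally_bounded: "0 < \<epsilon> \<Longrightarrow> \<exists>N. finite N \<and> N \<subseteq> carrier H \<and> (\<forall>h\<in>carrier H. \<exists>a\<in>N. d a h < \<epsilon>)"

text \<open>A value is an element of \<open>H\<close> with one colour for each layer. Gluing is
  exact in \<open>H\<close>, and approximation enters only through \<open>close\<close>. Layers from
  \<open>n\<close> on are ignored so that they can still be recoloured.\<close>

definition agree :: "nat \<Rightarrow> 'h \<times> (nat \<Rightarrow> nat) \<Rightarrow> 'h \<times> (nat \<Rightarrow> nat) \<Rightarrow> bool" where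
  "agree n a b \<longleftrightarrow> fst a = fst b \<and> (\<forall>i<n. snd a i = snd b i)"

lemma agree_refl: "agree n a a"
  by (simp add: agree_def)

lemma agree_sym: "agree n a b \<Longrightarrow> agree n b a"
  by (simp add: agree_def)

lemma agree_trans: "agree n a b \<Longrightarrow> agree n b c \<Longrightarrow> agree n a c"
  by (simp add: agree_def)

lemma agree_mono: "agree n a b \<Longrightarrow> m \<le> n \<Longrightarrow> agree m a b"
  by (simp add: agree_def)

locale configurations = G: group G + bi_invariant_metric H d
  for G :: "('g, 'a) monoid_scheme" and H :: "('h, 'b) monoid_scheme" (structure)
    and d :: "'h \<Rightarrow> 'h \<Rightarrow> real" +
  fixes \<gamma> :: "nat \<Rightarrow> 'g"
  assumes infinite_G: "infinite (carrier G)" and range_\<gamma>: "range \<gamma> = carrier G"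
begin

text \<open>The target is \<open>b\<close> moved by \<open>h\<close>: the action of \<open>H\<close>
  multiplies the first component on the right and leaves the colours alone.\<close>

definition close :: "real \<Rightarrow> nat \<Rightarrow> 'h \<Rightarrow> 'h \<times> (nat \<Rightarrow> nat) \<Rightarrow> 'h \<times> (nat \<Rightarrow> nat) \<Rightarrow> bool" where
  "close \<epsilon> m h a b \<longleftrightarrow> d (fst a) (fst b \<otimes> h) < \<epsilon> \<and> (\<forall>i<m. snd a i = snd b i)"

text \<open>Layer \<open>n\<close> is reserved for \<open>\<gamma> n\<close> and carries a proper
  3-colouring of the graph joining \<open>t\<close> to \<open>\<gamma> n t\<close>. For trivial
  \<open>\<gamma> n\<close> the edges would be loops.\<close>

definition proper :: "nat \<Rightarrow> ('g \<Rightarrow> 'h \<times> (nat \<Rightarrow> nat)) \<Rightarrow> bool" where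
  "proper n z \<longleftrightarrow> (\<forall>t\<in>carrier G. snd (z t) n < 3 \<and>
     (\<gamma> n \<noteq> \<one>\<^bsub>G\<^esub> \<longrightarrow> snd (z (\<gamma> n \<otimes>\<^bsub>G\<^esub> t)) n \<noteq> snd (z t) n))"

definition translate :: "'h \<Rightarrow> ('g \<Rightarrow> 'h \<times> (nat \<Rightarrow> nat)) \<Rightarrow> 'g \<Rightarrow> 'h \<times> (nat \<Rightarrow> nat)" where
  "translate k z = (\<lambda>t. (fst (z t) \<otimes> k, snd (z t)))"

text \<open>Colours with index at least \<open>n\<close> are still unconstrained in a set that is good at level \<open>n\<close>.\<close>

definition good :: "nat \<Rightarrow> ('g \<Rightarrow> 'h \<times> (nat \<Rightarrow> nat)) set \<Rightarrow> bool" where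
  "good n Z \<longleftrightarrow> (\<exists>D. G.window D \<and> G.irreducible (agree n) Z D)
     \<and> (\<forall>z\<in>Z. \<forall>t\<in>carrier G. fst (z t) \<in> carrier H)
     \<and> (\<forall>z\<in>Z. \<forall>s\<in>carrier G. G.shift s z \<in> Z)
     \<and> (\<forall>z\<in>Z. \<forall>k\<in>carrier H. translate k z \<in> Z)
     \<and> (\<forall>z\<in>Z. \<forall>z'. (\<forall>t\<in>carrier G. agree n (z t) (z' t)) \<longrightarrow> z' \<in> Z)"

lemma \<gamma>_carrier [simp]: "\<gamma> n \<in> carrier G"
  using range_\<gamma> by blast

lemma goodD:
  assumes "good n Z"
  shows "\<exists>D. G.window D \<and> G.irreducible (agree n) Z D"
    and "\<And>z t. \<lbrakk>z \<in> Z; t \<in> carrier G\<rbrakk> \<Longrightarrow> fst (z t) \<in> carrier H"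
    and "\<And>z s. \<lbrakk>z \<in> Z; s \<in> carrier G\<rbrakk> \<Longrightarrow> G.shift s z \<in> Z"
    and "\<And>z k. \<lbrakk>z \<in> Z; k \<in> carrier H\<rbrakk> \<Longrightarrow> translate k z \<in> Z"
    and "\<And>z z'. \<lbrakk>z \<in> Z; \<And>t. t \<in> carrier G \<Longrightarrow> agree n (z t) (z' t)\<rbrakk> \<Longrightarrow> z' \<in> Z"
  using assms unfolding good_def by simp_all

lemma goodI:
  assumes "G.window D" "G.irreducible (agree n) Z D"
    and "\<And>z t. \<lbrakk>z \<in> Z; t \<in> carrier G\<rbrakk> \<Longrightarrow> fst (z t) \<in> carrier H"
    and "\<And>z s. \<lbrakk>z \<in> Z; s \<in> carrier G\<rbrakk> \<Longrightarrow> G.shift s z \<in> Z"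
    and "\<And>z k. \<lbrakk>z \<in> Z; k \<in> carrier H\<rbrakk> \<Longrightarrow> translate k z \<in> Z"
    and "\<And>z z'. \<lbrakk>z \<in> Z; \<And>t. t \<in> carrier G \<Longrightarrow> agree n (z t) (z' t)\<rbrakk> \<Longrightarrow> z' \<in> Z"
  shows "good n Z"
  using assms unfolding good_def by auto

lemma good_full: "good 0 {z. \<forall>t\<in>carrier G. fst (z t) \<in> carrier H}" (is "good 0 ?Z")
proof -
  have "G.irreducible (agree 0) ?Z {\<one>\<^bsub>G\<^esub>}"
    unfolding G.irreducible_def
  proof (intro allI impI)
    fix C X assume C: "C \<subseteq> carrier G" and X: "\<forall>c\<in>C. X c \<in> ?Z"
    let ?z = "\<lambda>t. if t \<in> C then X t t else (\<one>, \<lambda>_. 0)"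
    have "?z \<in> ?Z" using X by auto
    then show "\<exists>z\<in>?Z. \<forall>c\<in>C. agree 0 (z c) (X c c)"
      by (rule rev_bexI) (simp add: agree_refl)
  qed
  moreover have "G.window {\<one>\<^bsub>G\<^esub>}" by (simp add: G.window_def)
  ultimately show ?thesis
    unfolding good_def by (auto simp: G.shift_def translate_def agree_def)
qed

text \<open>Each \<open>t\<close> has at most the neighbours \<open>\<gamma> n t\<close> and
  \<open>inv (\<gamma> n) t\<close>. Only layer \<open>n\<close> is rewritten, so sets that are good
  at level \<open>n\<close> do not notice the change.\<close>

lemma recolour:
  assumes C: "C \<subseteq> carrier G"
    and c\<^sub>0: "\<And>t. t \<in> C \<Longrightarrow> c\<^sub>0 t < 3"
      "\<And>t. \<lbrakk>t \<in> C; \<gamma> n \<otimes>\<^bsub>G\<^esub> t \<in> C; \<gamma> n \<noteq> \<one>\<^bsub>G\<^esub>\<rbrakk> \<Longrightarrow> c\<^sub>0 (\<gamma> n \<otimes>\<^bsub>G\<^esub> t) \<noteq> c\<^sub>0 t"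
  obtains z' where "\<And>t. agree n (z t) (z' t)" "\<And>t. t \<in> C \<Longrightarrow> snd (z' t) n = c\<^sub>0 t" "proper n z'"
proof -
  let ?g = "\<gamma> n"
  define nb where "nb t = {s. s \<in> carrier G \<and> t \<in> carrier G \<and> ?g \<noteq> \<one>\<^bsub>G\<^esub> \<and>
    (s = ?g \<otimes>\<^bsub>G\<^esub> t \<or> t = ?g \<otimes>\<^bsub>G\<^esub> s)}" for t
  have nb_sub: "nb t \<subseteq> {?g \<otimes>\<^bsub>G\<^esub> t, inv\<^bsub>G\<^esub> ?g \<otimes>\<^bsub>G\<^esub> t}" for t
    by (auto simp: nb_def G.m_assoc[symmetric])
  have "\<exists>c. (\<forall>t\<in>C. c t = c\<^sub>0 t) \<and> (\<forall>t\<in>range \<gamma>. c t < 3)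
    \<and> (\<forall>s\<in>range \<gamma>. \<forall>t\<in>range \<gamma>. s \<in> nb t \<longrightarrow> c s \<noteq> c t)"
  proof (rule extend_3_colouring)
    show "finite (nb t)" for t using finite_subset[OF nb_sub] by simp
    show "card (nb t) \<le> 2" for t
      using card_mono[OF _ nb_sub, of t] card_insert_le_m1[of 2 "{inv\<^bsub>G\<^esub> ?g \<otimes>\<^bsub>G\<^esub> t}" "?g \<otimes>\<^bsub>G\<^esub> t"] by simp
    show "t \<in> nb s" if "s \<in> nb t" for s t using that by (auto simp: nb_def)
    show "t \<notin> nb t" for t by (auto simp: nb_def)
    show "c\<^sub>0 s \<noteq> c\<^sub>0 t" if "s \<in> C" "t \<in> C" "s \<in> nb t" for s t
      using that c\<^sub>0(2)[of t] c\<^sub>0(2)[of s] by (auto simp: nb_def)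
  qed (fact c\<^sub>0)
  then obtain c where c: "\<forall>t\<in>C. c t = c\<^sub>0 t" "\<forall>t\<in>carrier G. c t < 3"
    "\<forall>s\<in>carrier G. \<forall>t\<in>carrier G. s \<in> nb t \<longrightarrow> c s \<noteq> c t"
    unfolding range_\<gamma> by (elim exE conjE)
  define z' where "z' t = (fst (z t), (snd (z t))(n := c t))" for t
  have "proper n z'"
    unfolding proper_def
  proof (intro ballI conjI impI)
    fix t assume t: "t \<in> carrier G"
    show "snd (z' t) n < 3" using c(2) t by (simp add: z'_def)
    assume "?g \<noteq> \<one>\<^bsub>G\<^esub>"
    then have "?g \<otimes>\<^bsub>G\<^esub> t \<in> nb t" using t by (simp add: nb_def)
    then show "snd (z' (?g \<otimes>\<^bsub>G\<^esub> t)) n \<noteq> snd (z' t) n" using c(3) t by (simp add: z'_def)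
  qed
  moreover have "agree n (z t) (z' t)" for t by (simp add: agree_def z'_def)
  moreover have "snd (z' t) n = c\<^sub>0 t" if "t \<in> C" for t using c(1) that by (simp add: z'_def)
  ultimately show ?thesis using that by metis
qed

lemma colour_step:
  assumes good: "good n Z"
  shows "good (Suc n) {z \<in> Z. proper n z}" (is "good _ ?Z'")
    and "z \<in> Z \<Longrightarrow> \<exists>z'\<in>{z \<in> Z. proper n z}. \<forall>t\<in>carrier G. agree n (z t) (z' t)"
proof -
  obtain D where D: "G.window D" "G.irreducible (agree n) Z D"
    using goodD(1)[OF good] by (elim exE conjE)
  note Hval = goodD(2)[OF good] and shift = goodD(3)[OF good]
    and trans = goodD(4)[OF good] and insens = goodD(5)[OF good]
  \<comment> \<open>With \<open>\<gamma> n\<close> and its inverse in the window, adjacent points of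
    \<open>C\<close> copy from the same proper configuration, so the prescribed colours are
    compatible.\<close>
  define D' where "D' = D \<union> {\<gamma> n, inv\<^bsub>G\<^esub> \<gamma> n}"
  have D': "G.window D'" using D(1) by (auto simp: G.window_def D'_def)
  have irr': "G.irreducible (agree (Suc n)) ?Z' D'"
    unfolding G.irreducible_def
  proof (intro allI impI)
    fix C and X :: "'g \<Rightarrow> 'g \<Rightarrow> 'h \<times> (nat \<Rightarrow> nat)"
    assume C: "C \<subseteq> carrier G" and X: "\<forall>c\<in>C. X c \<in> ?Z'"
      and cons: "\<forall>c\<in>C. \<forall>\<delta>\<in>D'. \<delta> \<otimes>\<^bsub>G\<^esub> c \<in> C \<longrightarrow> X (\<delta> \<otimes>\<^bsub>G\<^esub> c) = X c"
    obtain z where z: "z \<in> Z" "\<And>c. c \<in> C \<Longrightarrow> agree n (z c) (X c c)"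
      by (rule G.irreducibleD[OF D(2) C, of X]) (use X cons in \<open>auto simp: D'_def\<close>)
    obtain z' where z': "\<And>t. agree n (z t) (z' t)" "\<And>t. t \<in> C \<Longrightarrow> snd (z' t) n = snd (X t t) n" "proper n z'"
    proof (rule recolour[OF C, of "\<lambda>t. snd (X t t) n" n z])
      show "snd (X t t) n < 3" if "t \<in> C" for t
        using X that C by (auto simp: proper_def)
      show "snd (X (\<gamma> n \<otimes>\<^bsub>G\<^esub> t) (\<gamma> n \<otimes>\<^bsub>G\<^esub> t)) n \<noteq> snd (X t t) n"
        if t: "t \<in> C" "\<gamma> n \<otimes>\<^bsub>G\<^esub> t \<in> C" "\<gamma> n \<noteq> \<one>\<^bsub>G\<^esub>" for t
      proof -
        have "X (\<gamma> n \<otimes>\<^bsub>G\<^esub> t) = X t" using cons t by (auto simp: D'_def)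
        moreover have "proper n (X t)" using X t by blast
        ultimately show ?thesis using t C by (auto simp: proper_def)
      qed
    qed blast
    have "z' \<in> ?Z'" using insens[OF z(1), of z'] z' by blast
    moreover have "agree (Suc n) (z' c) (X c c)" if "c \<in> C" for c
      using z(2)[OF that] z'(1)[of c] z'(2)[OF that] by (auto simp: agree_def less_Suc_eq)
    ultimately show "\<exists>z\<in>?Z'. \<forall>c\<in>C. agree (Suc n) (z c) (X c c)" by blast
  qed
  have sh: "G.shift s z \<in> ?Z'" if "z \<in> ?Z'" "s \<in> carrier G" for z s
    using that shift by (auto simp: proper_def G.shift_def G.m_assoc)
  have tr: "translate k z \<in> ?Z'" if "z \<in> ?Z'" "k \<in> carrier H" for z k
    using that trans by (auto simp: proper_def translate_def)
  have ins: "z' \<in> ?Z'" if z: "z \<in> ?Z'" "\<And>t. t \<in> carrier G \<Longrightarrow> agree (Suc n) (z t) (z' t)" for z z'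
  proof -
    have "z' \<in> Z" by (rule insens[of z]) (use z in \<open>auto simp: agree_def\<close>)
    moreover have "snd (z t) n = snd (z' t) n" if "t \<in> carrier G" for t using z(2) that by (auto simp: agree_def)
    ultimately show ?thesis using z(1) by (auto simp: proper_def)
  qed
  show "good (Suc n) ?Z'"
  proof (rule goodI[OF D' irr'])
    show "fst (z t) \<in> carrier H" if "z \<in> ?Z'" "t \<in> carrier G" for z t using Hval that by blast
  qed (fact sh tr ins)+
  assume z: "z \<in> Z"
  obtain z' where z': "\<And>t. agree n (z t) (z' t)" "proper n z'"
    by (rule recolour[of "{}" "\<lambda>_. 0" n z]) auto
  then show "\<exists>z'\<in>?Z'. \<forall>t\<in>carrier G. agree n (z t) (z' t)"
    using insens[OF z, of z'] by blast
qed

text \<open>As \<open>G\<close> is infinite, the sites \<open>g a\<close> can be chosen one after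
  another outside finite forbidden sets.\<close>

lemma spread:
  assumes "finite N" "a\<^sub>0 \<notin> N" "finite B" "B \<subseteq> carrier G"
  shows "\<exists>g. g a\<^sub>0 = \<one>\<^bsub>G\<^esub> \<and> g ` insert a\<^sub>0 N \<subseteq> carrier G \<and>
    (\<forall>a\<in>insert a\<^sub>0 N. \<forall>b\<in>insert a\<^sub>0 N. \<forall>x\<in>B. g a = x \<otimes>\<^bsub>G\<^esub> g b \<longrightarrow> a = b)"
  using assms(1,2)
proof (induction N)
  case empty
  then show ?case by (intro exI[of _ "\<lambda>_. \<one>\<^bsub>G\<^esub>"]) auto
next
  case (insert n N)
  then obtain g where g: "g a\<^sub>0 = \<one>\<^bsub>G\<^esub>" "g ` insert a\<^sub>0 N \<subseteq> carrier G"
    "\<forall>a\<in>insert a\<^sub>0 N. \<forall>b\<in>insert a\<^sub>0 N. \<forall>x\<in>B. g a = x \<otimes>\<^bsub>G\<^esub> g b \<longrightarrow> a = b" by auto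
  \<comment> \<open>The two parts exclude \<open>y = x g b\<close> and \<open>g b = x y\<close>, as
    \<open>B\<close> need not be symmetric.\<close>
  let ?V = "(\<lambda>(x, b). x \<otimes>\<^bsub>G\<^esub> g b) ` (B \<times> insert a\<^sub>0 N) \<union> (\<lambda>(x, b). inv\<^bsub>G\<^esub> x \<otimes>\<^bsub>G\<^esub> g b) ` (B \<times> insert a\<^sub>0 N)"
  have "finite ?V" using insert(1) assms(3) by auto
  then obtain y where y: "y \<in> carrier G" "y \<notin> ?V" using infinite_G by (metis finite_subset subsetI)
  have y1: "y \<noteq> x \<otimes>\<^bsub>G\<^esub> g b" if "x \<in> B" "b \<in> insert a\<^sub>0 N" for x b
    using y(2) that by force
  have y2: "g b \<noteq> x \<otimes>\<^bsub>G\<^esub> y" if "x \<in> B" "b \<in> insert a\<^sub>0 N" for x b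
  proof
    assume "g b = x \<otimes>\<^bsub>G\<^esub> y"
    moreover have "x \<in> carrier G" using that(1) assms(4) by blast
    ultimately have "y = inv\<^bsub>G\<^esub> x \<otimes>\<^bsub>G\<^esub> g b" using y(1) by (simp add: G.m_assoc[symmetric])
    then show False using y(2) that by force
  qed
  have n: "n \<notin> insert a\<^sub>0 N" using insert by auto
  let ?g = "g(n := y)"
  have g': "?g b = g b" if "b \<in> insert a\<^sub>0 N" for b using that n by auto
  have "a = b" if ab: "a \<in> insert a\<^sub>0 (insert n N)" "b \<in> insert a\<^sub>0 (insert n N)" "x \<in> B"
    "?g a = x \<otimes>\<^bsub>G\<^esub> ?g b" for a b x
  proof (cases "a = n")
    case True
    show ?thesis
    proof (rule ccontr)
      assume "a \<noteq> b"
      then have b: "b \<in> insert a\<^sub>0 N" using ab True by auto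
      show False using y1[OF ab(3) b] ab(4) g'[OF b] True by simp
    qed
  next
    case False
    then have a: "a \<in> insert a\<^sub>0 N" using ab by auto
    show ?thesis
    proof (cases "b = n")
      case True
      then show ?thesis using y2[OF ab(3) a] ab(4) g'[OF a] by simp
    next
      case False
      then have b: "b \<in> insert a\<^sub>0 N" using ab by auto
      have "g a = x \<otimes>\<^bsub>G\<^esub> g b" using ab(4) g'[OF a] g'[OF b] by simp
      then show ?thesis using g(3) a b ab(3) by blast
    qed
  qed
  moreover have "?g a\<^sub>0 = \<one>\<^bsub>G\<^esub>" using g(1) n by auto
  moreover have "?g ` insert a\<^sub>0 (insert n N) \<subseteq> carrier G" using g(2) y(1) by auto
  ultimately show ?case by (intro exI[of _ ?g]) blast
qed

end

section \<open>Construction of a recurrent configuration\<close>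

context configurations
begin

lemma close_agree:
  assumes "close \<epsilon> m h a b" "agree m a a'" "agree m b b'" shows "close \<epsilon> m h a' b'"
  using assms by (auto simp: close_def agree_def)

text \<open>The copy of \<open>z\<close> moved by \<open>a\<close> sits at the site
  \<open>g a\<close>. Since \<open>g\<close> sends the identity to the identity, the unmoved copy
  stays in place and \<open>q\<close> still agrees with \<open>z\<close> on
  \<open>F\<close>.\<close>

lemma ex_spread_pattern:
  assumes good: "good m Z" and z: "z \<in> Z" and F: "finite F" "F \<subseteq> carrier G"
    and N: "finite N" "N \<subseteq> carrier H" "\<one> \<in> N"
  obtains g q where "g \<one> = \<one>\<^bsub>G\<^esub>" "\<And>a. a \<in> N \<Longrightarrow> g a \<in> carrier G" "q \<in> Z"
    "\<And>a f. \<lbrakk>a \<in> N; f \<in> F\<rbrakk> \<Longrightarrow> agree m (q (f \<otimes>\<^bsub>G\<^esub> g a)) (translate a z f)"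
proof -
  obtain D where D: "G.window D" "G.irreducible (agree m) Z D"
    using goodD(1)[OF good] by (elim exE conjE)
  note shift = goodD(3)[OF good] and trans = goodD(4)[OF good]
  have D_carrier: "\<delta> \<in> carrier G" if "\<delta> \<in> D" for \<delta> using D(1) that by (auto simp: G.window_def)
  have F_carrier: "f \<in> carrier G" if "f \<in> F" for f using F that by blast
  \<comment> \<open>If \<open>D\<close> links place \<open>f'\<close> of the copy at
    \<open>g b\<close> to place \<open>f\<close> of the copy at \<open>g a\<close>, then
    \<open>g a = x g b\<close> for some \<open>x\<close> in \<open>B\<close>.\<close>
  define B where "B = (\<lambda>(f, \<delta>, f'). inv\<^bsub>G\<^esub> f \<otimes>\<^bsub>G\<^esub> \<delta> \<otimes>\<^bsub>G\<^esub> f') ` (F \<times> D \<times> F)"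
  have "finite B" using F D(1) by (auto simp: B_def G.window_def)
  moreover have "B \<subseteq> carrier G" using F_carrier D_carrier by (auto simp: B_def)
  ultimately obtain g where g1: "g \<one> = \<one>\<^bsub>G\<^esub>" and gN: "g ` insert \<one> (N - {\<one>}) \<subseteq> carrier G"
    and gB: "\<forall>a\<in>insert \<one> (N - {\<one>}). \<forall>b\<in>insert \<one> (N - {\<one>}). \<forall>x\<in>B. g a = x \<otimes>\<^bsub>G\<^esub> g b \<longrightarrow> a = b"
    using spread[of "N - {\<one>}" \<one> B] N(1) by auto
  have NN: "insert \<one> (N - {\<one>}) = N" using N(3) by auto
  have g_carrier: "g a \<in> carrier G" if "a \<in> N" for a using gN that unfolding NN by blast
  have apart: "a = b" if ab: "a \<in> N" "b \<in> N" "f \<in> F" "f' \<in> F" "\<delta> \<in> D"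
    "\<delta> \<otimes>\<^bsub>G\<^esub> (f' \<otimes>\<^bsub>G\<^esub> g b) = f \<otimes>\<^bsub>G\<^esub> g a" for a b f f' \<delta>
  proof -
    have "g a = inv\<^bsub>G\<^esub> f \<otimes>\<^bsub>G\<^esub> (f \<otimes>\<^bsub>G\<^esub> g a)"
      using F_carrier[OF ab(3)] g_carrier[OF ab(1)] by (simp add: G.m_assoc[symmetric])
    also have "\<dots> = (inv\<^bsub>G\<^esub> f \<otimes>\<^bsub>G\<^esub> \<delta> \<otimes>\<^bsub>G\<^esub> f') \<otimes>\<^bsub>G\<^esub> g b"
      unfolding ab(6)[symmetric]
      using F_carrier[OF ab(3)] F_carrier[OF ab(4)] g_carrier[OF ab(2)] D_carrier[OF ab(5)]
      by (simp add: G.m_assoc)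
    finally have "g a = (inv\<^bsub>G\<^esub> f \<otimes>\<^bsub>G\<^esub> \<delta> \<otimes>\<^bsub>G\<^esub> f') \<otimes>\<^bsub>G\<^esub> g b" .
    moreover have "inv\<^bsub>G\<^esub> f \<otimes>\<^bsub>G\<^esub> \<delta> \<otimes>\<^bsub>G\<^esub> f' \<in> B"
      unfolding B_def using ab by (intro image_eqI[of _ _ "(f, \<delta>, f')"]) auto
    ultimately show ?thesis using gB ab(1,2) unfolding NN by blast
  qed
  define C where "C = {f \<otimes>\<^bsub>G\<^esub> g a |f a. f \<in> F \<and> a \<in> N}"
  define \<kappa> where "\<kappa> u = (SOME a. a \<in> N \<and> (\<exists>f\<in>F. u = f \<otimes>\<^bsub>G\<^esub> g a))" for u
  define X where "X u = translate (\<kappa> u) (G.shift (inv\<^bsub>G\<^esub> g (\<kappa> u)) z)" for u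
  have C_carrier: "C \<subseteq> carrier G" using F_carrier g_carrier by (auto simp: C_def)
  have D_one: "\<one>\<^bsub>G\<^esub> \<in> D" using D(1) by (simp add: G.window_def)
  have \<kappa>: "\<kappa> u \<in> N" "\<exists>f\<in>F. u = f \<otimes>\<^bsub>G\<^esub> g (\<kappa> u)" if "u \<in> C" for u
  proof -
    have "\<kappa> u \<in> N \<and> (\<exists>f\<in>F. u = f \<otimes>\<^bsub>G\<^esub> g (\<kappa> u))"
      unfolding \<kappa>_def by (rule someI_ex) (use that in \<open>auto simp: C_def\<close>)
    then show "\<kappa> u \<in> N" "\<exists>f\<in>F. u = f \<otimes>\<^bsub>G\<^esub> g (\<kappa> u)" by auto
  qed
  have \<kappa>D: "\<kappa> (\<delta> \<otimes>\<^bsub>G\<^esub> u) = \<kappa> u" if u: "u \<in> C" "\<delta> \<in> D" "\<delta> \<otimes>\<^bsub>G\<^esub> u \<in> C" for u \<delta>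
  proof -
    obtain f f' where f: "f \<in> F" "u = f \<otimes>\<^bsub>G\<^esub> g (\<kappa> u)" "f' \<in> F"
      "\<delta> \<otimes>\<^bsub>G\<^esub> u = f' \<otimes>\<^bsub>G\<^esub> g (\<kappa> (\<delta> \<otimes>\<^bsub>G\<^esub> u))"
      using \<kappa>(2)[OF u(1)] \<kappa>(2)[OF u(3)] by (elim bexE)
    have "\<delta> \<otimes>\<^bsub>G\<^esub> (f \<otimes>\<^bsub>G\<^esub> g (\<kappa> u)) = f' \<otimes>\<^bsub>G\<^esub> g (\<kappa> (\<delta> \<otimes>\<^bsub>G\<^esub> u))" using f(2,4) by simp
    then show ?thesis by (rule apart[OF \<kappa>(1)[OF u(3)] \<kappa>(1)[OF u(1)] f(3) f(1) u(2)])
  qed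
  have \<kappa>eq: "\<kappa> (f \<otimes>\<^bsub>G\<^esub> g a) = a" if a: "a \<in> N" "f \<in> F" for a f
  proof -
    let ?u = "f \<otimes>\<^bsub>G\<^esub> g a"
    have u: "?u \<in> C" using a by (auto simp: C_def)
    obtain f' where f': "f' \<in> F" "?u = f' \<otimes>\<^bsub>G\<^esub> g (\<kappa> ?u)" using \<kappa>(2)[OF u] by (elim bexE)
    have "\<one>\<^bsub>G\<^esub> \<otimes>\<^bsub>G\<^esub> ?u = f' \<otimes>\<^bsub>G\<^esub> g (\<kappa> ?u)"
      using f'(2) u C_carrier by auto
    then show ?thesis by (rule apart[OF \<kappa>(1)[OF u] a(1) f'(1) a(2) D_one])
  qed
  obtain q where q: "q \<in> Z" "\<And>c. c \<in> C \<Longrightarrow> agree m (q c) (X c c)"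
  proof (rule G.irreducibleD[OF D(2) C_carrier, of X])
    show "X c \<in> Z" if "c \<in> C" for c
      using \<kappa>(1)[OF that] N(2) g_carrier trans shift z unfolding X_def by blast
    show "X (\<delta> \<otimes>\<^bsub>G\<^esub> c) = X c" if "c \<in> C" "\<delta> \<in> D" "\<delta> \<otimes>\<^bsub>G\<^esub> c \<in> C" for c \<delta>
      using \<kappa>D[OF that] by (simp add: X_def)
  qed blast
  have fin: "agree m (q (f \<otimes>\<^bsub>G\<^esub> g a)) (translate a z f)" if a: "a \<in> N" "f \<in> F" for a f
  proof -
    have "f \<otimes>\<^bsub>G\<^esub> g a \<in> C" using a by (auto simp: C_def)
    then have "agree m (q (f \<otimes>\<^bsub>G\<^esub> g a)) (X (f \<otimes>\<^bsub>G\<^esub> g a) (f \<otimes>\<^bsub>G\<^esub> g a))" by (rule q(2))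
    moreover have "X (f \<otimes>\<^bsub>G\<^esub> g a) (f \<otimes>\<^bsub>G\<^esub> g a) = translate a z f"
      using \<kappa>eq[OF a] F_carrier[OF a(2)] g_carrier[OF a(1)]
      by (simp add: X_def translate_def G.shift_def G.m_assoc)
    ultimately show ?thesis by simp
  qed
  show ?thesis by (rule that[of g q]) (fact g1 g_carrier q(1) fin)+
qed

text \<open>A pattern \<open>q\<close> that holds the translates of \<open>z\<close> by an
  \<epsilon>-net is made recurrent. Since \<open>q\<close> can be realized in place, some point of
  the smaller set still agrees with \<open>z\<close> on \<open>F\<close>.\<close>

lemma pattern_step:
  assumes good: "good m Z" and z: "z \<in> Z" and F: "finite F" "F \<subseteq> carrier G" "F \<noteq> {}" and \<epsilon>: "0 < \<epsilon>"
  shows "\<exists>Z' z' E. good m Z' \<and> Z' \<subseteq> Z \<and> z' \<in> Z' \<and> (\<forall>f\<in>F. agree m (z' f) (z f))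
    \<and> finite E \<and> E \<subseteq> carrier G
    \<and> (\<forall>w\<in>Z'. \<forall>t\<in>carrier G. \<forall>h\<in>carrier H. \<exists>e\<in>E. \<forall>f\<in>F. close \<epsilon> m h (w (f \<otimes>\<^bsub>G\<^esub> (e \<otimes>\<^bsub>G\<^esub> t))) (z f))"
proof -
  obtain D where D: "G.window D" "G.irreducible (agree m) Z D"
    using goodD(1)[OF good] by (elim exE conjE)
  note Hval = goodD(2)[OF good] and shift = goodD(3)[OF good]
    and trans = goodD(4)[OF good] and insens = goodD(5)[OF good]
  have F_carrier: "f \<in> carrier G" if "f \<in> F" for f using F that by blast
  obtain N\<^sub>0 where N0: "finite N\<^sub>0" "N\<^sub>0 \<subseteq> carrier H" "\<forall>h\<in>carrier H. \<exists>a\<in>N\<^sub>0. d a h < \<epsilon>"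
    using totally_bounded[OF \<epsilon>] by (elim exE conjE)
  \<comment> \<open>Adding \<open>\<one>\<close> puts \<open>z\<close> itself into \<open>q\<close>
    at its original place.\<close>
  define N where "N = insert \<one> N\<^sub>0"
  have N: "finite N" "N \<subseteq> carrier H" "\<one> \<in> N" using N0 by (auto simp: N_def)
  obtain g q where g1: "g \<one> = \<one>\<^bsub>G\<^esub>" and g_carrier: "\<And>a. a \<in> N \<Longrightarrow> g a \<in> carrier G" and qZ: "q \<in> Z"
    and q: "\<And>a f. \<lbrakk>a \<in> N; f \<in> F\<rbrakk> \<Longrightarrow> agree m (q (f \<otimes>\<^bsub>G\<^esub> g a)) (translate a z f)"
    by (rule ex_spread_pattern[OF good z F(1,2) N]) blast
  define F' where "F' = (\<lambda>(f, a). f \<otimes>\<^bsub>G\<^esub> g a) ` (F \<times> N)"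
  have F'I: "f \<otimes>\<^bsub>G\<^esub> g a \<in> F'" if "f \<in> F" "a \<in> N" for f a
    unfolding F'_def using that by (intro image_eqI[of _ _ "(f, a)"]) auto
  have F'_carrier: "F' \<subseteq> carrier G" using F_carrier g_carrier by (auto simp: F'_def)
  \<comment> \<open>Quantifying over all of \<open>H\<close> and not over the net makes the demand
    invariant under \<open>translate\<close>.\<close>
  define P where "P x \<longleftrightarrow> (\<forall>h\<in>carrier H. \<exists>a\<in>N. \<forall>f\<in>F. close \<epsilon> m h (x (f \<otimes>\<^bsub>G\<^esub> g a)) (z f))"
    for x :: "'g \<Rightarrow> 'h \<times> (nat \<Rightarrow> nat)"
  have local: "P y" if xy: "\<And>f. f \<in> F' \<Longrightarrow> agree m (x f) (y f)" "P x" for x y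
    unfolding P_def
  proof
    fix h assume h: "h \<in> carrier H"
    obtain a where a: "a \<in> N" "\<forall>f\<in>F. close \<epsilon> m h (x (f \<otimes>\<^bsub>G\<^esub> g a)) (z f)"
      using xy(2)[unfolded P_def, rule_format, OF h] by (elim bexE)
    have "close \<epsilon> m h (y (f \<otimes>\<^bsub>G\<^esub> g a)) (z f)" if "f \<in> F" for f
      using a(2) that xy(1)[OF F'I[OF that a(1)]] agree_refl by (blast intro: close_agree)
    then show "\<exists>a\<in>N. \<forall>f\<in>F. close \<epsilon> m h (y (f \<otimes>\<^bsub>G\<^esub> g a)) (z f)" using a(1) by blast
  qed
  have Pq: "P q"
    unfolding P_def
  proof
    fix h assume h: "h \<in> carrier H"
    then obtain a where a: "a \<in> N" "d a h < \<epsilon>" using N0(3) by (auto simp: N_def)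
    have "close \<epsilon> m h (q (f \<otimes>\<^bsub>G\<^esub> g a)) (z f)" if "f \<in> F" for f
    proof -
      \<comment> \<open>Left invariance: the same \<open>a\<close> is good for all places
        \<open>f\<close>.\<close>
      have "d (fst (z f) \<otimes> a) (fst (z f) \<otimes> h) < \<epsilon>"
        using d_left[of a h "fst (z f)"] a h N(2) Hval[OF z F_carrier[OF that]] by auto
      then show ?thesis using q[OF a(1) that] by (auto simp: agree_def close_def translate_def)
    qed
    then show "\<exists>a\<in>N. \<forall>f\<in>F. close \<epsilon> m h (q (f \<otimes>\<^bsub>G\<^esub> g a)) (z f)" using a(1) by blast
  qed
  interpret pat: pattern G "agree m" Z D F' q P
  proof unfold_locales
    show "finite F'" using F(1) N(1) by (simp add: F'_def)
    show "F' \<noteq> {}" using F(3) N(3) by (auto simp: F'_def)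
    show "P y" if "\<And>f. f \<in> F' \<Longrightarrow> agree m (x f) (y f)" "P x" for x y using local that by blast
  qed (use agree_sym D F'_carrier shift qZ Pq in auto)
  let ?W = "pat.W"
  define Z' where "Z' = G.recurrent Z ?W P"
  have Z'Z: "Z' \<subseteq> Z" by (auto simp: Z'_def G.recurrent_def)
  have Z'D: "\<exists>s\<in>carrier G. G.touch ?W s t \<and> P (G.shift s w)" if "w \<in> Z'" "t \<in> carrier G" for w t
    using that unfolding Z'_def G.recurrent_def by simp
  have Z'I: "w \<in> Z'" if "w \<in> Z" "\<And>t. t \<in> carrier G \<Longrightarrow> \<exists>s\<in>carrier G. G.touch ?W s t \<and> P (G.shift s w)" for w
    using that unfolding Z'_def G.recurrent_def by simp
  obtain D' where D': "G.window D'" "G.irreducible (agree m) Z' D'"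
    using pat.recurrent_irreducible unfolding Z'_def by (elim exE conjE)
  have goodZ': "good m Z'"
  proof (rule goodI[OF D'])
    show "fst (w t) \<in> carrier H" if "w \<in> Z'" "t \<in> carrier G" for w t
      using Hval Z'Z that by blast
    show "G.shift r w \<in> Z'" if w: "w \<in> Z'" "r \<in> carrier G" for w r
    proof (rule Z'I)
      show "G.shift r w \<in> Z" using shift w Z'Z by blast
      fix t assume t: "t \<in> carrier G"
      obtain s where s: "s \<in> carrier G" "G.touch ?W s (t \<otimes>\<^bsub>G\<^esub> r)" "P (G.shift s w)"
        using Z'D[OF w(1), of "t \<otimes>\<^bsub>G\<^esub> r"] t w(2) by auto
      \<comment> \<open>Shifting by \<open>r\<close> moves the occurrence from \<open>s\<close> to
        \<open>s'\<close>; touching is preserved because \<open>touch\<close> compares left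
        multiples.\<close>
      define s' where "s' = s \<otimes>\<^bsub>G\<^esub> inv\<^bsub>G\<^esub> r"
      have s': "s' \<in> carrier G" using s w by (simp add: s'_def)
      obtain a b where ab: "a \<in> ?W" "b \<in> ?W" "a \<otimes>\<^bsub>G\<^esub> s = b \<otimes>\<^bsub>G\<^esub> (t \<otimes>\<^bsub>G\<^esub> r)"
        using s(2) unfolding G.touch_def by (elim bexE)
      have "a \<otimes>\<^bsub>G\<^esub> s' = (a \<otimes>\<^bsub>G\<^esub> s) \<otimes>\<^bsub>G\<^esub> inv\<^bsub>G\<^esub> r"
        using pat.W_carrier[OF ab(1)] s w by (simp add: s'_def G.m_assoc)
      also have "\<dots> = b \<otimes>\<^bsub>G\<^esub> t"
        unfolding ab(3) using pat.W_carrier[OF ab(2)] t w by (simp add: G.m_assoc)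
      finally have "G.touch ?W s' t" unfolding G.touch_def using ab by blast
      moreover have "P (G.shift s' (G.shift r w))"
      proof (rule local[OF _ s(3)])
        fix f assume "f \<in> F'"
        then have "f \<in> carrier G" using F'_carrier by blast
        then have "G.shift s' (G.shift r w) f = G.shift s w f"
          using s w by (simp add: G.shift_def s'_def G.m_assoc)
        then show "agree m (G.shift s w f) (G.shift s' (G.shift r w) f)" by (simp add: agree_refl)
      qed
      ultimately show "\<exists>s\<in>carrier G. G.touch ?W s t \<and> P (G.shift s (G.shift r w))" using s' by blast
    qed
    show "translate k w \<in> Z'" if w: "w \<in> Z'" "k \<in> carrier H" for w k
    proof (rule Z'I)
      show "translate k w \<in> Z" using trans w Z'Z by blast
      fix t assume t: "t \<in> carrier G"
      obtain s where s: "s \<in> carrier G" "G.touch ?W s t" "P (G.shift s w)"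
        using Z'D[OF w(1) t] by (elim bexE conjE)
      have "P (G.shift s (translate k w))"
        unfolding P_def
      proof
        fix h assume h: "h \<in> carrier H"
        \<comment> \<open>By right invariance, multiplying by \<open>k\<close> turns an
          approximation of \<open>z\<close> moved by \<open>h \<otimes> inv k\<close> into one of
          \<open>z\<close> moved by \<open>h\<close>.\<close>
        then have hk: "h \<otimes> inv k \<in> carrier H" using w(2) by simp
        obtain a where a: "a \<in> N" "\<forall>f\<in>F. close \<epsilon> m (h \<otimes> inv k) (G.shift s w (f \<otimes>\<^bsub>G\<^esub> g a)) (z f)"
          using s(3)[unfolded P_def, rule_format, OF hk] by (elim bexE)
        have "close \<epsilon> m h (G.shift s (translate k w) (f \<otimes>\<^bsub>G\<^esub> g a)) (z f)" if f: "f \<in> F" for f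
        proof -
          let ?x = "fst (w (f \<otimes>\<^bsub>G\<^esub> g a \<otimes>\<^bsub>G\<^esub> s))"
          have x: "?x \<in> carrier H"
            using Hval Z'Z w(1) F_carrier[OF f] g_carrier[OF a(1)] s(1) by (meson G.m_closed subsetD)
          have zf: "fst (z f) \<in> carrier H" using Hval[OF z F_carrier[OF f]] .
          have "d (?x \<otimes> k) (fst (z f) \<otimes> (h \<otimes> inv k) \<otimes> k) = d ?x (fst (z f) \<otimes> (h \<otimes> inv k))"
            by (rule d_right) (use x zf hk w(2) in auto)
          moreover have "fst (z f) \<otimes> (h \<otimes> inv k) \<otimes> k = fst (z f) \<otimes> h"
            using zf h w(2) by (simp add: m_assoc)
          ultimately show ?thesis
            using a(2) f by (auto simp: close_def G.shift_def translate_def)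
        qed
        then show "\<exists>a\<in>N. \<forall>f\<in>F. close \<epsilon> m h (G.shift s (translate k w) (f \<otimes>\<^bsub>G\<^esub> g a)) (z f)"
          using a(1) by blast
      qed
      then show "\<exists>s\<in>carrier G. G.touch ?W s t \<and> P (G.shift s (translate k w))" using s by blast
    qed
    show "w' \<in> Z'" if w: "w \<in> Z'" "\<And>t. t \<in> carrier G \<Longrightarrow> agree m (w t) (w' t)" for w w'
    proof (rule Z'I)
      show "w' \<in> Z" by (rule insens[of w]) (use w Z'Z in auto)
      fix t assume t: "t \<in> carrier G"
      obtain s where s: "s \<in> carrier G" "G.touch ?W s t" "P (G.shift s w)"
        using Z'D[OF w(1) t] by (elim bexE conjE)
      have "P (G.shift s w')"
      proof (rule local[OF _ s(3)])
        fix f assume "f \<in> F'"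
        then have "f \<otimes>\<^bsub>G\<^esub> s \<in> carrier G" using F'_carrier s(1) by blast
        then show "agree m (G.shift s w f) (G.shift s w' f)" using w(2) by (simp add: G.shift_def)
      qed
      then show "\<exists>s\<in>carrier G. G.touch ?W s t \<and> P (G.shift s w')" using s by blast
    qed
  qed
  obtain z' where z': "z' \<in> Z'" "\<forall>f\<in>F'. agree m (z' f) (q f)"
    using pat.recurrent_realizes unfolding Z'_def by (elim bexE)
  have z'z: "agree m (z' f) (z f)" if f: "f \<in> F" for f
  proof -
    have f1: "f \<otimes>\<^bsub>G\<^esub> g \<one> = f" using F_carrier[OF f] g1 by simp
    have "agree m (z' f) (q f)" using z'(2) F'I[OF f N(3)] unfolding f1 by blast
    moreover have "agree m (q f) (translate \<one> z f)" using q[OF N(3) f] unfolding f1 .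
    moreover have "translate \<one> z f = z f"
      using Hval[OF z F_carrier[OF f]] by (simp add: translate_def)
    ultimately show ?thesis using agree_trans by metis
  qed
  \<comment> \<open>A site \<open>s\<close> with \<open>x s = y t\<close> and a copy at
    \<open>g a s\<close> give the return time \<open>e = g a (inv x) y\<close>, with
    \<open>g a s = e t\<close>; there are finitely many such \<open>e\<close>, for all
    \<open>w\<close>, \<open>t\<close> and \<open>h\<close> together.\<close>
  define E where "E = (\<lambda>(a, x, y). g a \<otimes>\<^bsub>G\<^esub> (inv\<^bsub>G\<^esub> x \<otimes>\<^bsub>G\<^esub> y)) ` (N \<times> ?W \<times> ?W)"
  have "finite E" unfolding E_def using N(1) pat.finite_W by blast
  moreover have "E \<subseteq> carrier G" using g_carrier pat.W_carrier by (auto simp: E_def)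
  moreover have "\<exists>e\<in>E. \<forall>f\<in>F. close \<epsilon> m h (w (f \<otimes>\<^bsub>G\<^esub> (e \<otimes>\<^bsub>G\<^esub> t))) (z f)"
    if w: "w \<in> Z'" "t \<in> carrier G" "h \<in> carrier H" for w t h
  proof -
    obtain s where s: "s \<in> carrier G" "G.touch ?W s t" "P (G.shift s w)"
      using Z'D[OF w(1,2)] by (elim bexE conjE)
    obtain x y where xy: "x \<in> ?W" "y \<in> ?W" "x \<otimes>\<^bsub>G\<^esub> s = y \<otimes>\<^bsub>G\<^esub> t"
      using s(2) unfolding G.touch_def by (elim bexE)
    obtain a where a: "a \<in> N" "\<forall>f\<in>F. close \<epsilon> m h (G.shift s w (f \<otimes>\<^bsub>G\<^esub> g a)) (z f)"
      using s(3)[unfolded P_def, rule_format, OF w(3)] by (elim bexE)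
    note car = pat.W_carrier[OF xy(1)] pat.W_carrier[OF xy(2)] g_carrier[OF a(1)] s(1) w(2)
    have "s = inv\<^bsub>G\<^esub> x \<otimes>\<^bsub>G\<^esub> (x \<otimes>\<^bsub>G\<^esub> s)" using car by (simp add: G.m_assoc[symmetric])
    then have s_eq: "s = inv\<^bsub>G\<^esub> x \<otimes>\<^bsub>G\<^esub> (y \<otimes>\<^bsub>G\<^esub> t)" unfolding xy(3) .
    define e where "e = g a \<otimes>\<^bsub>G\<^esub> (inv\<^bsub>G\<^esub> x \<otimes>\<^bsub>G\<^esub> y)"
    have e: "e \<in> E" unfolding E_def e_def using a(1) xy by (intro image_eqI[of _ _ "(a, x, y)"]) auto
    have et: "e \<otimes>\<^bsub>G\<^esub> t = g a \<otimes>\<^bsub>G\<^esub> s" unfolding s_eq e_def using car by (simp add: G.m_assoc)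
    have "close \<epsilon> m h (w (f \<otimes>\<^bsub>G\<^esub> (e \<otimes>\<^bsub>G\<^esub> t))) (z f)" if f: "f \<in> F" for f
      using a(2)[rule_format, OF f] car F_carrier[OF f] unfolding et by (simp add: G.shift_def G.m_assoc)
    then show ?thesis using e by blast
  qed
  ultimately show ?thesis using goodZ' Z'Z z'(1) z'z
    by (intro exI[of _ Z'] exI[of _ z'] exI[of _ E]) blast
qed

text \<open>Layer \<open>n\<close> is coloured before the pattern is chosen, so that the recurrent
  pattern includes it. Hence \<open>z'\<close> agrees with \<open>z\<close> at level
  \<open>n\<close> only, while recurrence of the part of \<open>z'\<close> on \<open>F\<close> holds
  at level \<open>Suc n\<close>.\<close>

lemma stage:
  assumes good: "good n Z" and z: "z \<in> Z" and F: "finite F" "F \<subseteq> carrier G" "F \<noteq> {}" and \<epsilon>: "0 < \<epsilon>"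
  shows "\<exists>Z' z' E. good (Suc n) Z' \<and> Z' \<subseteq> Z \<and> z' \<in> Z' \<and> (\<forall>w\<in>Z'. proper n w)
    \<and> (\<forall>f\<in>F. agree n (z' f) (z f)) \<and> finite E \<and> E \<subseteq> carrier G
    \<and> (\<forall>w\<in>Z'. \<forall>t\<in>carrier G. \<forall>h\<in>carrier H. \<exists>e\<in>E. \<forall>f\<in>F. close \<epsilon> (Suc n) h (w (f \<otimes>\<^bsub>G\<^esub> (e \<otimes>\<^bsub>G\<^esub> t))) (z' f))"
proof -
  let ?Z = "{z \<in> Z. proper n z}"
  obtain z\<^sub>1 where z1: "z\<^sub>1 \<in> ?Z" "\<forall>t\<in>carrier G. agree n (z t) (z\<^sub>1 t)"
    using colour_step(2)[OF good z] by (elim bexE)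
  obtain Z' z' E where Z': "good (Suc n) Z'" "Z' \<subseteq> ?Z" "z' \<in> Z'" "\<forall>f\<in>F. agree (Suc n) (z' f) (z\<^sub>1 f)"
    "finite E" "E \<subseteq> carrier G"
    "\<forall>w\<in>Z'. \<forall>t\<in>carrier G. \<forall>h\<in>carrier H. \<exists>e\<in>E. \<forall>f\<in>F. close \<epsilon> (Suc n) h (w (f \<otimes>\<^bsub>G\<^esub> (e \<otimes>\<^bsub>G\<^esub> t))) (z\<^sub>1 f)"
    using pattern_step[OF colour_step(1)[OF good] z1(1) F \<epsilon>] by (elim exE conjE)
  have "agree n (z' f) (z f)" if f: "f \<in> F" for f
  proof -
    have "agree n (z' f) (z\<^sub>1 f)" using agree_mono[OF Z'(4)[rule_format, OF f], of n] by simp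
    moreover have "agree n (z\<^sub>1 f) (z f)" using z1(2) f F(2) agree_sym by blast
    ultimately show ?thesis by (rule agree_trans)
  qed
  moreover have "\<exists>e\<in>E. \<forall>f\<in>F. close \<epsilon> (Suc n) h (w (f \<otimes>\<^bsub>G\<^esub> (e \<otimes>\<^bsub>G\<^esub> t))) (z' f)"
    if w: "w \<in> Z'" "t \<in> carrier G" "h \<in> carrier H" for w t h
  proof -
    obtain e where e: "e \<in> E" "\<forall>f\<in>F. close \<epsilon> (Suc n) h (w (f \<otimes>\<^bsub>G\<^esub> (e \<otimes>\<^bsub>G\<^esub> t))) (z\<^sub>1 f)"
      using Z'(7)[rule_format, OF w] by (elim bexE)
    have "close \<epsilon> (Suc n) h (w (f \<otimes>\<^bsub>G\<^esub> (e \<otimes>\<^bsub>G\<^esub> t))) (z' f)" if f: "f \<in> F" for f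
      by (rule close_agree[OF e(2)[rule_format, OF f] agree_refl agree_sym[OF Z'(4)[rule_format, OF f]]])
    then show ?thesis using e(1) by blast
  qed
  ultimately show ?thesis using Z' by (intro exI[of _ Z'] exI[of _ z'] exI[of _ E]) auto
qed

text \<open>The points \<open>z n\<close> stabilise at every place and in every layer. Their limit
  need not lie in the sets \<open>Z n\<close>, but each finite part of it agrees up to any given
  level with some \<open>z k\<close>, and properness and recurrence look at finite parts
  only.\<close>

theorem ex_recurrent_configuration:
  "\<exists>x. (\<forall>t\<in>carrier G. fst (x t) \<in> carrier H) \<and> (\<forall>n. proper n x) \<and>
     (\<forall>F \<epsilon> m. finite F \<longrightarrow> F \<subseteq> carrier G \<longrightarrow> 0 < \<epsilon> \<longrightarrow>
       (\<exists>E. finite E \<and> E \<subseteq> carrier G \<and> (\<forall>t\<in>carrier G. \<forall>h\<in>carrier H.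
          \<exists>e\<in>E. \<forall>f\<in>F. close \<epsilon> m h (x (f \<otimes>\<^bsub>G\<^esub> (e \<otimes>\<^bsub>G\<^esub> t))) (x f))))"
proof -
  define Fn where "Fn n = \<gamma> ` {..n}" for n :: nat
  have Fn: "finite (Fn n)" "Fn n \<subseteq> carrier G" "Fn n \<noteq> {}" for n by (auto simp: Fn_def)
  define Q where "Q n S S' \<longleftrightarrow> fst S' \<subseteq> fst S \<and> (\<forall>w\<in>fst S'. proper n w)
    \<and> (\<forall>f\<in>Fn n. agree n (snd S' f) (snd S f))
    \<and> (\<exists>E. finite E \<and> E \<subseteq> carrier G \<and> (\<forall>w\<in>fst S'. \<forall>t\<in>carrier G. \<forall>h\<in>carrier H. \<exists>e\<in>E. \<forall>f\<in>Fn n.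
         close (1 / real (Suc n)) (Suc n) h (w (f \<otimes>\<^bsub>G\<^esub> (e \<otimes>\<^bsub>G\<^esub> t))) (snd S' f)))"
    for n and S S' :: "('g \<Rightarrow> 'h \<times> (nat \<Rightarrow> nat)) set \<times> ('g \<Rightarrow> 'h \<times> (nat \<Rightarrow> nat))"
  have "\<exists>S. \<forall>n. (good n (fst (S n)) \<and> snd (S n) \<in> fst (S n)) \<and> Q n (S n) (S (Suc n))"
  proof (rule dependent_nat_choice)
    let ?Z = "{z :: 'g \<Rightarrow> 'h \<times> (nat \<Rightarrow> nat). \<forall>t\<in>carrier G. fst (z t) \<in> carrier H}"
    have "(\<lambda>_. (\<one>, \<lambda>_. 0)) \<in> ?Z" by simp
    then show "\<exists>S. good 0 (fst S) \<and> snd S \<in> fst S"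
      using good_full by (intro exI[of _ "(?Z, \<lambda>_. (\<one>, \<lambda>_. 0))"]) auto
    fix S n assume "good n (fst S) \<and> snd S \<in> fst (S :: _ \<times> ('g \<Rightarrow> 'h \<times> (nat \<Rightarrow> nat)))"
    then have S: "good n (fst S)" "snd S \<in> fst S" by auto
    obtain Z' z' E where *: "good (Suc n) Z'" "Z' \<subseteq> fst S" "z' \<in> Z'" "\<forall>w\<in>Z'. proper n w"
      "\<forall>f\<in>Fn n. agree n (z' f) (snd S f)" "finite E" "E \<subseteq> carrier G"
      "\<forall>w\<in>Z'. \<forall>t\<in>carrier G. \<forall>h\<in>carrier H. \<exists>e\<in>E. \<forall>f\<in>Fn n.
        close (1 / real (Suc n)) (Suc n) h (w (f \<otimes>\<^bsub>G\<^esub> (e \<otimes>\<^bsub>G\<^esub> t))) (z' f)"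
      using stage[OF S Fn[of n], of "1 / real (Suc n)"] by (auto elim!: exE)
    have "Q n S (Z', z')" unfolding Q_def fst_conv snd_conv
      by (intro conjI exI[of _ E]) (fact *)+
    then show "\<exists>S'. (good (Suc n) (fst S') \<and> snd S' \<in> fst S') \<and> Q n S S'"
      using *(1,3) by (intro exI[of _ "(Z', z')"]) simp
  qed
  then obtain S where S: "\<And>n. good n (fst (S n))" "\<And>n. snd (S n) \<in> fst (S n)" "\<And>n. Q n (S n) (S (Suc n))"
    by blast
  define Z where "Z n = fst (S n)" for n
  define z where "z n = snd (S n)" for n
  have zZ: "z n \<in> Z n" for n using S(2) by (simp add: Z_def z_def)
  have dec: "Z (Suc n) \<subseteq> Z n" for n using S(3)[of n] by (simp add: Q_def Z_def)
  have proper_Z: "proper n w" if "w \<in> Z (Suc n)" for n w using S(3)[of n] that by (simp add: Q_def Z_def)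
  have step: "agree n (z (Suc n) f) (z n f)" if "f \<in> Fn n" for n f
    using S(3)[of n] that by (simp add: Q_def z_def)
  have rec: "\<exists>E. finite E \<and> E \<subseteq> carrier G \<and> (\<forall>w\<in>Z (Suc n). \<forall>t\<in>carrier G. \<forall>h\<in>carrier H. \<exists>e\<in>E. \<forall>f\<in>Fn n.
         close (1 / real (Suc n)) (Suc n) h (w (f \<otimes>\<^bsub>G\<^esub> (e \<otimes>\<^bsub>G\<^esub> t))) (z (Suc n) f))" for n
    using S(3)[of n] unfolding Q_def Z_def z_def by (elim conjE)
  have decle: "Z n \<subseteq> Z m" if "m \<le> n" for m n
    using that by (induction n rule: dec_induct) (use dec in auto)
  define ix where "ix t = (LEAST i. \<gamma> i = t)" for t
  have ix: "\<gamma> (ix t) = t" if "t \<in> carrier G" for t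
    unfolding ix_def by (rule LeastI_ex) (use that in \<open>auto simp flip: range_\<gamma>\<close>)
  have inF: "t \<in> Fn n" if "t \<in> carrier G" "ix t \<le> n" for t n
    unfolding Fn_def using ix[OF that(1)] that(2) by (intro image_eqI[of _ _ "ix t"]) auto
  have ix_le: "ix t \<le> n" if "t \<in> Fn n" for t n
  proof -
    obtain i where "i \<le> n" "\<gamma> i = t" using \<open>t \<in> Fn n\<close> by (auto simp: Fn_def)
    then show ?thesis unfolding ix_def using Least_le[of "\<lambda>i. \<gamma> i = t" i] by simp
  qed
  have stable: "agree n (z k t) (z n t)" if t: "t \<in> carrier G" and le: "ix t \<le> n" "n \<le> k" for n k t
    using le(2)
  proof (induction k rule: dec_induct)
    case base show ?case by (rule agree_refl)
  next
    case (step k)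
    have "agree k (z (Suc k) t) (z k t)" using \<open>\<And>n f. f \<in> Fn n \<Longrightarrow> agree n (z (Suc n) f) (z n f)\<close>
        inF[OF t, of k] le(1) step(1) by simp
    then have "agree n (z (Suc k) t) (z k t)" using agree_mono step(1) by blast
    then show ?case using step(3) agree_trans by blast
  qed
  \<comment> \<open>Agreement at level \<open>k\<close> controls only layers below \<open>k\<close>,
    so layer \<open>i\<close> at \<open>t\<close> is frozen once the stage has reached both
    \<open>Suc i\<close> and \<open>ix t\<close>.\<close>
  define x where "x t = (fst (z (ix t) t), \<lambda>i. snd (z (max (ix t) (Suc i)) t) i)" for t
  have limit: "agree n (x t) (z k t)" if t: "t \<in> carrier G" and le: "ix t \<le> k" "n \<le> k" for n k t
    unfolding agree_def
  proof (intro conjI allI impI)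
    show "fst (x t) = fst (z k t)"
      using stable[OF t order_refl le(1)] by (simp add: x_def agree_def)
    fix i assume i: "i < n"
    have "agree (max (ix t) (Suc i)) (z k t) (z (max (ix t) (Suc i)) t)"
      by (rule stable[OF t]) (use le i in auto)
    then show "snd (x t) i = snd (z k t) i" by (simp add: x_def agree_def)
  qed
  have limit_fin: "\<exists>k\<ge>n. \<forall>t\<in>A. agree n (x t) (z k t)" if A: "finite A" "A \<subseteq> carrier G" for A n
  proof (intro exI[of _ "max n (Max (ix ` A))"] conjI ballI)
    fix t assume "t \<in> A"
    then have "t \<in> carrier G" "ix t \<le> Max (ix ` A)" using A by auto
    then show "agree n (x t) (z (max n (Max (ix ` A))) t)" by (intro limit) auto
  qed simp
  have "fst (x t) \<in> carrier H" if "t \<in> carrier G" for t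
    using goodD(2)[OF S(1)[of "ix t"] _ that] zZ[of "ix t"] by (simp add: x_def Z_def)
  moreover have "proper n x" for n
    unfolding proper_def
  proof (rule ballI)
    fix t assume t: "t \<in> carrier G"
    obtain k where k: "k \<ge> Suc n" "\<forall>s\<in>{t, \<gamma> n \<otimes>\<^bsub>G\<^esub> t}. agree (Suc n) (x s) (z k s)"
      using limit_fin[of "{t, \<gamma> n \<otimes>\<^bsub>G\<^esub> t}" "Suc n"] t by auto
    have "proper n (z k)" using proper_Z zZ decle[OF k(1)] by blast
    then show "snd (x t) n < 3 \<and> (\<gamma> n \<noteq> \<one>\<^bsub>G\<^esub> \<longrightarrow> snd (x (\<gamma> n \<otimes>\<^bsub>G\<^esub> t)) n \<noteq> snd (x t) n)"
      using k(2) t by (simp add: proper_def agree_def)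
  qed
  moreover have "\<exists>E. finite E \<and> E \<subseteq> carrier G \<and> (\<forall>t\<in>carrier G. \<forall>h\<in>carrier H.
          \<exists>e\<in>E. \<forall>f\<in>F. close \<epsilon> m h (x (f \<otimes>\<^bsub>G\<^esub> (e \<otimes>\<^bsub>G\<^esub> t))) (x f))"
    if F: "finite F" "F \<subseteq> carrier G" and \<epsilon>: "0 < \<epsilon>" for F \<epsilon> m
  proof -
    obtain n\<^sub>0 where n0: "1 / real (Suc n\<^sub>0) < \<epsilon>" using nat_approx_posE[OF \<epsilon>] by metis
    \<comment> \<open>Large enough for the layers below \<open>m\<close>, for the error \<epsilon>
      and for \<open>F \<subseteq> Fn n\<close>.\<close>
    define n where "n = max m (max n\<^sub>0 (Max (ix ` F)))"
    have "1 / real (Suc n) \<le> 1 / real (Suc n\<^sub>0)" by (rule divide_left_mono) (auto simp: n_def)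
    then have n\<epsilon>: "1 / real (Suc n) < \<epsilon>" using n0 by linarith
    have FF: "f \<in> Fn n" if "f \<in> F" for f
    proof -
      have "ix f \<le> Max (ix ` F)" using F that by simp
      then show ?thesis using F(2) that by (intro inF) (auto simp: n_def)
    qed
    obtain E where E: "finite E" "E \<subseteq> carrier G"
      "\<forall>w\<in>Z (Suc n). \<forall>t\<in>carrier G. \<forall>h\<in>carrier H. \<exists>e\<in>E. \<forall>f\<in>Fn n.
         close (1 / real (Suc n)) (Suc n) h (w (f \<otimes>\<^bsub>G\<^esub> (e \<otimes>\<^bsub>G\<^esub> t))) (z (Suc n) f)"
      using rec[of n] by (elim exE conjE)
    have "\<exists>e\<in>E. \<forall>f\<in>F. close \<epsilon> m h (x (f \<otimes>\<^bsub>G\<^esub> (e \<otimes>\<^bsub>G\<^esub> t))) (x f)"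
      if t: "t \<in> carrier G" and h: "h \<in> carrier H" for t h
    proof -
      \<comment> \<open>Finiteness of \<open>E\<close> lets one stage \<open>k\<close> cover every
        place that a return time could lead to; \<open>k\<close> may depend on \<open>t\<close>,
        while \<open>E\<close> does not.\<close>
      let ?A = "(\<lambda>(f, e). f \<otimes>\<^bsub>G\<^esub> (e \<otimes>\<^bsub>G\<^esub> t)) ` (F \<times> E)"
      have "finite ?A" using F(1) E(1) by simp
      moreover have "?A \<subseteq> carrier G" using F(2) E(2) t by auto
      ultimately have "\<exists>k\<ge>Suc n. \<forall>s\<in>?A. agree (Suc n) (x s) (z k s)" by (rule limit_fin)
      then obtain k where k: "k \<ge> Suc n" "\<forall>s\<in>?A. agree (Suc n) (x s) (z k s)" by (elim exE conjE)
      have "z k \<in> Z (Suc n)" using zZ decle[OF k(1)] by blast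
      then obtain e where e: "e \<in> E" "\<forall>f\<in>Fn n. close (1 / real (Suc n)) (Suc n) h (z k (f \<otimes>\<^bsub>G\<^esub> (e \<otimes>\<^bsub>G\<^esub> t))) (z (Suc n) f)"
        using E(3)[rule_format, OF _ t h] by metis
      have "close \<epsilon> m h (x (f \<otimes>\<^bsub>G\<^esub> (e \<otimes>\<^bsub>G\<^esub> t))) (x f)" if f: "f \<in> F" for f
      proof -
        have 1: "agree (Suc n) (x (f \<otimes>\<^bsub>G\<^esub> (e \<otimes>\<^bsub>G\<^esub> t))) (z k (f \<otimes>\<^bsub>G\<^esub> (e \<otimes>\<^bsub>G\<^esub> t)))"
          using k(2) f e(1) by auto
        have 2: "agree (Suc n) (x f) (z (Suc n) f)"
          using limit[of f "Suc n" "Suc n"] f F(2) ix_le[OF FF[OF f]] by auto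
        have "close (1 / real (Suc n)) (Suc n) h (x (f \<otimes>\<^bsub>G\<^esub> (e \<otimes>\<^bsub>G\<^esub> t))) (x f)"
          by (rule close_agree[OF e(2)[rule_format, OF FF[OF f]] agree_sym[OF 1] agree_sym[OF 2]])
        then show ?thesis using n\<epsilon> unfolding close_def by (auto simp: n_def)
      qed
      then show ?thesis using e(1) by blast
    qed
    then show ?thesis using E(1,2) by (intro exI[of _ E]) blast
  qed
  ultimately show ?thesis by (intro exI[of _ x]) blast
qed

end

section \<open>Totally bounded metrics from compact groups\<close>

text \<open>The \<open>b\<close> that violate the bound for some \<open>x\<close> and
  \<open>y\<close> form the projection of a closed set along a compact factor, hence a closed set,
  and \<open>k\<close> is not in it.\<close>

lemma compact_group_equicontinuous:
  fixes f :: "'k \<Rightarrow> real"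
  assumes K: "compact_group K T" and f: "continuous_map T euclideanreal f"
    and k: "k \<in> carrier K" and \<epsilon>: "0 < \<epsilon>"
  shows "\<exists>U. openin T U \<and> k \<in> U \<and> (\<forall>b\<in>U. \<forall>x\<in>carrier K. \<forall>y\<in>carrier K.
    \<bar>f (x \<otimes>\<^bsub>K\<^esub> b \<otimes>\<^bsub>K\<^esub> y) - f (x \<otimes>\<^bsub>K\<^esub> k \<otimes>\<^bsub>K\<^esub> y)\<bar> < \<epsilon>)"
proof -
  interpret K: group K using K by (simp add: compact_group_def)
  have top: "topspace T = carrier K" and cpt: "compact_space T"
    and mult: "continuous_map (prod_topology T T) T (\<lambda>p. fst p \<otimes>\<^bsub>K\<^esub> snd p)"
    using K by (auto simp: compact_group_def)
  let ?X = "prod_topology (prod_topology T T) T"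
  have mulc: "continuous_map ?X T (\<lambda>p. u p \<otimes>\<^bsub>K\<^esub> v p)"
    if "continuous_map ?X T u" "continuous_map ?X T v" for u v
    using continuous_map_compose[OF continuous_map_pairedI[OF that] mult] by (simp add: comp_def)
  have x: "continuous_map ?X T (\<lambda>p. fst (fst p))"
    using continuous_map_compose[OF continuous_map_fst continuous_map_fst] by (simp add: comp_def)
  have y: "continuous_map ?X T (\<lambda>p. snd (fst p))"
    using continuous_map_compose[OF continuous_map_fst continuous_map_snd] by (simp add: comp_def)
  have b: "continuous_map ?X T (\<lambda>p. snd p)" by (rule continuous_map_snd)
  have c: "continuous_map ?X T (\<lambda>p. k)" using k top by simp
  define D where "D p = f (fst (fst p) \<otimes>\<^bsub>K\<^esub> snd p \<otimes>\<^bsub>K\<^esub> snd (fst p)) - f (fst (fst p) \<otimes>\<^bsub>K\<^esub> k \<otimes>\<^bsub>K\<^esub> snd (fst p))" for p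
  have "continuous_map ?X euclideanreal (\<lambda>p. f (fst (fst p) \<otimes>\<^bsub>K\<^esub> snd p \<otimes>\<^bsub>K\<^esub> snd (fst p)))"
    using continuous_map_compose[OF mulc[OF mulc[OF x b] y] f] by (simp add: comp_def)
  moreover have "continuous_map ?X euclideanreal (\<lambda>p. f (fst (fst p) \<otimes>\<^bsub>K\<^esub> k \<otimes>\<^bsub>K\<^esub> snd (fst p)))"
    using continuous_map_compose[OF mulc[OF mulc[OF x c] y] f] by (simp add: comp_def)
  ultimately have D: "continuous_map ?X euclideanreal D"
    unfolding D_def by (rule continuous_map_diff)
  have "closed {r::real. \<epsilon> \<le> \<bar>r\<bar>}" by (intro closed_Collect_le continuous_intros)
  then have "closedin ?X {p \<in> topspace ?X. D p \<in> {r. \<epsilon> \<le> \<bar>r\<bar>}}"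
    by (intro closedin_continuous_map_preimage[OF D]) simp
  then have "closedin T (snd ` {p \<in> topspace ?X. D p \<in> {r. \<epsilon> \<le> \<bar>r\<bar>}})" (is "closedin T ?B")
    using closed_map_snd[of "prod_topology T T" T] cpt
    by (simp add: closed_map_def compact_space_prod_topology)
  then have "openin T (topspace T - ?B)" by blast
  moreover have "k \<in> topspace T - ?B"
    using k \<epsilon> by (auto simp: top D_def)
  moreover have "\<bar>f (x \<otimes>\<^bsub>K\<^esub> b \<otimes>\<^bsub>K\<^esub> y) - f (x \<otimes>\<^bsub>K\<^esub> k \<otimes>\<^bsub>K\<^esub> y)\<bar> < \<epsilon>"
    if "b \<in> topspace T - ?B" "x \<in> carrier K" "y \<in> carrier K" for b x y
  proof (rule ccontr)
    assume "\<not> ?thesis"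
    then have "((x, y), b) \<in> {p \<in> topspace ?X. D p \<in> {r. \<epsilon> \<le> \<bar>r\<bar>}}"
      using that by (auto simp: D_def top)
    then have "b \<in> ?B" by force
    then show False using that(1) by blast
  qed
  ultimately show ?thesis by blast
qed

lemma ex_separating_function:
  fixes K :: "('k, 'c) monoid_scheme" and T :: "'k topology"
  assumes K: "compact_group K T" and k: "k \<in> carrier K" "k \<noteq> \<one>\<^bsub>K\<^esub>"
  shows "\<exists>f :: 'k \<Rightarrow> real. continuous_map T euclideanreal f \<and> (\<forall>x\<in>carrier K. 0 \<le> f x \<and> f x \<le> 1)
    \<and> f \<one>\<^bsub>K\<^esub> = 0 \<and> f k = 1"
proof -
  interpret K: group K using K by (simp add: compact_group_def)
  have top: "topspace T = carrier K" and cpt: "compact_space T" and haus: "Hausdorff_space T"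
    using K by (auto simp: compact_group_def)
  have "normal_space T" using cpt haus compact_Hausdorff_or_regular_imp_normal_space by blast
  moreover have "closedin T {\<one>\<^bsub>K\<^esub>}" "closedin T {k}"
    using closedin_Hausdorff_singleton[OF haus] k top by auto
  moreover have "disjnt {\<one>\<^bsub>K\<^esub>} {k}" using k by auto
  ultimately obtain f where f: "continuous_map T (top_of_set {0..1::real}) f" "f ` {\<one>\<^bsub>K\<^esub>} \<subseteq> {0}" "f ` {k} \<subseteq> {1}"
    using Urysohn_lemma[of T "{\<one>\<^bsub>K\<^esub>}" "{k}" 0 1] by (metis zero_le_one)
  have "continuous_map T euclideanreal f" using f(1) continuous_map_in_subtopology by blast
  moreover have "f x \<in> {0..1}" if "x \<in> carrier K" for x
    using f(1) that top by (auto simp: continuous_map_in_subtopology)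
  ultimately show ?thesis using f(2,3) by (intro exI[of _ f]) auto
qed

text \<open>The supremum runs over two-sided translates of Urysohn functions that separate the
  elements of \<open>H\<close> from the identity. Translation merely permutes the indices, whence
  bi-invariance; the weights \<open>1 / 2 ^ n\<close> leave finitely many functions relevant at
  scale \<epsilon>, and compactness of \<open>K\<close> then gives finite nets.\<close>

lemma ex_bi_invariant_metric:
  fixes H :: "('h, 'b) monoid_scheme" and K :: "('k, 'c) monoid_scheme" and T :: "'k topology"
  assumes H: "group H" "countable (carrier H)" and K: "compact_group K T"
    and \<psi>: "\<psi> \<in> hom H K" "inj_on \<psi> (carrier H)"
  shows "\<exists>d. bi_invariant_metric H d"
proof -
  interpret H: group H by (rule H(1))
  interpret K: group K using K by (simp add: compact_group_def)
  interpret \<psi>: group_hom H K \<psi>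
    by (intro group_hom.intro group_hom_axioms.intro H.group_axioms K.group_axioms \<psi>(1))
  define e where "e = from_nat_into (carrier H)"
  have e: "range e = carrier H"
    unfolding e_def by (rule range_from_nat_into) (use H(2) H.one_closed in auto)
  have e_carrier: "e n \<in> carrier H" for n using e by blast
  have "\<exists>f :: 'k \<Rightarrow> real. continuous_map T euclideanreal f \<and> (\<forall>x\<in>carrier K. 0 \<le> f x \<and> f x \<le> 1)
    \<and> f \<one>\<^bsub>K\<^esub> = 0 \<and> (e n \<noteq> \<one>\<^bsub>H\<^esub> \<longrightarrow> f (\<psi> (e n)) = 1)" for n
  proof (cases "e n = \<one>\<^bsub>H\<^esub>")
    case True
    then show ?thesis by (intro exI[of _ "\<lambda>_. 0"]) auto
  next
    case False
    then have "\<psi> (e n) \<noteq> \<one>\<^bsub>K\<^esub>"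
      using \<psi>(2) e_carrier[of n] \<psi>.hom_one by (metis H.one_closed inj_onD)
    then show ?thesis using ex_separating_function[OF K, of "\<psi> (e n)"] e_carrier by auto
  qed
  then obtain f :: "nat \<Rightarrow> 'k \<Rightarrow> real" where f: "\<And>n. continuous_map T euclideanreal (f n)"
    "\<And>n x. x \<in> carrier K \<Longrightarrow> 0 \<le> f n x \<and> f n x \<le> 1" "\<And>n. f n \<one>\<^bsub>K\<^esub> = 0"
    "\<And>n. e n \<noteq> \<one>\<^bsub>H\<^esub> \<Longrightarrow> f n (\<psi> (e n)) = 1" by metis
  define I where "I = (UNIV :: nat set) \<times> carrier H \<times> carrier H"
  define \<Delta> where "\<Delta> a b = (\<lambda>(n, x, y). \<bar>f n (\<psi> (x \<otimes>\<^bsub>H\<^esub> a \<otimes>\<^bsub>H\<^esub> y)) - f n (\<psi> (x \<otimes>\<^bsub>H\<^esub> b \<otimes>\<^bsub>H\<^esub> y))\<bar> / 2 ^ n)" for a b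
  define d where "d a b = (SUP i\<in>I. \<Delta> a b i)" for a b
  have I_ne: "I \<noteq> {}" by (auto simp: I_def)
  have \<Delta>_le: "\<Delta> a b (n, x, y) \<le> 1 / 2 ^ n"
    if "a \<in> carrier H" "b \<in> carrier H" "x \<in> carrier H" "y \<in> carrier H" for a b n x y
    using f(2)[of "\<psi> (x \<otimes>\<^bsub>H\<^esub> a \<otimes>\<^bsub>H\<^esub> y)" n] f(2)[of "\<psi> (x \<otimes>\<^bsub>H\<^esub> b \<otimes>\<^bsub>H\<^esub> y)" n] that
    by (auto simp: \<Delta>_def divide_right_mono)
  have bdd: "bdd_above (\<Delta> a b ` I)" if "a \<in> carrier H" "b \<in> carrier H" for a b
  proof (rule bdd_aboveI2)
    fix i assume "i \<in> I"
    then obtain n x y where i: "i = (n, x, y)" "x \<in> carrier H" "y \<in> carrier H" by (auto simp: I_def)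
    have "1 / 2 ^ n \<le> (1::real)" by simp
    then show "\<Delta> a b i \<le> 1" unfolding i(1) by (rule order_trans[OF \<Delta>_le[OF that i(2,3)]])
  qed
  have upper: "\<Delta> a b (n, x, y) \<le> d a b"
    if "a \<in> carrier H" "b \<in> carrier H" "x \<in> carrier H" "y \<in> carrier H" for a b n x y
    unfolding d_def by (rule cSUP_upper[OF _ bdd]) (use that in \<open>auto simp: I_def\<close>)
  have least: "d a b \<le> r" if "\<And>n x y. x \<in> carrier H \<Longrightarrow> y \<in> carrier H \<Longrightarrow> \<Delta> a b (n, x, y) \<le> r" for a b r
    unfolding d_def by (rule cSUP_least[OF I_ne]) (use that in \<open>auto simp: I_def\<close>)
  have left_le: "d (c \<otimes>\<^bsub>H\<^esub> a) (c \<otimes>\<^bsub>H\<^esub> b) \<le> d a b"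
    if "a \<in> carrier H" "b \<in> carrier H" "c \<in> carrier H" for a b c
  proof (rule least)
    fix n x y assume "x \<in> carrier H" "y \<in> carrier H"
    then show "\<Delta> (c \<otimes>\<^bsub>H\<^esub> a) (c \<otimes>\<^bsub>H\<^esub> b) (n, x, y) \<le> d a b"
      using upper[of a b "x \<otimes>\<^bsub>H\<^esub> c" y n] that by (simp add: \<Delta>_def H.m_assoc)
  qed
  have right_le: "d (a \<otimes>\<^bsub>H\<^esub> c) (b \<otimes>\<^bsub>H\<^esub> c) \<le> d a b"
    if "a \<in> carrier H" "b \<in> carrier H" "c \<in> carrier H" for a b c
  proof (rule least)
    fix n x y assume "x \<in> carrier H" "y \<in> carrier H"
    then show "\<Delta> (a \<otimes>\<^bsub>H\<^esub> c) (b \<otimes>\<^bsub>H\<^esub> c) (n, x, y) \<le> d a b"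
      using upper[of a b x "c \<otimes>\<^bsub>H\<^esub> y" n] that by (simp add: \<Delta>_def H.m_assoc)
  qed
  have "bi_invariant_metric H d"
  proof (intro bi_invariant_metric.intro bi_invariant_metric_axioms.intro)
    show "group H" by (rule H(1))
    show "d a a = 0" for a
      unfolding d_def \<Delta>_def using I_ne by (simp add: case_prod_beta)
    show "0 < d a b" if ab: "a \<in> carrier H" "b \<in> carrier H" "a \<noteq> b" for a b
    proof -
      \<comment> \<open>The function attached to this element, translated on the left by the inverse
        of \<open>a\<close>, is 0 at \<open>a\<close> and 1 at \<open>b\<close>.\<close>
      let ?c = "inv\<^bsub>H\<^esub> a \<otimes>\<^bsub>H\<^esub> b"
      have "?c \<in> range e" using e ab by simp
      then obtain n where n: "e n = ?c" by (metis imageE)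
      have "?c \<noteq> \<one>\<^bsub>H\<^esub>" using ab by (metis H.inv_closed H.inv_equality H.inv_inv)
      then have "\<Delta> a b (n, inv\<^bsub>H\<^esub> a, \<one>\<^bsub>H\<^esub>) = 1 / 2 ^ n"
        using f(3,4)[of n] n ab by (simp add: \<Delta>_def)
      then show ?thesis using upper[OF ab(1,2), of "inv\<^bsub>H\<^esub> a" "\<one>\<^bsub>H\<^esub>" n] ab(1)
        by (simp add: less_le_trans[of 0 "1 / 2 ^ n"])
    qed
    show "d a b = d b a" for a b
      unfolding d_def \<Delta>_def by (simp add: abs_minus_commute)
    show "d a c \<le> d a b + d b c" if abc: "a \<in> carrier H" "b \<in> carrier H" "c \<in> carrier H" for a b c
    proof (rule least)
      fix n x y assume xy: "x \<in> carrier H" "y \<in> carrier H"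
      have "\<Delta> a c (n, x, y) \<le> \<Delta> a b (n, x, y) + \<Delta> b c (n, x, y)"
        by (auto simp: \<Delta>_def add_divide_distrib[symmetric] intro!: divide_right_mono)
      also have "\<dots> \<le> d a b + d b c" using upper abc xy by (intro add_mono) auto
      finally show "\<Delta> a c (n, x, y) \<le> d a b + d b c" .
    qed
    show "d (c \<otimes>\<^bsub>H\<^esub> a) (c \<otimes>\<^bsub>H\<^esub> b) = d a b" if abc: "a \<in> carrier H" "b \<in> carrier H" "c \<in> carrier H" for a b c
    proof (rule antisym)
      show "d a b \<le> d (c \<otimes>\<^bsub>H\<^esub> a) (c \<otimes>\<^bsub>H\<^esub> b)"
        using left_le[of "c \<otimes>\<^bsub>H\<^esub> a" "c \<otimes>\<^bsub>H\<^esub> b" "inv\<^bsub>H\<^esub> c"] abc by (simp add: H.m_assoc[symmetric])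
    qed (rule left_le[OF abc])
    show "d (a \<otimes>\<^bsub>H\<^esub> c) (b \<otimes>\<^bsub>H\<^esub> c) = d a b" if abc: "a \<in> carrier H" "b \<in> carrier H" "c \<in> carrier H" for a b c
    proof (rule antisym)
      show "d a b \<le> d (a \<otimes>\<^bsub>H\<^esub> c) (b \<otimes>\<^bsub>H\<^esub> c)"
        using right_le[of "a \<otimes>\<^bsub>H\<^esub> c" "b \<otimes>\<^bsub>H\<^esub> c" "inv\<^bsub>H\<^esub> c"] abc by (simp add: H.m_assoc)
    qed (rule right_le[OF abc])
    fix \<epsilon> :: real assume \<epsilon>: "0 < \<epsilon>"
    \<comment> \<open>Indices from \<open>M\<close> on contribute less than
      \<open>\<epsilon> / 2\<close> by weight. For the others the tolerance is
      \<open>\<epsilon> / 4\<close>, since two elements of \<open>H\<close> are compared through a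
      centre \<open>k\<close>.\<close>
    obtain M where M: "(1/2) ^ M < \<epsilon> / 2" using real_arch_pow_inv[of "\<epsilon> / 2" "1/2"] \<epsilon> by auto
    have "\<exists>U. openin T U \<and> k \<in> U \<and> (\<forall>n<M. \<forall>b\<in>U. \<forall>x\<in>carrier K. \<forall>y\<in>carrier K.
      \<bar>f n (x \<otimes>\<^bsub>K\<^esub> b \<otimes>\<^bsub>K\<^esub> y) - f n (x \<otimes>\<^bsub>K\<^esub> k \<otimes>\<^bsub>K\<^esub> y)\<bar> < \<epsilon> / 4)" if k: "k \<in> carrier K" for k
    proof -
      have "\<forall>n. \<exists>U. openin T U \<and> k \<in> U \<and> (\<forall>b\<in>U. \<forall>x\<in>carrier K. \<forall>y\<in>carrier K.
        \<bar>f n (x \<otimes>\<^bsub>K\<^esub> b \<otimes>\<^bsub>K\<^esub> y) - f n (x \<otimes>\<^bsub>K\<^esub> k \<otimes>\<^bsub>K\<^esub> y)\<bar> < \<epsilon> / 4)"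
        using compact_group_equicontinuous[OF K f(1) k, of "\<epsilon> / 4"] \<epsilon> by simp
      then obtain U where U: "\<And>n. openin T (U n)" "\<And>n. k \<in> U n"
        "\<And>n b x y. b \<in> U n \<Longrightarrow> x \<in> carrier K \<Longrightarrow> y \<in> carrier K \<Longrightarrow>
           \<bar>f n (x \<otimes>\<^bsub>K\<^esub> b \<otimes>\<^bsub>K\<^esub> y) - f n (x \<otimes>\<^bsub>K\<^esub> k \<otimes>\<^bsub>K\<^esub> y)\<bar> < \<epsilon> / 4" by metis
      show ?thesis
      proof (intro exI[of _ "topspace T \<inter> (\<Inter>n\<in>{..<M}. U n)"] conjI allI impI ballI)
        show "openin T (topspace T \<inter> (\<Inter>n\<in>{..<M}. U n))"
          by (rule openin_Int_Inter) (use U(1) in auto)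
        show "k \<in> topspace T \<inter> (\<Inter>n\<in>{..<M}. U n)"
          using U(2) k K by (auto simp: compact_group_def)
      qed (use U(3) in auto)
    qed
    then obtain U where U: "\<And>k. k \<in> carrier K \<Longrightarrow> openin T (U k)" "\<And>k. k \<in> carrier K \<Longrightarrow> k \<in> U k"
      "\<And>k n b x y. k \<in> carrier K \<Longrightarrow> n < M \<Longrightarrow> b \<in> U k \<Longrightarrow> x \<in> carrier K \<Longrightarrow> y \<in> carrier K \<Longrightarrow>
         \<bar>f n (x \<otimes>\<^bsub>K\<^esub> b \<otimes>\<^bsub>K\<^esub> y) - f n (x \<otimes>\<^bsub>K\<^esub> k \<otimes>\<^bsub>K\<^esub> y)\<bar> < \<epsilon> / 4" by metis
    have top: "topspace T = carrier K" and cpt: "compactin T (topspace T)"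
      using K by (auto simp: compact_group_def compact_space_def)
    have "\<exists>\<F>. finite \<F> \<and> \<F> \<subseteq> U ` carrier K \<and> topspace T \<subseteq> \<Union>\<F>"
      by (rule compactinD[OF cpt]) (use U(1,2) top in auto)
    then obtain \<F> where "finite \<F>" "\<F> \<subseteq> U ` carrier K" "topspace T \<subseteq> \<Union>\<F>" by (elim exE conjE)
    then obtain A where A: "finite A" "A \<subseteq> carrier K" "topspace T \<subseteq> \<Union>(U ` A)"
      using finite_subset_image[of \<F> U "carrier K"] by auto
    \<comment> \<open>Centres of the cover need not come from \<open>H\<close>, so each is replaced
      by an element of \<open>H\<close> with image in the same open set, if there is one.\<close>
    define p where "p k = (SOME h. h \<in> carrier H \<and> \<psi> h \<in> U k)" for k
    define N where "N = p ` {k \<in> A. \<exists>h\<in>carrier H. \<psi> h \<in> U k}"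
    have p: "p k \<in> carrier H \<and> \<psi> (p k) \<in> U k" if "\<exists>h\<in>carrier H. \<psi> h \<in> U k" for k
      unfolding p_def by (rule someI_ex) (use that in blast)
    have "\<exists>a\<in>N. d a h < \<epsilon>" if h: "h \<in> carrier H" for h
    proof -
      have "\<psi> h \<in> topspace T" using h top by simp
      then obtain k where k: "k \<in> A" "\<psi> h \<in> U k" using A(3) by blast
      have kK: "k \<in> carrier K" using k A(2) by blast
      have pk: "p k \<in> carrier H" "\<psi> (p k) \<in> U k" using p k(2) h by blast+
      have "d (p k) h \<le> \<epsilon> / 2"
      proof (rule least)
        fix n x y assume xy: "x \<in> carrier H" "y \<in> carrier H"
        show "\<Delta> (p k) h (n, x, y) \<le> \<epsilon> / 2"
        proof (cases "n < M")
          case True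
          have "\<bar>f n (\<psi> x \<otimes>\<^bsub>K\<^esub> \<psi> (p k) \<otimes>\<^bsub>K\<^esub> \<psi> y) - f n (\<psi> x \<otimes>\<^bsub>K\<^esub> k \<otimes>\<^bsub>K\<^esub> \<psi> y)\<bar> < \<epsilon> / 4"
            "\<bar>f n (\<psi> x \<otimes>\<^bsub>K\<^esub> \<psi> h \<otimes>\<^bsub>K\<^esub> \<psi> y) - f n (\<psi> x \<otimes>\<^bsub>K\<^esub> k \<otimes>\<^bsub>K\<^esub> \<psi> y)\<bar> < \<epsilon> / 4"
            using U(3)[OF kK True] pk(2) k(2) xy by auto
          then have "\<bar>f n (\<psi> x \<otimes>\<^bsub>K\<^esub> \<psi> (p k) \<otimes>\<^bsub>K\<^esub> \<psi> y) - f n (\<psi> x \<otimes>\<^bsub>K\<^esub> \<psi> h \<otimes>\<^bsub>K\<^esub> \<psi> y)\<bar> \<le> \<epsilon> / 2"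
            by linarith
          then have *: "\<bar>f n (\<psi> (x \<otimes>\<^bsub>H\<^esub> p k \<otimes>\<^bsub>H\<^esub> y)) - f n (\<psi> (x \<otimes>\<^bsub>H\<^esub> h \<otimes>\<^bsub>H\<^esub> y))\<bar> \<le> \<epsilon> / 2"
            using xy pk(1) h by simp
          have "\<Delta> (p k) h (n, x, y) \<le> \<bar>f n (\<psi> (x \<otimes>\<^bsub>H\<^esub> p k \<otimes>\<^bsub>H\<^esub> y)) - f n (\<psi> (x \<otimes>\<^bsub>H\<^esub> h \<otimes>\<^bsub>H\<^esub> y))\<bar> / 1"
            unfolding \<Delta>_def prod.case by (rule divide_left_mono) auto
          then show ?thesis using * by simp
        next
          case False
          then have "(1/2::real) ^ n \<le> (1/2) ^ M" by (intro power_decreasing) auto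
          then show ?thesis using M \<Delta>_le[OF pk(1) h xy, of n] by (simp add: power_divide)
        qed
      qed
      then have "d (p k) h < \<epsilon>" using \<epsilon> by simp
      moreover have "p k \<in> N" unfolding N_def using k h by blast
      ultimately show ?thesis by blast
    qed
    moreover have "finite N" using A(1) by (simp add: N_def)
    moreover have "N \<subseteq> carrier H" using p by (auto simp: N_def)
    ultimately show "\<exists>N. finite N \<and> N \<subseteq> carrier H \<and> (\<forall>h\<in>carrier H. \<exists>a\<in>N. d a h < \<epsilon>)" by blast
  qed
  then show ?thesis by blast
qed

section \<open>Coding the configuration\<close>

context configurations
begin

text \<open>Bits are answers to tests at places \<open>g\<close>: whether the value is within
  \<open>r m\<close> of \<open>k\<close>, or the colour in layer \<open>c\<close> is
  \<open>v\<close>. \<open>G\<close> moves places and \<open>H\<close> moves centres; testing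
  against \<open>k \<otimes> h\<close> amounts to testing the value times \<open>inv h\<close>, so
  recurrence is applied to \<open>inv h\<close>.\<close>

theorem ex_flow:
  assumes countable_H: "countable (carrier H)"
  shows "\<exists>(Y :: (nat \<Rightarrow> bool) topology) (act :: 'g \<Rightarrow> (nat \<Rightarrow> bool) \<Rightarrow> (nat \<Rightarrow> bool)).
           G_flow G Y act \<and> minimal_flow G Y act \<and> free_flow G Y act
           \<and> Y homeomorphic_space cantor_space
           \<and> (\<exists>\<phi>. \<phi> \<in> hom H (Aut_flow G Y act) \<and> inj_on \<phi> (carrier H))"
proof -
  have countable_G: "countable (carrier G)" unfolding range_\<gamma>[symmetric] by simp
  obtain x where x_carrier: "\<forall>t\<in>carrier G. fst (x t) \<in> carrier H" and x_proper: "\<forall>n. proper n x"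
    and x_rec: "\<forall>F \<epsilon> m. finite F \<longrightarrow> F \<subseteq> carrier G \<longrightarrow> 0 < \<epsilon> \<longrightarrow>
       (\<exists>E. finite E \<and> E \<subseteq> carrier G \<and> (\<forall>t\<in>carrier G. \<forall>h\<in>carrier H.
          \<exists>e\<in>E. \<forall>f\<in>F. close \<epsilon> m h (x (f \<otimes>\<^bsub>G\<^esub> (e \<otimes>\<^bsub>G\<^esub> t))) (x f)))"
    using ex_recurrent_configuration by (elim exE conjE)
  \<comment> \<open>Only countably many distances occur, so some radii tending to 0 are never
    attained; this makes the tests stable under small changes of the value.\<close>
  define V where "V = (\<lambda>(t, k). d (fst (x t)) k) ` (carrier G \<times> carrier H)"
  have V_I: "d (fst (x t)) k \<in> V" if "t \<in> carrier G" "k \<in> carrier H" for t k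
    unfolding V_def using that by (intro image_eqI[of _ _ "(t, k)"]) auto
  have "countable V" unfolding V_def using countable_G countable_H by blast
  have "\<exists>r. 0 < r \<and> r < 1 / real (Suc m) \<and> r \<notin> V" for m
  proof -
    have "uncountable ({0<..<1 / real (Suc m)} - V)"
      by (rule uncountable_minus_countable) (use \<open>countable V\<close> in \<open>simp_all add: uncountable_open_interval\<close>)
    then have "{0<..<1 / real (Suc m)} - V \<noteq> {}" using countable_empty by metis
    then show ?thesis by auto
  qed
  then obtain r where r: "\<And>m. 0 < r m" "\<And>m. r m < 1 / real (Suc m)" "\<And>m. r m \<notin> V" by metis
  define I :: "('g \<times> ('h \<times> nat + nat \<times> nat)) set"
    where "I = carrier G \<times> (carrier H \<times> UNIV <+> UNIV)"
  have I_cases: thesis if "i \<in> I" "\<And>g k m. \<lbrakk>i = (g, Inl (k, m)); g \<in> carrier G; k \<in> carrier H\<rbrakk> \<Longrightarrow> thesis"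
    "\<And>g c v. \<lbrakk>i = (g, Inr (c, v)); g \<in> carrier G\<rbrakk> \<Longrightarrow> thesis" for i thesis
    using that by (auto simp: I_def)
  have "countable I" unfolding I_def using countable_G countable_H by (intro countable_SIGMA countable_Plus) auto
  moreover have "infinite I"
  proof
    assume "finite I"
    then have "finite (fst ` I)" by simp
    moreover have "fst ` I = carrier G" by (force simp: I_def)
    ultimately show False using infinite_G by simp
  qed
  ultimately obtain dec :: "nat \<Rightarrow> 'g \<times> ('h \<times> nat + nat \<times> nat)" where dec: "bij_betw dec UNIV I"
    by (rule countable_infiniteE')
  define enc where "enc = inv_into UNIV dec"
  have dec_I: "dec n \<in> I" for n using dec bij_betwE by blast
  have dec_enc: "dec (enc i) = i" if "i \<in> I" for i
    using dec that by (simp add: enc_def bij_betw_inv_into_right)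
  have enc_dec: "enc (dec n) = n" for n
    using dec by (simp add: enc_def bij_betw_inv_into_left)
  define val where "val = (\<lambda>(g, j). case j of Inl (k, m) \<Rightarrow> d (fst (x g)) k < r m
    | Inr (c, v) \<Rightarrow> snd (x g) c = v)"
  have val: "val (g, Inl (k, m)) \<longleftrightarrow> d (fst (x g)) k < r m" "val (g, Inr (c, v)) \<longleftrightarrow> snd (x g) c = v"
    for g k m c v by (simp_all add: val_def)
  define \<sigma>' where "\<sigma>' s = (\<lambda>(g, j). (g \<otimes>\<^bsub>G\<^esub> s, j :: 'h \<times> nat + nat \<times> nat))" for s
  define \<tau>' where "\<tau>' h = (\<lambda>(g :: 'g, j). (g, case j of Inl (k, m) \<Rightarrow> Inl (k \<otimes> h, m :: nat)
    | Inr p \<Rightarrow> Inr (p :: nat \<times> nat)))" for h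
  have \<sigma>'_I: "\<sigma>' s i \<in> I" if "i \<in> I" "s \<in> carrier G" for i s
    using that by (auto simp: \<sigma>'_def I_def)
  have \<tau>'_I: "\<tau>' h i \<in> I" if "i \<in> I" "h \<in> carrier H" for i h
    using that by (auto simp: \<tau>'_def I_def)
  define y\<^sub>0 where "y\<^sub>0 n = val (dec n)" for n
  define \<sigma> where "\<sigma> s n = enc (\<sigma>' s (dec n))" for s n
  define \<tau> where "\<tau> h n = enc (\<tau>' h (dec n))" for h n
  have dec_\<sigma>: "dec (\<sigma> s n) = \<sigma>' s (dec n)" if "s \<in> carrier G" for s n
    unfolding \<sigma>_def by (rule dec_enc[OF \<sigma>'_I[OF dec_I that]])
  have dec_\<tau>: "dec (\<tau> h n) = \<tau>' h (dec n)" if "h \<in> carrier H" for h n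
    unfolding \<tau>_def by (rule dec_enc[OF \<tau>'_I[OF dec_I that]])
  have dec_inj: "a = b" if "dec a = dec b" for a b using that enc_dec by metis
  have "recurrent_point G H \<sigma> \<tau> y\<^sub>0"
  proof (intro recurrent_point.intro recurrent_point_axioms.intro)
    show "group G" by (rule G.group_axioms)
    show "group H" by (rule group_axioms)
    show "infinite (carrier G)" by (rule infinite_G)
    show "\<sigma> \<one>\<^bsub>G\<^esub> n = n" for n
      by (rule dec_inj, cases rule: I_cases[OF dec_I[of n]]) (simp_all add: dec_\<sigma> \<sigma>'_def)
    show "\<sigma> (s \<otimes>\<^bsub>G\<^esub> t) n = \<sigma> t (\<sigma> s n)" if "s \<in> carrier G" "t \<in> carrier G" for s t n
      by (rule dec_inj, cases rule: I_cases[OF dec_I[of n]]) (use that in \<open>simp_all add: dec_\<sigma> \<sigma>'_def G.m_assoc\<close>)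
    show "\<tau> \<one> n = n" for n
      by (rule dec_inj, cases rule: I_cases[OF dec_I[of n]]) (simp_all add: dec_\<tau> \<tau>'_def)
    show "\<tau> (h \<otimes> h') n = \<tau> h' (\<tau> h n)" if "h \<in> carrier H" "h' \<in> carrier H" for h h' n
      by (rule dec_inj, cases rule: I_cases[OF dec_I[of n]]) (use that in \<open>simp_all add: dec_\<tau> \<tau>'_def m_assoc\<close>)
    show "\<sigma> s (\<tau> h n) = \<tau> h (\<sigma> s n)" if "s \<in> carrier G" "h \<in> carrier H" for s h n
      by (rule dec_inj, cases rule: I_cases[OF dec_I[of n]])
        (use that in \<open>simp_all add: dec_\<tau> dec_\<sigma> \<tau>'_def \<sigma>'_def\<close>)
    show "\<exists>E. finite E \<and> E \<subseteq> carrier G \<and>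
          (\<forall>t\<in>carrier G. \<exists>e\<in>E. \<forall>n<k. y\<^sub>0 (\<sigma> (e \<otimes>\<^bsub>G\<^esub> t) n) = y\<^sub>0 (\<tau> h n))"
      if h: "h \<in> carrier H" for h k
    proof -
      define A where "A = dec ` {..<k}"
      have A: "finite A" "A \<subseteq> I" using dec_I by (auto simp: A_def)
      \<comment> \<open>Moving a value by less than the gap cannot change the answer. Colour tests
        are exact and get the default 1.\<close>
      define gap where "gap = (\<lambda>(g, j). case j of Inl (a, m) \<Rightarrow> \<bar>d (fst (x g)) (a \<otimes> h) - r m\<bar>
        | Inr (c :: nat, v :: nat) \<Rightarrow> 1)"
      define \<epsilon> where "\<epsilon> = Min (insert 1 (gap ` A))"
      define M where "M = Max (insert 0 ((\<lambda>(g, j). case j of Inl a \<Rightarrow> 0 | Inr (c, v) \<Rightarrow> Suc c) ` A))"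
      have gap_pos: "0 < gap i" if "i \<in> I" for i
      proof (cases rule: I_cases[OF that])
        case (1 g a m)
        then have "r m \<noteq> d (fst (x g)) (a \<otimes> h)" using V_I[of g "a \<otimes> h"] r(3)[of m] h by auto
        then show ?thesis using 1 by (simp add: gap_def)
      qed (simp add: gap_def)
      have "0 < \<epsilon>" unfolding \<epsilon>_def using A gap_pos by (subst Min_gr_iff) auto
      have \<epsilon>_le: "\<epsilon> \<le> gap i" if "i \<in> A" for i unfolding \<epsilon>_def using A(1) that by simp
      have M_gr: "c < M" if "(g, Inr (c, v)) \<in> A" for g c v
      proof -
        have "Suc c \<in> insert 0 ((\<lambda>(g, j). case j of Inl a \<Rightarrow> 0 | Inr (c, v) \<Rightarrow> Suc c) ` A)"
          using that by (intro insertI2 image_eqI[of _ _ "(g, Inr (c, v))"]) auto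
        then have "Suc c \<le> M" unfolding M_def using A(1) by (intro Max_ge) auto
        then show ?thesis by simp
      qed
      have "finite (fst ` A)" "fst ` A \<subseteq> carrier G" using A by (auto simp: I_def)
      then obtain E where E: "finite E" "E \<subseteq> carrier G" "\<forall>t\<in>carrier G. \<forall>h\<in>carrier H.
          \<exists>e\<in>E. \<forall>f\<in>fst ` A. close \<epsilon> M h (x (f \<otimes>\<^bsub>G\<^esub> (e \<otimes>\<^bsub>G\<^esub> t))) (x f)"
        using x_rec[rule_format, of "fst ` A" \<epsilon> M] \<open>0 < \<epsilon>\<close> by metis
      have "\<exists>e\<in>E. \<forall>n<k. y\<^sub>0 (\<sigma> (e \<otimes>\<^bsub>G\<^esub> t) n) = y\<^sub>0 (\<tau> h n)" if t: "t \<in> carrier G" for t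
      proof -
        obtain e where e: "e \<in> E" "\<forall>f\<in>fst ` A. close \<epsilon> M (inv h) (x (f \<otimes>\<^bsub>G\<^esub> (e \<otimes>\<^bsub>G\<^esub> t))) (x f)"
          using E(3)[rule_format, OF t inv_closed[OF h]] by (elim bexE)
        have et: "e \<otimes>\<^bsub>G\<^esub> t \<in> carrier G" using e(1) E(2) t by blast
        have "y\<^sub>0 (\<sigma> (e \<otimes>\<^bsub>G\<^esub> t) n) = y\<^sub>0 (\<tau> h n)" if n: "n < k" for n
        proof -
          have nA: "dec n \<in> A" using n by (simp add: A_def)
          show ?thesis
          proof (cases rule: I_cases[OF dec_I[of n]])
            case (1 g a m)
            let ?u = "fst (x (g \<otimes>\<^bsub>G\<^esub> (e \<otimes>\<^bsub>G\<^esub> t)))" and ?w = "fst (x g) \<otimes> inv h"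
            have car: "?u \<in> carrier H" "fst (x g) \<in> carrier H" "?w \<in> carrier H" "a \<in> carrier H"
              using x_carrier 1 et h by auto
            have "g \<in> fst ` A" using nA 1(1) by force
            then have "d ?u ?w < \<epsilon>" using e(2) by (auto simp: close_def)
            also have "\<epsilon> \<le> \<bar>d (fst (x g)) (a \<otimes> h) - r m\<bar>" using \<epsilon>_le[OF nA] 1 by (simp add: gap_def)
            also have "d (fst (x g)) (a \<otimes> h) = d (?w \<otimes> h) (a \<otimes> h)"
              using car h by (simp add: m_assoc)
            also have "\<dots> = d ?w a" by (rule d_right[OF car(3,4) h])
            finally have "d ?u ?w < \<bar>d ?w a - r m\<bar>" .
            moreover have "d ?u a \<le> d ?u ?w + d ?w a" "d ?w a \<le> d ?u ?w + d ?u a"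
              using d_triangle[OF car(1,3,4)] d_triangle[OF car(3,1,4)] d_sym[OF car(1,3)] by auto
            ultimately have "d ?u a < r m \<longleftrightarrow> d ?w a < r m" by linarith
            moreover have "d (fst (x g)) (a \<otimes> h) = d ?w a"
              using d_right[OF car(3,4) h] car h by (simp add: m_assoc)
            ultimately show ?thesis
              using 1 et h by (simp add: y\<^sub>0_def dec_\<sigma> dec_\<tau> \<sigma>'_def \<tau>'_def val)
          next
            case (2 g c v)
            have "g \<in> fst ` A" using nA 2(1) by force
            moreover have "c < M" using M_gr nA 2(1) by simp
            ultimately have "snd (x (g \<otimes>\<^bsub>G\<^esub> (e \<otimes>\<^bsub>G\<^esub> t))) c = snd (x g) c" using e(2) by (auto simp: close_def)
            then show ?thesis
              using 2 et h by (simp add: y\<^sub>0_def dec_\<sigma> dec_\<tau> \<sigma>'_def \<tau>'_def val)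
          qed
        qed
        then show ?thesis using e(1) by blast
      qed
      then show ?thesis using E(1,2) by (intro exI[of _ E]) blast
    qed
    show "\<exists>k. \<forall>t\<in>carrier G. \<exists>n<k. y\<^sub>0 (\<sigma> t n) \<noteq> y\<^sub>0 (\<sigma> t (\<sigma> g n))"
      if g: "g \<in> carrier G" "g \<noteq> \<one>\<^bsub>G\<^esub>" for g
    proof -
      have "g \<in> range \<gamma>" using g(1) range_\<gamma> by simp
      then obtain c where c: "\<gamma> c = g" by (metis imageE)
      \<comment> \<open>Three tests matter, one for each colour of layer \<open>c\<close> at the
        identity. The test for the colour at \<open>t\<close> succeeds at \<open>t\<close> and fails
        at \<open>g t\<close>.\<close>
      define ni where "ni v = enc (\<one>\<^bsub>G\<^esub>, Inr (c, v))" for v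
      have dec_ni: "dec (ni v) = (\<one>\<^bsub>G\<^esub>, Inr (c, v))" for v
        unfolding ni_def by (rule dec_enc) (auto simp: I_def)
      define k where "k = Suc (Max (ni ` {..<3}))"
      have "\<exists>n<k. y\<^sub>0 (\<sigma> t n) \<noteq> y\<^sub>0 (\<sigma> t (\<sigma> g n))" if t: "t \<in> carrier G" for t
      proof -
        let ?v = "snd (x t) c"
        have v: "?v < 3" "snd (x (g \<otimes>\<^bsub>G\<^esub> t)) c \<noteq> ?v"
          using x_proper[rule_format, of c] g(2) t c by (auto simp: proper_def)
        have "ni ?v \<le> Max (ni ` {..<3})" using v(1) by (intro Max_ge) auto
        then have "ni ?v < k" by (simp add: k_def)
        moreover have "y\<^sub>0 (\<sigma> t (ni ?v))"
          using t by (simp add: y\<^sub>0_def dec_\<sigma> dec_ni \<sigma>'_def val)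
        moreover have "\<not> y\<^sub>0 (\<sigma> t (\<sigma> g (ni ?v)))"
          using t g(1) v(2) by (simp add: y\<^sub>0_def dec_\<sigma> dec_ni \<sigma>'_def val)
        ultimately show ?thesis by blast
      qed
      then show ?thesis by blast
    qed
    show "\<exists>n. y\<^sub>0 (\<tau> h n) \<noteq> y\<^sub>0 n" if h: "h \<in> carrier H" "h \<noteq> \<one>" for h
    proof -
      let ?a = "fst (x \<one>\<^bsub>G\<^esub>)"
      have a: "?a \<in> carrier H" using x_carrier by simp
      have "0 < d \<one> h" using d_pos[of \<one> h] h by auto
      then obtain m where m: "1 / real (Suc m) < d \<one> h" using nat_approx_posE by metis
      \<comment> \<open>The centre is the value at the identity and the radius is below
        \<open>d \<one> h\<close>: the test succeeds, but fails once \<open>\<tau> h\<close> moves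
        the centre from \<open>a\<close> to \<open>a \<otimes> h\<close>, at distance
        \<open>d \<one> h\<close> from \<open>a\<close>.\<close>
      define n where "n = enc (\<one>\<^bsub>G\<^esub>, Inl (?a, m))"
      have dn: "dec n = (\<one>\<^bsub>G\<^esub>, Inl (?a, m))"
        unfolding n_def by (rule dec_enc) (use a in \<open>auto simp: I_def\<close>)
      have "y\<^sub>0 n" using r(1) d_self[OF a] by (simp add: y\<^sub>0_def dn val)
      moreover have "d ?a (?a \<otimes> h) = d \<one> h" using d_left[of \<one> h ?a] a h by simp
      then have "\<not> y\<^sub>0 (\<tau> h n)" using m r(2)[of m] h by (simp add: y\<^sub>0_def dec_\<tau> dn \<tau>'_def val)
      ultimately show ?thesis by blast
    qed
  qed
  then show ?thesis by (rule recurrent_point.flow_exists)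
qed

end

theorem theorem11p5:
  fixes G :: "('g, 'a) monoid_scheme" and H :: "('h, 'b) monoid_scheme"
    and K :: "('k, 'c) monoid_scheme" and T :: "'k topology" and \<psi> :: "'h \<Rightarrow> 'k"
  assumes "group G" and "countable (carrier G)" and "infinite (carrier G)"
    and "group H" and "countable (carrier H)"
    and "compact_group K T" and "\<psi> \<in> hom H K" and "inj_on \<psi> (carrier H)"
  shows "\<exists>(Y :: (nat \<Rightarrow> bool) topology) (act :: 'g \<Rightarrow> (nat \<Rightarrow> bool) \<Rightarrow> (nat \<Rightarrow> bool)).
           G_flow G Y act \<and> minimal_flow G Y act \<and> free_flow G Y act
           \<and> Y homeomorphic_space cantor_space
           \<and> (\<exists>\<phi>. \<phi> \<in> hom H (Aut_flow G Y act) \<and> inj_on \<phi> (carrier H))"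
proof -
  obtain d where d: "bi_invariant_metric H d"
    using ex_bi_invariant_metric[OF assms(4-8)] by (elim exE)
  have "range (from_nat_into (carrier G)) = carrier G"
    by (rule range_from_nat_into) (use assms(2,3) in auto)
  then have "configurations G H d (from_nat_into (carrier G))"
    by (intro configurations.intro configurations_axioms.intro assms(1,3) d)
  then show ?thesis using assms(5) by (rule configurations.ex_flow)
qed

end
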